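(* Let $g\ge 1$ and $2g-2+n\ge 2$. There is a natural surjection of chain complexes $C_*(\Delta_{g,n};\mathbb Q)\to G^{(g,n)}$, decreasing degrees by $2g-1$, which induces isomorphisms $\widetilde H_{k+2g-1}(\Delta_{g,n};\mathbb Q)\xrightarrow{\cong}H_k(G^{(g,n)})$ for all $k$. (Its kernel is the subcomplex spanned by cells $[{\bf G},\omega]$ in which ${\bf G}$ has a vertex of positive weight.)
   Context: A stable $n$-marked weighted graph of genus $g$ is ${\bf G}=(G,m,w)$ with $G$ finite connected (loops, parallel edges allowed), $w\colon V(G)\to\mathbb Z_{\ge0}$, $m\colon\{1,\dots,n\}\to V(G)$ arbitrary, with $b_1(G)+\sum_v w(v)=g$ and $2w(v)-2+\mathrm{val}(v)>0$ for all $v$, $\mathrm{val}(v)$ = number of half-edges at $v$ (loops twice) plus $|m^{-1}(v)|$. Contracting a non-loop edge merges its endpoints (weights add), contracting a loop adds $1$ to the weight. $\Delta_{g,n}$ is the symmetric $\Delta$-complex whose $p$-simplices are isomorphism classes of $({\bf G},\omega)$ with $\omega\colon E(G)\to\{0,\dots,p\}$ bijective, faces by contracting the edges with omitted labels; its realization is the space of tropical curves of type $(g,n)$ of total edge length $1$. Its cellular chain complex $C_*(\Delta_{g,n};\mathbb Q)$ has in degree $p$ generators $[{\bf G},\omega]$, $|E(G)|=p+1$, subject to $[{\bf G},\omega]=\mathrm{sgn}(\sigma)[{\bf G}',\omega']$ whenever an isomorphism ${\bf G}\cong{\bf G}'$ relates $\omega,\omega'$ by the permutation $\sigma$, with differential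 $\partial[{\bf G},\omega]=\sum_i(-1)^i[{\bf G}/e_i,\omega|]$ where $e_i=\omega^{-1}(i)$ and the remaining edges are ordered by $\omega$; its homology is the reduced rational homology of $\Delta_{g,n}$. The marked graph complex $G^{(g,n)}$ is generated by $[\Gamma,\omega,m]$ where $\Gamma$ is a connected graph with $b_1(\Gamma)=g$, $\omega$ a total order on $E(\Gamma)$, $m\colon\{1,\dots,n\}\to V(\Gamma)$ any map, such that at each vertex the number of incident half-edges plus the number of markings is at least $3$; relations $[\Gamma,\omega,m]=\mathrm{sgn}(\sigma)[\Gamma',\omega',m']$ for isomorphisms preserving markings relating the orders by $\sigma$; degree $|E(\Gamma)|-2g$; differential $\partial[\Gamma,\omega,m]=\sum_{i=0}^N(-1)^i[\Gamma/e_i,\omega|_{E\setminus e_i},\pi_i\circ m]$ for $\omega=(e_0<\dots<e_N)$, where terms with $e_i$ a loop are zero and $\pi_i$ is the induced map on vertices. *)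

theory Defs
  imports Complex_Main "HOL-Combinatorics.Permutations"
begin

section \<open>Edge-labelled marked weighted graphs\<close>

text \<open>A graph with vertices 0..nv-1 and edges 0..ne-1; the edge labelling omega is
  the identity on edge indices, i.e. edge i is the edge with label i.  ends i is the set
  of endpoints of edge i (a singleton for a loop).  wt is the vertex weight, mk the
  marking (defined on 1..n).  Values outside the meaningful ranges are normalised to
  fixed defaults, so that equality of records is meaningful.\<close>

record lgraph =
  nv :: nat
  ne :: nat
  ends :: "nat \<Rightarrow> nat set"
  wt :: "nat \<Rightarrow> nat"
  mk :: "nat \<Rightarrow> nat"

definition adj :: "lgraph \<Rightarrow> (nat \<times> nat) set" where
  "adj X = {(u, v). \<exists>i < ne X. u \<in> ends X i \<and> v \<in> ends X i}"

definition wf_lg :: "nat \<Rightarrow> lgraph \<Rightarrow> bool" where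
  "wf_lg n X \<longleftrightarrow>
     (\<forall>i < ne X. ends X i \<subseteq> {..<nv X} \<and> ends X i \<noteq> {} \<and> card (ends X i) \<le> 2) \<and>
     (\<forall>i. ne X \<le> i \<longrightarrow> ends X i = {}) \<and>
     (\<forall>v. nv X \<le> v \<longrightarrow> wt X v = 0) \<and>
     (\<forall>j \<in> {1..n}. mk X j < nv X) \<and>
     (\<forall>j. j \<notin> {1..n} \<longrightarrow> mk X j = 0) \<and>
     0 < nv X \<and> (\<forall>u < nv X. \<forall>v < nv X. (u, v) \<in> (adj X)\<^sup>*)"

text \<open>valence: half-edges at v (loops counted twice) plus number of markings at v\<close>
definition val :: "nat \<Rightarrow> lgraph \<Rightarrow> nat \<Rightarrow> nat" where
  "val n X v = (\<Sum>i<ne X. (if ends X i = {v} then 2 else if v \<in> ends X i then 1 else 0))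
               + card {j \<in> {1..n}. mk X j = v}"

text \<open>first Betti number of a connected graph\<close>
definition b1 :: "lgraph \<Rightarrow> int" where
  "b1 X = int (ne X) - int (nv X) + 1"

definition total_wt :: "lgraph \<Rightarrow> nat" where
  "total_wt X = (\<Sum>v<nv X. wt X v)"

text \<open>isomorphism of marked weighted graphs, acting on edge labels by sigma\<close>
definition iso_by :: "nat \<Rightarrow> lgraph \<Rightarrow> lgraph \<Rightarrow> (nat \<Rightarrow> nat) \<Rightarrow> bool" where
  "iso_by n X Y \<sigma> \<longleftrightarrow> ne X = ne Y \<and> nv X = nv Y \<and> \<sigma> permutes {..<ne X} \<and>
     (\<exists>\<phi>. bij_betw \<phi> {..<nv X} {..<nv Y} \<and>
          (\<forall>i < ne X. ends Y (\<sigma> i) = \<phi> ` ends X i) \<and>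
          (\<forall>v < nv X. wt Y (\<phi> v) = wt X v) \<and>
          (\<forall>j \<in> {1..n}. mk Y j = \<phi> (mk X j)))"

text \<open>contraction of edge i; the remaining edges keep their relative order
  (relabelled 0..ne-2), vertices are renumbered order-preservingly after merging the
  larger endpoint into the smaller one.\<close>
definition contract :: "lgraph \<Rightarrow> nat \<Rightarrow> lgraph" where
  "contract X i =
    (let re = (\<lambda>j. if j < i then j else Suc j) in
     if card (ends X i) = 1 then
       (let a = the_elem (ends X i) in
        X\<lparr> ne := ne X - 1,
           ends := (\<lambda>j. if j < ne X - 1 then ends X (re j) else {}),
           wt := (wt X)(a := wt X a + 1) \<rparr>)
     else
       (let lo = Min (ends X i); hi = Max (ends X i);
            \<pi> = (\<lambda>v. if v = hi then lo else if hi < v then v - 1 else v) in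
        X\<lparr> nv := nv X - 1, ne := ne X - 1,
           ends := (\<lambda>j. if j < ne X - 1 then \<pi> ` ends X (re j) else {}),
           wt := (\<lambda>u. if u < nv X - 1 then (\<Sum>v \<in> {v. v < nv X \<and> \<pi> v = u}. wt X v) else 0),
           mk := (\<lambda>j. \<pi> (mk X j)) \<rparr>))"

section \<open>Rational linear combinations\<close>

definition delta :: "'a \<Rightarrow> 'a \<Rightarrow> rat" where
  "delta X = (\<lambda>Y. if Y = X then 1 else 0)"

inductive_set spanQ :: "('a \<Rightarrow> rat) set \<Rightarrow> ('a \<Rightarrow> rat) set" for S where
  spanQ_zero: "(\<lambda>_. 0) \<in> spanQ S"
| spanQ_step: "x \<in> S \<Longrightarrow> y \<in> spanQ S \<Longrightarrow> (\<lambda>a. c * x a + y a) \<in> spanQ S"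

text \<open>linear extension of a map given on basis elements (for finitely supported f)\<close>
definition lin_ext :: "('a \<Rightarrow> 'b \<Rightarrow> rat) \<Rightarrow> ('a \<Rightarrow> rat) \<Rightarrow> 'b \<Rightarrow> rat" where
  "lin_ext d f = (\<lambda>Y. \<Sum>X \<in> {X. f X \<noteq> 0}. f X * d X Y)"

section \<open>The chain complex of Delta_{g,n}\<close>

text \<open>generators of degree p: |E| = p+1 (p = -1 gives the augmentation, so the
  homology is the reduced homology)\<close>
definition gensD :: "nat \<Rightarrow> nat \<Rightarrow> int \<Rightarrow> lgraph set" where
  "gensD g n p = {X. wf_lg n X \<and> b1 X + int (total_wt X) = int g \<and>
      (\<forall>v < nv X. 2 * int (wt X v) - 2 + int (val n X v) > 0) \<and> int (ne X) = p + 1}"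

definition relgensD :: "nat \<Rightarrow> nat \<Rightarrow> int \<Rightarrow> (lgraph \<Rightarrow> rat) set" where
  "relgensD g n p = {(\<lambda>Z. delta X Z - of_int (sign \<sigma>) * delta Y Z) | X Y \<sigma>.
      X \<in> gensD g n p \<and> Y \<in> gensD g n p \<and> iso_by n X Y \<sigma>}"

definition chD :: "nat \<Rightarrow> nat \<Rightarrow> int \<Rightarrow> (lgraph \<Rightarrow> rat) set" where
  "chD g n p = spanQ (delta ` gensD g n p)"

definition relsD :: "nat \<Rightarrow> nat \<Rightarrow> int \<Rightarrow> (lgraph \<Rightarrow> rat) set" where
  "relsD g n p = spanQ (relgensD g n p)"

definition dD :: "(lgraph \<Rightarrow> rat) \<Rightarrow> lgraph \<Rightarrow> rat" where
  "dD = lin_ext (\<lambda>X Y. \<Sum>i<ne X. (-1) ^ i * (if contract X i = Y then 1 else 0))"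

section \<open>The marked graph complex G^{(g,n)}\<close>

definition gensG :: "nat \<Rightarrow> nat \<Rightarrow> int \<Rightarrow> lgraph set" where
  "gensG g n k = {X. wf_lg n X \<and> (\<forall>v. wt X v = 0) \<and> b1 X = int g \<and>
      (\<forall>v < nv X. 3 \<le> val n X v) \<and> int (ne X) - 2 * int g = k}"

definition relgensG :: "nat \<Rightarrow> nat \<Rightarrow> int \<Rightarrow> (lgraph \<Rightarrow> rat) set" where
  "relgensG g n k = {(\<lambda>Z. delta X Z - of_int (sign \<sigma>) * delta Y Z) | X Y \<sigma>.
      X \<in> gensG g n k \<and> Y \<in> gensG g n k \<and> iso_by n X Y \<sigma>}"

definition chG :: "nat \<Rightarrow> nat \<Rightarrow> int \<Rightarrow> (lgraph \<Rightarrow> rat) set" where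
  "chG g n k = spanQ (delta ` gensG g n k)"

definition relsG :: "nat \<Rightarrow> nat \<Rightarrow> int \<Rightarrow> (lgraph \<Rightarrow> rat) set" where
  "relsG g n k = spanQ (relgensG g n k)"

text \<open>loop contractions give zero\<close>
definition dG :: "(lgraph \<Rightarrow> rat) \<Rightarrow> lgraph \<Rightarrow> rat" where
  "dG = lin_ext (\<lambda>X Y. \<Sum>i \<in> {i. i < ne X \<and> card (ends X i) \<noteq> 1}.
                   (-1) ^ i * (if contract X i = Y then 1 else 0))"

section \<open>The natural map and homology of quotient complexes\<close>

text \<open>[G,omega] maps to [G,omega,m] if all weights vanish, and to 0 otherwise\<close>
definition natmap :: "(lgraph \<Rightarrow> rat) \<Rightarrow> lgraph \<Rightarrow> rat" where
  "natmap f = (\<lambda>Y. if (\<forall>v. wt Y v = 0) then f Y else 0)"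

text \<open>For a complex given as lifted chains C p modulo relations R p with differential d:
  cycles and boundaries in degree p (as subsets of C p).\<close>
definition cycles :: "(int \<Rightarrow> ('a \<Rightarrow> rat) set) \<Rightarrow> (int \<Rightarrow> ('a \<Rightarrow> rat) set)
                      \<Rightarrow> (('a \<Rightarrow> rat) \<Rightarrow> 'a \<Rightarrow> rat) \<Rightarrow> int \<Rightarrow> ('a \<Rightarrow> rat) set" where
  "cycles C R d p = {x \<in> C p. d x \<in> R (p - 1)}"

definition bdries :: "(int \<Rightarrow> ('a \<Rightarrow> rat) set) \<Rightarrow> (int \<Rightarrow> ('a \<Rightarrow> rat) set)
                      \<Rightarrow> (('a \<Rightarrow> rat) \<Rightarrow> 'a \<Rightarrow> rat) \<Rightarrow> int \<Rightarrow> ('a \<Rightarrow> rat) set" where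
  "bdries C R d p = {x \<in> C p. \<exists>y \<in> C (p + 1). (\<lambda>a. x a - d y a) \<in> R p}"

text \<open>the induced map H_p(C/R) \<rightarrow> H_q(C'/R') of F is well defined and bijective\<close>
definition homology_iso where
  "homology_iso C R d C' R' d' F p q \<longleftrightarrow>
     (\<forall>z \<in> cycles C R d p. F z \<in> cycles C' R' d' q) \<and>
     (\<forall>z \<in> bdries C R d p. F z \<in> bdries C' R' d' q) \<and>
     (\<forall>z \<in> cycles C R d p. F z \<in> bdries C' R' d' q \<longrightarrow> z \<in> bdries C R d p) \<and>
     (\<forall>z' \<in> cycles C' R' d' q. \<exists>z \<in> cycles C R d p. (\<lambda>a. F z a - z' a) \<in> bdries C' R' d' q)"

end

(*
  The kernel of the natural map is the complex of graphs with a vertex of positive weight, so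
  everything reduces to its acyclicity, which comes from a homotopy.  Call a vertex of weight 1
  and valence 1 a tip, and the edge at a tip a tail.  The homotopy h sends a graph to the signed
  sum, over the vertices v of positive weight that are not tips, of the graph in which one unit
  of weight at v is replaced by a tail at v.  Modulo isomorphisms and graphs with more tips,
  d h + h d multiplies a generator by the number of such v plus the number of tails whose other
  end is not such a v.  This number is positive for every graph of positive weight, because
  2g - 2 + n >= 2 excludes the single vertex of weight 1 with one marking.  As the number of
  vertices is at most 2g - 2 + n, a descending induction on the number of tips concludes.
*)

theory Submission
  imports Defs
begin

section \<open>Spans and linear extensions\<close>

text \<open>Cells are isomorphism classes up to sign, but chains are functions on labelled graphs.
  So every geometric identity, d d = 0 included, holds only modulo the relations, and most of the
  work is to produce isomorphisms with the right sign. One principle yields all of them: two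
  contractions of the same graph along the same edges are isomorphic, and the edge labels alone fix
  the sign. Tips are excluded from the homotopy because a tail at a tip would leave a vertex of
  weight 0 and valence 2. The obstacle to a diagonal d h + h d is that contracting an edge may merge
  two admissible vertices or, for a loop, create a new one. Unless that edge is a tail, each
  affected graph has more tips than the original, whence the filtration. Graphs with equally many
  tips can have different factors, so the filtration is refined by the factor; dividing by it uses
  rational coefficients. The number 2w - 2 + val is additive under contraction. It controls
  stability, bounds the number of vertices, and its total 2g - 2 + n decides whether the factor is
  positive.\<close>

definition finsupp :: "('a \<Rightarrow> rat) \<Rightarrow> bool" where
  "finsupp f \<longleftrightarrow> finite {a. f a \<noteq> 0}"

lemma finsupp_zero [simp]: "finsupp (\<lambda>_. 0)"
  by (simp add: finsupp_def)

lemma finsupp_delta [simp]: "finsupp (delta X)"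
  by (simp add: finsupp_def delta_def)

lemma finsupp_lincomb:
  assumes "finsupp f" "finsupp g"
  shows "finsupp (\<lambda>a. c * f a + g a)"
proof -
  have "{a. c * f a + g a \<noteq> 0} \<subseteq> {a. f a \<noteq> 0} \<union> {a. g a \<noteq> 0}" by auto
  then show ?thesis using assms unfolding finsupp_def
    by (meson finite_UnI finite_subset)
qed

lemma finsupp_diff_scale:
  assumes "finsupp f" "finsupp g"
  shows "finsupp (\<lambda>a. f a - c * g a)"
  using finsupp_lincomb[OF assms(2,1), of "- c"] by (simp add: algebra_simps)

lemma finsupp_sum:
  assumes "\<And>i. i \<in> I \<Longrightarrow> finsupp (f i)"
  shows "finsupp (\<lambda>a. \<Sum>i\<in>I. c i * f i a)"
proof (cases "finite I")
  case True
  then show ?thesis using assms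
    by (induction I rule: finite_induct) (auto intro: finsupp_lincomb)
qed simp

lemma spanQ_base: "x \<in> S \<Longrightarrow> x \<in> spanQ S"
  using spanQ_step[OF _ spanQ_zero, of x S 1] by simp

lemma spanQ_lincomb:
  assumes "x \<in> spanQ S" "y \<in> spanQ S"
  shows "(\<lambda>a. c * x a + y a) \<in> spanQ S"
  using assms(1)
proof induction
  case spanQ_zero
  then show ?case using assms(2) by simp
next
  case (spanQ_step x z b)
  have "(\<lambda>a. (c * b) * x a + (c * z a + y a)) \<in> spanQ S"
    by (rule spanQ.spanQ_step) (use spanQ_step in auto)
  then show ?case by (simp add: algebra_simps)
qed

lemma spanQ_scale: "x \<in> spanQ S \<Longrightarrow> (\<lambda>a. c * x a) \<in> spanQ S"
  using spanQ_lincomb[OF _ spanQ_zero, of x S c] by simp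

lemma spanQ_add: "x \<in> spanQ S \<Longrightarrow> y \<in> spanQ S \<Longrightarrow> (\<lambda>a. x a + y a) \<in> spanQ S"
  using spanQ_lincomb[of x S y 1] by simp

lemma spanQ_diff: "x \<in> spanQ S \<Longrightarrow> y \<in> spanQ S \<Longrightarrow> (\<lambda>a. x a - y a) \<in> spanQ S"
  using spanQ_lincomb[of y S x "-1"] by simp

lemma spanQ_sum:
  assumes "\<And>i. i \<in> I \<Longrightarrow> f i \<in> spanQ S"
  shows "(\<lambda>a. \<Sum>i\<in>I. c i * f i a) \<in> spanQ S"
proof (cases "finite I")
  case True
  then show ?thesis using assms
    by (induction I rule: finite_induct) (auto intro: spanQ_lincomb spanQ_zero)
qed (simp add: spanQ_zero)

lemma spanQ_least:
  assumes "x \<in> spanQ S" "\<And>s. s \<in> S \<Longrightarrow> s \<in> spanQ T"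
  shows "x \<in> spanQ T"
  using assms(1) by induction (auto intro: spanQ_zero spanQ_lincomb assms(2))

lemma spanQ_mono: "x \<in> spanQ S \<Longrightarrow> S \<subseteq> T \<Longrightarrow> x \<in> spanQ T"
  by (erule spanQ_least) (auto intro: spanQ_base)

lemma spanQ_finsupp:
  assumes "x \<in> spanQ S" "\<And>s. s \<in> S \<Longrightarrow> finsupp s"
  shows "finsupp x"
  using assms(1) by induction (auto intro: finsupp_lincomb assms(2))

text \<open>Passes between the inductive description of a chain and the description by its support.
  The latter suits \<open>natmap\<close>, which merely cuts down the support.\<close>

lemma spanQ_delta: "spanQ (delta ` S) = {f. finsupp f \<and> (\<forall>a. f a \<noteq> 0 \<longrightarrow> a \<in> S)}"
proof (intro set_eqI iffI)
  fix x assume "x \<in> spanQ (delta ` S)"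
  then show "x \<in> {f. finsupp f \<and> (\<forall>a. f a \<noteq> 0 \<longrightarrow> a \<in> S)}"
  proof induction
    case (spanQ_step x y c)
    then have "finsupp (\<lambda>a. c * x a + y a)" by (intro finsupp_lincomb) auto
    moreover have "\<forall>a. c * x a + y a \<noteq> 0 \<longrightarrow> a \<in> S"
      using spanQ_step by (auto simp: delta_def split: if_splits)
    ultimately show ?case by simp
  qed simp
next
  fix f :: "'a \<Rightarrow> rat" assume f: "f \<in> {f. finsupp f \<and> (\<forall>a. f a \<noteq> 0 \<longrightarrow> a \<in> S)}"
  let ?I = "{a. f a \<noteq> 0}"
  have fin: "finite ?I" using f by (simp add: finsupp_def)
  have "(\<lambda>b. \<Sum>a\<in>?I. f a * delta a b) \<in> spanQ (delta ` S)"
    by (rule spanQ_sum) (use f in \<open>auto intro: spanQ_base\<close>)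
  moreover have "(\<Sum>a\<in>?I. f a * delta a b) = f b" for b
  proof -
    have "(\<Sum>a\<in>?I. f a * delta a b) = (\<Sum>a\<in>?I. if a = b then f b else 0)"
      by (rule sum.cong) (auto simp: delta_def)
    then show ?thesis using fin by (simp add: sum.delta)
  qed
  ultimately show "f \<in> spanQ (delta ` S)" by simp
qed

text \<open>Linearity is asked for on finitely supported functions only: \<open>lin_ext\<close> sums
  over the support, and a sum over an infinite set is 0, so \<open>lin_ext d\<close> need not be
  additive on all functions.\<close>

definition fslin :: "(('a \<Rightarrow> rat) \<Rightarrow> 'b \<Rightarrow> rat) \<Rightarrow> bool" where
  "fslin L \<longleftrightarrow> L (\<lambda>_. 0) = (\<lambda>_. 0) \<and>
     (\<forall>c f g. finsupp f \<longrightarrow> finsupp g \<longrightarrow>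
        L (\<lambda>a. c * f a + g a) = (\<lambda>b. c * L f b + L g b))"

lemma fslinD:
  "fslin L \<Longrightarrow> finsupp f \<Longrightarrow> finsupp g \<Longrightarrow>
     L (\<lambda>a. c * f a + g a) = (\<lambda>b. c * L f b + L g b)"
  by (simp add: fslin_def)

lemma fslin_zero: "fslin L \<Longrightarrow> L (\<lambda>_. 0) = (\<lambda>_. 0)"
  by (simp add: fslin_def)

lemma fslin_scale:
  assumes "fslin L" "finsupp f"
  shows "L (\<lambda>a. c * f a) = (\<lambda>b. c * L f b)"
  using fslinD[OF assms finsupp_zero, of c] fslin_zero[OF assms(1)] by simp

lemma fslin_diff_scale:
  assumes "fslin L" "finsupp f" "finsupp g"
  shows "L (\<lambda>a. f a - c * g a) = (\<lambda>b. L f b - c * L g b)"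
  using fslinD[OF assms(1) assms(3,2), of "- c"] by (simp add: algebra_simps)

lemma fslin_diff:
  assumes "fslin L" "finsupp f" "finsupp g"
  shows "L (\<lambda>a. f a - g a) = (\<lambda>b. L f b - L g b)"
  using fslin_diff_scale[OF assms, of 1] by simp

lemma fslin_sum:
  assumes "fslin L" "\<And>i. i \<in> I \<Longrightarrow> finsupp (f i)"
  shows "L (\<lambda>a. \<Sum>i\<in>I. c i * f i a) = (\<lambda>b. \<Sum>i\<in>I. c i * L (f i) b)"
proof (cases "finite I")
  case True
  then show ?thesis using assms(2)
  proof (induction I rule: finite_induct)
    case (insert x F)
    then show ?case
      using fslinD[OF assms(1), of "f x" "\<lambda>a. \<Sum>i\<in>F. c i * f i a" "c x"]
      by (simp add: finsupp_sum)
  qed (simp add: fslin_zero[OF assms(1)])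
qed (simp add: fslin_zero[OF assms(1)])

lemma fslin_spanQ:
  assumes "fslin L" "x \<in> spanQ S" "\<And>s. s \<in> S \<Longrightarrow> finsupp s"
    "\<And>s. s \<in> S \<Longrightarrow> L s \<in> spanQ T"
  shows "L x \<in> spanQ T"
  using assms(2)
proof induction
  case spanQ_zero
  then show ?case by (simp add: fslin_zero[OF assms(1)] spanQ.spanQ_zero)
next
  case (spanQ_step x y c)
  have "finsupp y" using spanQ_step.hyps(2) assms(3) by (rule spanQ_finsupp)
  then show ?case using spanQ_step assms by (simp add: fslinD spanQ_lincomb)
qed

lemma lin_ext_superset:
  assumes "finite A" "{X. f X \<noteq> 0} \<subseteq> A"
  shows "lin_ext d f Y = (\<Sum>X\<in>A. f X * d X Y)"
  unfolding lin_ext_def by (rule sum.mono_neutral_left) (use assms in auto)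

lemma fslin_lin_ext: "fslin (lin_ext d)"
proof -
  have "lin_ext d (\<lambda>a. c * f a + g a) Y = c * lin_ext d f Y + lin_ext d g Y"
    if "finsupp f" "finsupp g" for c f g Y
  proof -
    let ?A = "{a. f a \<noteq> 0} \<union> {a. g a \<noteq> 0}"
    have A: "finite ?A" using that by (simp add: finsupp_def)
    show ?thesis
      unfolding lin_ext_superset[OF A, of f, simplified] lin_ext_superset[OF A, of g, simplified]
      by (subst lin_ext_superset[OF A])
        (auto simp: sum_distrib_left sum.distrib algebra_simps)
  qed
  then show ?thesis by (auto simp: fslin_def lin_ext_def)
qed

lemma lin_ext_delta [simp]: "lin_ext d (delta X) = d X"
proof
  fix Y show "lin_ext d (delta X) Y = d X Y"
    by (subst lin_ext_superset[of "{X}"]) (auto simp: delta_def)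
qed

lemma finsupp_lin_ext:
  assumes "\<And>X. finsupp (d X)"
  shows "finsupp (lin_ext d f)"
  unfolding lin_ext_def by (rule finsupp_sum) (rule assms)

section \<open>Congruence modulo a span\<close>

definition cong_mod :: "('a \<Rightarrow> rat) set \<Rightarrow> ('a \<Rightarrow> rat) \<Rightarrow> ('a \<Rightarrow> rat) \<Rightarrow> bool" where
  "cong_mod S x y \<longleftrightarrow> (\<lambda>a. x a - y a) \<in> spanQ S"

lemma cong_mod_refl [simp]: "cong_mod S x x"
  by (simp add: cong_mod_def spanQ_zero)

lemma cong_mod_trans [trans]: "cong_mod S x y \<Longrightarrow> cong_mod S y z \<Longrightarrow> cong_mod S x z"
  unfolding cong_mod_def using spanQ_add[of "\<lambda>a. x a - y a" S "\<lambda>a. y a - z a"] by simp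

lemma cong_mod_sum:
  assumes "\<And>i. i \<in> I \<Longrightarrow> cong_mod S (f i) (g i)"
  shows "cong_mod S (\<lambda>a. \<Sum>i\<in>I. c i * f i a) (\<lambda>a. \<Sum>i\<in>I. c i * g i a)"
  using spanQ_sum[of I "\<lambda>i a. f i a - g i a" S c] assms
  by (simp add: cong_mod_def right_diff_distrib sum_subtractf)

lemma cong_mod_scale: "cong_mod S f g \<Longrightarrow> cong_mod S (\<lambda>a. c * f a) (\<lambda>a. c * g a)"
  using spanQ_scale[of "\<lambda>a. f a - g a" S c]
  by (simp add: cong_mod_def right_diff_distrib)

lemma cong_mod_add:
  assumes "cong_mod S f g" "cong_mod S f' g'"
  shows "cong_mod S (\<lambda>a. f a + f' a) (\<lambda>a. g a + g' a)"
  using spanQ_add[OF assms[unfolded cong_mod_def]]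
  by (simp add: cong_mod_def algebra_simps)

lemma cong_mod_mono: "cong_mod S x y \<Longrightarrow> S \<subseteq> T \<Longrightarrow> cong_mod T x y"
  unfolding cong_mod_def by (rule spanQ_mono)

section \<open>Removing a point from a permutation\<close>

text \<open>The coface map of the cosimplicial identities. It recovers from a label after a
  contraction the label before it.\<close>

definition skip :: "nat \<Rightarrow> nat \<Rightarrow> nat" where
  "skip i j = (if j < i then j else Suc j)"

text \<open>The cycle i -> i+1 -> ... -> m -> i, which completes \<open>skip i\<close> to a
  permutation. It measures the sign of making the edge with label \<open>i\<close> the last
  one.\<close>

definition move_last :: "nat \<Rightarrow> nat \<Rightarrow> nat \<Rightarrow> nat" where
  "move_last m i j = (if j < m then skip i j else if j = m then i else j)"

text \<open>The cycle is a product of \<open>m - i\<close> adjacent transpositions; descending from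
  \<open>i = m\<close>, each step adds one of them on the left.\<close>

lemma move_last_permutes_sign:
  "i \<le> m \<Longrightarrow> move_last m i permutes {..m} \<and> sign (move_last m i) = (-1) ^ (m - i)"
proof (induction rule: inc_induct)
  case base
  have "move_last m m = id" by (auto simp: move_last_def skip_def)
  then show ?case using permutes_id[of "{..m}"] by (simp add: id_def[symmetric])
next
  case (step i)
  have eq: "move_last m i = transpose i (Suc i) \<circ> move_last m (Suc i)"
    using step.hyps by (auto simp: move_last_def skip_def transpose_def fun_eq_iff)
  have t: "transpose i (Suc i) permutes {..m}"
    by (rule permutes_swap_id) (use step.hyps in auto)
  have "sign (move_last m i) = sign (transpose i (Suc i)) * sign (move_last m (Suc i))"
    unfolding eq using t step.IH by (intro sign_compose permutes_imp_permutation[of "{..m}"]) auto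
  also have "\<dots> = - ((-1) ^ (m - Suc i))" using step.IH by (simp add: sign_swap_id)
  also have "\<dots> = (-1) ^ (m - i)"
    using step.hyps by (simp add: Suc_diff_Suc[symmetric] del: Suc_diff_Suc)
  finally show ?case unfolding eq using permutes_compose[OF conjunct1[OF step.IH] t] by blast
qed

lemmas move_last_permutes = move_last_permutes_sign[THEN conjunct1]
lemmas sign_move_last = move_last_permutes_sign[THEN conjunct2]

lemma skip_inj: "skip i j = skip i k \<Longrightarrow> j = k"
  by (auto simp: skip_def split: if_splits)

lemma bij_betw_skip: "i < Suc m \<Longrightarrow> bij_betw (skip i) {..<m} ({..<Suc m} - {i})"
proof -
  assume i: "i < Suc m"
  have "j \<in> skip i ` {..<m}" if "j < Suc m" "j \<noteq> i" for j
    by (rule image_eqI[of _ _ "if j < i then j else j - 1"]) (use that i in \<open>auto simp: skip_def\<close>)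
  then have "skip i ` {..<m} = {..<Suc m} - {i}" by (auto simp: skip_def split: if_splits)
  then show ?thesis by (auto simp: bij_betw_def inj_on_def dest: skip_inj)
qed

text \<open>The cosimplicial identity; it underlies d d = 0.\<close>

lemma skip_skip: "i \<le> j \<Longrightarrow> skip i (skip j k) = skip (Suc j) (skip i k)"
  by (auto simp: skip_def)

lemma minus_one_power_diff: "i \<le> m \<Longrightarrow> (-1) ^ (m - i) = ((-1) ^ m * (-1) ^ i :: 'a :: comm_ring_1)"
proof -
  assume "i \<le> m"
  then obtain k where m: "m = i + k" using le_Suc_ex by blast
  have "(-1) ^ i * (-1) ^ i = (1 :: 'a)" by (simp flip: power_mult_distrib)
  then show ?thesis by (simp add: m power_add ac_simps)
qed

text \<open>Composing with the cycles that bring \<open>i\<close> and \<open>\<sigma> i\<close> to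
  the last place turns \<open>\<sigma>\<close> into a permutation fixing \<open>m\<close>, and this
  is \<open>\<tau>\<close>. The two cycles contribute (-1)^(m-i) and (-1)^(m-\<sigma> i), which
  gives the sign rule: exactly what makes a face map compatible with relabelling.\<close>

lemma permutes_remove_point:
  assumes s: "\<sigma> permutes {..<Suc m}" and i: "i < Suc m"
  obtains \<tau> where "\<tau> permutes {..<m}" "\<And>j. j < m \<Longrightarrow> \<sigma> (skip i j) = skip (\<sigma> i) (\<tau> j)"
    "sign \<tau> * (-1) ^ i = sign \<sigma> * (-1) ^ \<sigma> i"
proof -
  have si: "\<sigma> i \<le> m" using permutes_in_image[OF s, of i] i by simp
  note [simp] = lessThan_Suc_atMost
  let ?a = "move_last m i" and ?b = "move_last m (\<sigma> i)"
  have a: "?a permutes {..m}" and b: "?b permutes {..m}" and s': "\<sigma> permutes {..m}"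
    using move_last_permutes i si s by auto
  define \<tau> where "\<tau> = inv ?b \<circ> (\<sigma> \<circ> ?a)"
  have t: "\<tau> permutes {..m}" unfolding \<tau>_def
    using permutes_compose[OF permutes_compose[OF a s'] permutes_inv[OF b]] by simp
  have bt: "?b (\<tau> j) = \<sigma> (?a j)" for j
    unfolding \<tau>_def using permutes_inverses(1)[OF b] by simp
  have "\<tau> m = m"
  proof -
    have "?b (\<tau> m) = ?b m" unfolding bt by (simp add: move_last_def)
    then show ?thesis using permutes_inj[OF b] by (simp add: inj_eq)
  qed
  then have tm: "\<tau> permutes {..<m}"
    by (intro permutes_superset[OF t]) (auto simp: le_less)
  have 1: "\<sigma> (skip i j) = skip (\<sigma> i) (\<tau> j)" if "j < m" for j
    using bt[of j] that permutes_in_image[OF tm, of j] by (simp add: move_last_def)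
  have perm: "permutation p" if "p permutes {..m}" for p
    using that by (rule permutes_imp_permutation[rotated]) simp
  have "?b \<circ> \<tau> = \<sigma> \<circ> ?a" using bt by auto
  then have "sign ?b * sign \<tau> = sign \<sigma> * sign ?a"
    using sign_compose[OF perm[OF b] perm[OF t]] sign_compose[OF perm[OF s'] perm[OF a]] by simp
  then have "(-1) ^ m * ((-1) ^ \<sigma> i * sign \<tau>) = (-1) ^ m * ((-1) ^ i * sign \<sigma>)"
    using i si by (simp add: sign_move_last minus_one_power_diff ac_simps)
  then have "(-1) ^ \<sigma> i * sign \<tau> = (-1) ^ i * sign \<sigma>" by simp
  moreover have "(-1) ^ i * (-1) ^ i = (1::int)" "(-1) ^ \<sigma> i * (-1) ^ \<sigma> i = (1::int)"
    by (simp_all flip: power_mult_distrib)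
  ultimately have "sign \<tau> * (-1) ^ i = sign \<sigma> * (-1) ^ \<sigma> i"
    by (metis (no_types, opaque_lifting) mult.assoc mult.commute mult.right_neutral)
  with tm 1 that show ?thesis by blast
qed

section \<open>Contracting a set of edges\<close>

definition adj_on :: "lgraph \<Rightarrow> nat set \<Rightarrow> (nat \<times> nat) set" where
  "adj_on X S = {(u, v). \<exists>i\<in>S. u \<in> ends X i \<and> v \<in> ends X i}"

definition fib :: "lgraph \<Rightarrow> (nat \<Rightarrow> nat) \<Rightarrow> nat \<Rightarrow> nat set" where
  "fib X \<rho> y = {v. v < nv X \<and> \<rho> v = y}"

text \<open>\<open>contraction n X S Y \<kappa> \<rho>\<close>: \<open>Y\<close> is \<open>X\<close> with all edges in \<open>S\<close> contracted, where \<open>\<kappa>\<close> sends an edge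
  of \<open>Y\<close> to the edge of \<open>X\<close> it comes from and \<open>\<rho>\<close> is the quotient map on vertices.  The weight
  condition says that the genus of a vertex of \<open>Y\<close> is the genus of the subgraph collapsed to it;
  this treats loops and non-loops alike.  Isomorphisms are the case \<open>S = {}\<close>, and since \<open>X\<close>,
  \<open>S\<close>, \<open>\<kappa>\<close> determine \<open>Y\<close> up to isomorphism, all isomorphisms needed below come from comparing
  two contractions of one graph.\<close>
definition contraction ::
  "nat \<Rightarrow> lgraph \<Rightarrow> nat set \<Rightarrow> lgraph \<Rightarrow> (nat \<Rightarrow> nat) \<Rightarrow> (nat \<Rightarrow> nat) \<Rightarrow> bool" where
  "contraction n X S Y \<kappa> \<rho> \<longleftrightarrow>
     S \<subseteq> {..<ne X} \<and> bij_betw \<kappa> {..<ne Y} ({..<ne X} - S) \<and> \<rho> ` {..<nv X} = {..<nv Y} \<and>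
     (\<forall>u<nv X. \<forall>v<nv X. \<rho> u = \<rho> v \<longleftrightarrow> (u, v) \<in> (adj_on X S)\<^sup>*) \<and>
     (\<forall>j<ne Y. ends Y j = \<rho> ` ends X (\<kappa> j)) \<and>
     (\<forall>y<nv Y. int (wt Y y) - 1 =
        (\<Sum>v\<in>fib X \<rho> y. int (wt X v) - 1) + int (card {i \<in> S. \<rho> ` ends X i = {y}})) \<and>
     (\<forall>j\<in>{1..n}. mk Y j = \<rho> (mk X j))"

definition half_edges :: "nat set \<Rightarrow> nat \<Rightarrow> nat" where
  "half_edges E v = (if E = {v} then 2 else if v \<in> E then 1 else 0)"

text \<open>For weight w and valence k this is minus the Euler characteristic of a surface of genus
  w with k punctures. Stability says that it is positive at every vertex.\<close>

definition excess :: "nat \<Rightarrow> lgraph \<Rightarrow> nat \<Rightarrow> int" where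
  "excess n X v = 2 * int (wt X v) - 2 + int (val n X v)"

lemma finite_fib [simp]: "finite (fib X \<rho> y)"
  by (simp add: fib_def)

lemma wf_ends:
  assumes "wf_lg n X" "i < ne X"
  shows "ends X i \<subseteq> {..<nv X}" "ends X i \<noteq> {}" "card (ends X i) \<le> 2" "finite (ends X i)"
proof -
  show e: "ends X i \<subseteq> {..<nv X}" "ends X i \<noteq> {}" "card (ends X i) \<le> 2"
    using assms by (auto simp: wf_lg_def)
  show "finite (ends X i)" by (rule finite_subset[OF e(1)]) simp
qed

lemma wf_ends_cases:
  assumes "wf_lg n X" "i < ne X"
  obtains a where "ends X i = {a}" "a < nv X"
  | a b where "ends X i = {a, b}" "a < b" "b < nv X"
proof -
  note e = wf_ends[OF assms]
  then have "card (ends X i) \<noteq> 0" by simp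
  with e(3) consider "card (ends X i) = 1" | "card (ends X i) = 2" by linarith
  then show thesis
  proof cases
    case 1
    then show ?thesis using e(1) that(1) by (auto simp: card_1_singleton_iff)
  next
    case 2
    then obtain a b where "ends X i = {a, b}" "a \<noteq> b" by (auto simp: card_2_iff)
    then show ?thesis using e(1) that(2)[of a b] that(2)[of b a]
      by (cases "a < b") (auto simp: insert_commute)
  qed
qed

lemma wf_connected: "wf_lg n X \<Longrightarrow> u < nv X \<Longrightarrow> v < nv X \<Longrightarrow> (u, v) \<in> (adj X)\<^sup>*"
  by (simp add: wf_lg_def)

lemma wf_mk: "wf_lg n X \<Longrightarrow> j \<in> {1..n} \<Longrightarrow> mk X j < nv X"
  by (simp add: wf_lg_def)

lemma adj_on_edge: "adj_on X {i} = ends X i \<times> ends X i"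
  by (auto simp: adj_on_def)

lemma rtrancl_square: "(u, v) \<in> (B \<times> B)\<^sup>* \<longleftrightarrow> u = v \<or> (u \<in> B \<and> v \<in> B)"
proof
  assume "(u, v) \<in> (B \<times> B)\<^sup>*"
  then show "u = v \<or> (u \<in> B \<and> v \<in> B)" by induction auto
qed auto

text \<open>Half-edges are neither lost nor gained when an edge is pushed forward along
  \<open>\<rho>\<close>; an edge whose ends are identified becomes a loop, which is why loops count
  twice.\<close>

lemma sum_half_edges:
  assumes V: "finite V" and E: "E \<subseteq> V" "E \<noteq> {}" "card E \<le> 2"
  shows "(\<Sum>v\<in>{v \<in> V. \<rho> v = y}. half_edges E v) = half_edges (\<rho> ` E) y"
proof -
  have "finite E" using E V finite_subset by blast
  then have "card E \<noteq> 0" using E by simp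
  with E(3) consider "card E = 1" | "card E = 2" by linarith
  then show ?thesis
  proof cases
    case 1
    then obtain a where a: "E = {a}" by (auto simp: card_1_singleton_iff)
    have "(\<Sum>v\<in>{v \<in> V. \<rho> v = y}. half_edges E v) = (\<Sum>v\<in>{v \<in> V. \<rho> v = y}. if v = a then 2 else 0)"
      by (rule sum.cong) (auto simp: a half_edges_def)
    then show ?thesis using V E by (auto simp: a half_edges_def)
  next
    case 2
    then obtain a b where a: "E = {a, b}" "a \<noteq> b" by (auto simp: card_2_iff)
    have "(\<Sum>v\<in>{v \<in> V. \<rho> v = y}. half_edges E v) =
      (\<Sum>v\<in>{v \<in> V. \<rho> v = y}. (if v = a then 1 else 0) + (if v = b then 1 else 0))"
      by (rule sum.cong) (use a in \<open>auto simp: half_edges_def doubleton_eq_iff\<close>)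
    then show ?thesis using V E a by (auto simp: sum.distrib half_edges_def doubleton_eq_iff)
  qed
qed

lemma val_half_edges:
  "val n X v = (\<Sum>i<ne X. half_edges (ends X i) v) + (\<Sum>j\<in>{1..n}. if mk X j = v then 1 else 0)"
proof -
  have "card {j \<in> {1..n}. mk X j = v} = (\<Sum>j\<in>{1..n}. if mk X j = v then 1 else 0)"
    by (simp add: sum.If_cases Int_def)
  then show ?thesis by (simp add: val_def half_edges_def)
qed

section \<open>Invariants, composition and uniqueness of contractions\<close>

context
  fixes n X S Y \<kappa> \<rho>
  assumes wfX: "wf_lg n X" and contr: "contraction n X S Y \<kappa> \<rho>"
begin

lemma contraction_image: "\<rho> ` {..<nv X} = {..<nv Y}"
  using contr by (simp add: contraction_def)

lemma contraction_lt: "v < nv X \<Longrightarrow> \<rho> v < nv Y"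
  using contraction_image by blast

lemma contraction_surj: "y < nv Y \<Longrightarrow> \<exists>v<nv X. \<rho> v = y"
  using contraction_image by (metis imageE lessThan_iff)

lemma contraction_kernel:
  "u < nv X \<Longrightarrow> v < nv X \<Longrightarrow> \<rho> u = \<rho> v \<longleftrightarrow> (u, v) \<in> (adj_on X S)\<^sup>*"
  using contr by (simp add: contraction_def)

lemma contraction_ends: "j < ne Y \<Longrightarrow> ends Y j = \<rho> ` ends X (\<kappa> j)"
  using contr by (simp add: contraction_def)

lemma contraction_wt:
  "y < nv Y \<Longrightarrow> int (wt Y y) - 1 =
     (\<Sum>v\<in>fib X \<rho> y. int (wt X v) - 1) + int (card {i \<in> S. \<rho> ` ends X i = {y}})"
  using contr by (simp add: contraction_def)

lemma contraction_mk: "j \<in> {1..n} \<Longrightarrow> mk Y j = \<rho> (mk X j)"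
  using contr by (simp add: contraction_def)

lemma contraction_edges: "S \<subseteq> {..<ne X}" "finite S"
proof -
  show S: "S \<subseteq> {..<ne X}" using contr by (simp add: contraction_def)
  show "finite S" by (rule finite_subset[OF S]) simp
qed

lemma contraction_bij: "bij_betw \<kappa> {..<ne Y} ({..<ne X} - S)"
  using contr by (simp add: contraction_def)

lemma contraction_kept: "j < ne Y \<Longrightarrow> \<kappa> j < ne X \<and> \<kappa> j \<notin> S"
  using bij_betwE[OF contraction_bij] by blast

lemma contraction_ne: "ne X = ne Y + card S"
proof -
  have "ne Y = ne X - card S"
    using bij_betw_same_card[OF contraction_bij] contraction_edges by (simp add: card_Diff_subset)
  moreover have "card S \<le> ne X" using card_mono[OF _ contraction_edges(1)] by simp
  ultimately show ?thesis by simp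
qed

lemma contraction_collapsed:
  assumes "i \<in> S"
  shows "\<exists>y<nv Y. \<rho> ` ends X i = {y}"
proof -
  have i: "i < ne X" using assms contraction_edges by auto
  note e = wf_ends[OF wfX i]
  from e(2) obtain a where a: "a \<in> ends X i" by auto
  have "\<rho> b = \<rho> a" if "b \<in> ends X i" for b
    using contraction_kernel[of b a] that a e(1) assms by (auto simp: adj_on_def)
  then have "\<rho> ` ends X i = {\<rho> a}" using a by blast
  moreover have "\<rho> a < nv Y" by (rule contraction_lt) (use a e(1) in auto)
  ultimately show ?thesis by auto
qed

lemma sum_fib: "(\<Sum>y<nv Y. \<Sum>v\<in>fib X \<rho> y. f v) = (\<Sum>v<nv X. f v)"
  using sum.group[of "{..<nv X}" "{..<nv Y}" \<rho> f] contraction_image by (simp add: fib_def)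

lemma sum_collapsed: "(\<Sum>y<nv Y. int (card {i \<in> S. \<rho> ` ends X i = {y}})) = int (card S)"
proof -
  have eq: "{i \<in> S. \<rho> ` ends X i = {y}} = {i \<in> S. the_elem (\<rho> ` ends X i) = y}" for y
    using contraction_collapsed by fastforce
  have "(\<lambda>i. the_elem (\<rho> ` ends X i)) ` S \<subseteq> {..<nv Y}"
    using contraction_collapsed by fastforce
  from sum.group[OF contraction_edges(2) _ this, of "\<lambda>_. 1 :: int"] show ?thesis
    by (simp add: eq)
qed

text \<open>The genus equals \<open>ne + 1\<close> plus the sum of weight minus 1 over all vertices.
  Summed over \<open>Y\<close>, the weight condition raises the last sum by \<open>card S\<close>,
  and the number of edges drops by the same amount.\<close>

lemma contraction_genus: "b1 Y + int (total_wt Y) = b1 X + int (total_wt X)"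
proof -
  have "(\<Sum>y<nv Y. int (wt Y y) - 1) = (\<Sum>v<nv X. int (wt X v) - 1) + int (card S)"
    by (simp add: contraction_wt sum.distrib sum_fib sum_collapsed)
  then show ?thesis by (simp add: b1_def total_wt_def sum_subtractf contraction_ne)
qed

lemma contraction_connected:
  assumes "y < nv Y" "y' < nv Y"
  shows "(y, y') \<in> (adj Y)\<^sup>*"
proof -
  have "(\<rho> u, \<rho> v) \<in> (adj Y)\<^sup>*" if "(u, v) \<in> (adj X)\<^sup>*" for u v
    using that
  proof induction
    case (step v w)
    then obtain i where i: "i < ne X" "v \<in> ends X i" "w \<in> ends X i" by (auto simp: adj_def)
    show ?case
    proof (cases "i \<in> S")
      case True
      then have "\<rho> v = \<rho> w" using contraction_collapsed[OF True] i by (metis imageI singletonD)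
      then show ?thesis using step.IH by simp
    next
      case False
      then obtain j where "j < ne Y" "\<kappa> j = i" using contraction_bij i
        unfolding bij_betw_def by (metis (no_types, lifting) DiffI imageE lessThan_iff)
      then have "(\<rho> v, \<rho> w) \<in> adj Y" using i by (auto simp: adj_def contraction_ends)
      then show ?thesis using step.IH by simp
    qed
  qed simp
  then show ?thesis using assms contraction_surj wf_connected[OF wfX] by metis
qed

lemma contraction_val:
  assumes y: "y < nv Y"
  shows "(\<Sum>v\<in>fib X \<rho> y. val n X v) = val n Y y + 2 * card {i \<in> S. \<rho> ` ends X i = {y}}"
proof -
  have "(\<Sum>v\<in>fib X \<rho> y. \<Sum>i<ne X. half_edges (ends X i) v) =
      (\<Sum>i<ne X. \<Sum>v\<in>fib X \<rho> y. half_edges (ends X i) v)" by (rule sum.swap)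
  also have "\<dots> = (\<Sum>i<ne X. half_edges (\<rho> ` ends X i) y)"
    using sum_half_edges[of "{..<nv X}"] wf_ends[OF wfX]
    by (intro sum.cong) (auto simp: fib_def)
  also have "\<dots> = (\<Sum>i\<in>{..<ne X} - S. half_edges (\<rho> ` ends X i) y)
      + (\<Sum>i\<in>S. half_edges (\<rho> ` ends X i) y)"
    by (rule sum.subset_diff) (use contraction_edges in auto)
  also have "(\<Sum>i\<in>{..<ne X} - S. half_edges (\<rho> ` ends X i) y) = (\<Sum>j<ne Y. half_edges (ends Y j) y)"
    by (subst sum.reindex_bij_betw[OF contraction_bij, symmetric]) (simp add: contraction_ends)
  also have "(\<Sum>i\<in>S. half_edges (\<rho> ` ends X i) y) = (\<Sum>i\<in>S. if \<rho> ` ends X i = {y} then 2 else 0)"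
    by (rule sum.cong) (use contraction_collapsed in \<open>fastforce simp: half_edges_def\<close>)+
  also have "\<dots> = 2 * card {i \<in> S. \<rho> ` ends X i = {y}}"
    using contraction_edges by (simp add: sum.If_cases Int_def)
  finally have half: "(\<Sum>v\<in>fib X \<rho> y. \<Sum>i<ne X. half_edges (ends X i) v) =
    (\<Sum>j<ne Y. half_edges (ends Y j) y) + 2 * card {i \<in> S. \<rho> ` ends X i = {y}}" .
  have "(\<Sum>v\<in>fib X \<rho> y. \<Sum>j\<in>{1..n}. if mk X j = v then 1 else 0 :: nat) =
      (\<Sum>j\<in>{1..n}. \<Sum>v\<in>fib X \<rho> y. if mk X j = v then 1 else 0)" by (rule sum.swap)
  also have "\<dots> = (\<Sum>j\<in>{1..n}. if mk Y j = y then 1 else 0)"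
    by (rule sum.cong) (use wf_mk[OF wfX] in \<open>auto simp: fib_def contraction_mk\<close>)
  finally show ?thesis using half by (simp add: val_half_edges sum.distrib)
qed

text \<open>Each edge collapsed to \<open>y\<close> raises twice the weight term by 2 and removes
  two half-edges, so the contributions cancel. Additivity makes stability pass to
  contractions.\<close>

lemma contraction_excess:
  assumes y: "y < nv Y"
  shows "excess n Y y = (\<Sum>v\<in>fib X \<rho> y. excess n X v)"
proof -
  have "(\<Sum>v\<in>fib X \<rho> y. excess n X v) =
    2 * (\<Sum>v\<in>fib X \<rho> y. int (wt X v) - 1) + int (\<Sum>v\<in>fib X \<rho> y. val n X v)"
    by (simp add: excess_def sum.distrib sum_subtractf sum_distrib_left[symmetric] algebra_simps)
  then show ?thesis using contraction_wt[OF y] by (simp add: contraction_val[OF y] excess_def)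
qed

lemma contraction_gensD:
  assumes X: "X \<in> gensD g n p" and wfY: "wf_lg n Y"
  shows "Y \<in> gensD g n (p - int (card S))"
proof -
  have pos: "excess n X v > 0" if "v < nv X" for v
    using X that by (simp add: gensD_def excess_def)
  have "excess n Y y > 0" if y: "y < nv Y" for y
  proof -
    have "fib X \<rho> y \<noteq> {}" using contraction_surj[OF y] by (auto simp: fib_def)
    then show ?thesis unfolding contraction_excess[OF y]
      by (intro sum_pos) (auto simp: fib_def intro: pos)
  qed
  then show ?thesis using X wfY contraction_genus contraction_ne
    by (simp add: gensD_def excess_def)
qed

text \<open>The point of allowing sets of edges: iterated faces, and faces following isomorphisms,
  become single contractions of the original graph and can be compared there.\<close>

lemma contraction_compose:
  assumes c2: "contraction n Y T Z \<kappa>' \<rho>'"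
  shows "contraction n X (S \<union> \<kappa> ` T) Z (\<kappa> \<circ> \<kappa>') (\<rho>' \<circ> \<rho>)"
proof -
  have T: "T \<subseteq> {..<ne Y}" using c2 by (simp add: contraction_def)
  then have finT: "finite T" using finite_subset by blast
  have b2: "bij_betw \<kappa>' {..<ne Z} ({..<ne Y} - T)" using c2 by (simp add: contraction_def)
  have inj: "inj_on \<kappa> {..<ne Y}" and im: "\<kappa> ` {..<ne Y} = {..<ne X} - S"
    using contraction_bij by (auto simp: bij_betw_def)
  have TS: "\<kappa> ` T \<subseteq> {..<ne X} - S" using T im by blast
  have A: "S \<union> \<kappa> ` T \<subseteq> {..<ne X}" using TS contraction_edges by blast
  have "bij_betw \<kappa> ({..<ne Y} - T) ({..<ne X} - (S \<union> \<kappa> ` T))"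
    unfolding bij_betw_def
  proof
    show "inj_on \<kappa> ({..<ne Y} - T)" by (rule inj_on_subset[OF inj]) simp
    have "\<kappa> ` ({..<ne Y} - T) = \<kappa> ` {..<ne Y} - \<kappa> ` T"
      by (rule inj_on_image_set_diff[OF inj]) (use T in auto)
    then show "\<kappa> ` ({..<ne Y} - T) = {..<ne X} - (S \<union> \<kappa> ` T)"
      using im by auto
  qed
  from bij_betw_trans[OF b2 this]
  have B: "bij_betw (\<kappa> \<circ> \<kappa>') {..<ne Z} ({..<ne X} - (S \<union> \<kappa> ` T))" .
  have C: "(\<rho>' \<circ> \<rho>) ` {..<nv X} = {..<nv Z}"
    using c2 contr by (simp add: contraction_def flip: image_image)
  have k2: "\<rho>' u = \<rho>' v \<longleftrightarrow> (u, v) \<in> (adj_on Y T)\<^sup>*" if "u < nv Y" "v < nv Y" for u v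
    using c2 that by (simp add: contraction_def)
  let ?R = "adj_on X (S \<union> \<kappa> ` T)"
  have R1: "(adj_on X S)\<^sup>* \<subseteq> ?R\<^sup>*" by (rule rtrancl_mono) (auto simp: adj_on_def)
  have eS: "ends X i \<subseteq> {..<nv X}" if "i < ne X" for i using wf_ends[OF wfX that] by simp
  \<comment> \<open>Each step along an edge of \<open>T\<close> comes from an edge of
    \<open>X\<close>; its ends are joined to the neighbouring steps inside fibres of
    \<open>\<rho>\<close>, which are connected by edges of \<open>S\<close>.\<close>
  have lift: "\<forall>u v. u < nv X \<longrightarrow> v < nv X \<longrightarrow> \<rho> u = y \<longrightarrow> \<rho> v = y' \<longrightarrow> (u, v) \<in> ?R\<^sup>*"
    if "(y, y') \<in> (adj_on Y T)\<^sup>*" for y y'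
    using that
  proof induction
    case base
    show ?case
    proof (intro allI impI)
      fix u v assume uv: "u < nv X" "v < nv X" "\<rho> u = y" "\<rho> v = y"
      then have "(u, v) \<in> (adj_on X S)\<^sup>*" using contraction_kernel[of u v] by simp
      then show "(u, v) \<in> ?R\<^sup>*" using R1 by blast
    qed
  next
    case (step y' y'')
    show ?case
    proof (intro allI impI)
      fix u v assume uv: "u < nv X" "v < nv X" "\<rho> u = y" "\<rho> v = y''"
      from step.hyps(2) obtain j where j: "j \<in> T" "y' \<in> ends Y j" "y'' \<in> ends Y j"
        by (auto simp: adj_on_def)
      then have jn: "j < ne Y" using T by auto
      obtain a b where ab: "a \<in> ends X (\<kappa> j)" "b \<in> ends X (\<kappa> j)" "\<rho> a = y'" "\<rho> b = y''"
        using j contraction_ends[OF jn] by auto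
      have ab': "a < nv X" "b < nv X" using ab eS contraction_kept[OF jn] by auto
      have ua: "(u, a) \<in> ?R\<^sup>*" using step.IH uv(1,3) ab(3) ab'(1) by blast
      have ab_R: "(a, b) \<in> ?R" using ab j by (auto simp: adj_on_def)
      have "(b, v) \<in> (adj_on X S)\<^sup>*" using contraction_kernel[of b v] uv ab' ab by simp
      then have "(b, v) \<in> ?R\<^sup>*" using R1 by blast
      then show "(u, v) \<in> ?R\<^sup>*" by (meson ua ab_R rtrancl.rtrancl_into_rtrancl rtrancl_trans)
    qed
  qed
  have push: "\<rho>' (\<rho> u) = \<rho>' (\<rho> v)" if "(u, v) \<in> ?R\<^sup>*" for u v
    using that
  proof induction
    case (step v w)
    then obtain i where i: "i \<in> S \<union> \<kappa> ` T" "v \<in> ends X i" "w \<in> ends X i"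
      by (auto simp: adj_on_def)
    have "\<rho>' (\<rho> v) = \<rho>' (\<rho> w)"
    proof (cases "i \<in> S")
      case True
      then show ?thesis using contraction_collapsed[OF True] i by (metis imageI singletonD)
    next
      case False
      then obtain j where j: "j \<in> T" "i = \<kappa> j" using i by auto
      then have jn: "j < ne Y" using T by auto
      have lt: "v < nv X" "w < nv X" using eS i j contraction_kept[OF jn] by auto
      have "\<rho> v \<in> ends Y j" "\<rho> w \<in> ends Y j" using i j contraction_ends[OF jn] by auto
      then have "(\<rho> v, \<rho> w) \<in> adj_on Y T" using j(1) by (auto simp: adj_on_def)
      then show ?thesis using k2[OF contraction_lt contraction_lt] lt by blast
    qed
    then show ?case using step.IH by simp
  qed simp
  have D: "\<forall>u<nv X. \<forall>v<nv X. (\<rho>' \<circ> \<rho>) u = (\<rho>' \<circ> \<rho>) v \<longleftrightarrow> (u, v) \<in> ?R\<^sup>*"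
  proof (intro allI impI iffI)
    fix u v assume uv: "u < nv X" "v < nv X" "(\<rho>' \<circ> \<rho>) u = (\<rho>' \<circ> \<rho>) v"
    then have "(\<rho> u, \<rho> v) \<in> (adj_on Y T)\<^sup>*" using k2 contraction_lt by simp
    from lift[OF this] uv show "(u, v) \<in> ?R\<^sup>*" by blast
  next
    fix u v assume "(u, v) \<in> ?R\<^sup>*"
    from push[OF this] show "(\<rho>' \<circ> \<rho>) u = (\<rho>' \<circ> \<rho>) v" by simp
  qed
  have E: "\<forall>j<ne Z. ends Z j = (\<rho>' \<circ> \<rho>) ` ends X ((\<kappa> \<circ> \<kappa>') j)"
  proof (intro allI impI)
    fix j assume j: "j < ne Z"
    then have "\<kappa>' j < ne Y" using b2 unfolding bij_betw_def by blast
    then show "ends Z j = (\<rho>' \<circ> \<rho>) ` ends X ((\<kappa> \<circ> \<kappa>') j)"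
      using c2 j contraction_ends by (simp add: contraction_def image_comp)
  qed
  have F: "int (wt Z z) - 1 = (\<Sum>v\<in>fib X (\<rho>' \<circ> \<rho>) z. int (wt X v) - 1)
      + int (card {i \<in> S \<union> \<kappa> ` T. (\<rho>' \<circ> \<rho>) ` ends X i = {z}})" if z: "z < nv Z" for z
  proof -
    have sub: "fib Y \<rho>' z \<subseteq> {..<nv Y}" by (auto simp: fib_def)
    have 1: "(\<Sum>y\<in>fib Y \<rho>' z. \<Sum>v\<in>fib X \<rho> y. int (wt X v) - 1) =
        (\<Sum>v\<in>fib X (\<rho>' \<circ> \<rho>) z. int (wt X v) - 1)"
    proof -
      have "{v \<in> fib X (\<rho>' \<circ> \<rho>) z. \<rho> v = y} = fib X \<rho> y" if "y \<in> fib Y \<rho>' z" for y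
        using that by (auto simp: fib_def)
      moreover have "\<rho> ` fib X (\<rho>' \<circ> \<rho>) z \<subseteq> fib Y \<rho>' z"
        using contraction_lt by (auto simp: fib_def)
      ultimately show ?thesis
        using sum.group[of "fib X (\<rho>' \<circ> \<rho>) z" "fib Y \<rho>' z" \<rho> "\<lambda>v. int (wt X v) - 1"] by simp
    qed
    have 2: "(\<Sum>y\<in>fib Y \<rho>' z. int (card {i \<in> S. \<rho> ` ends X i = {y}})) =
        int (card {i \<in> S. (\<rho>' \<circ> \<rho>) ` ends X i = {z}})"
    proof -
      let ?U = "{i \<in> S. (\<rho>' \<circ> \<rho>) ` ends X i = {z}}" and ?h = "\<lambda>i. the_elem (\<rho> ` ends X i)"
      have "?h ` ?U \<subseteq> fib Y \<rho>' z"
      proof safe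
        fix i assume i: "i \<in> S" "(\<rho>' \<circ> \<rho>) ` ends X i = {z}"
        obtain y where y: "y < nv Y" "\<rho> ` ends X i = {y}" using contraction_collapsed[OF i(1)] by blast
        have "\<rho>' ` \<rho> ` ends X i = {z}" using i(2) by (simp only: image_comp)
        then have "\<rho>' y = z" unfolding y(2) by simp
        then show "?h i \<in> fib Y \<rho>' z" unfolding y(2) using y(1) by (simp add: fib_def)
      qed
      moreover have "{i \<in> ?U. ?h i = y} = {i \<in> S. \<rho> ` ends X i = {y}}" if "y \<in> fib Y \<rho>' z" for y
      proof (intro set_eqI iffI)
        fix i assume i: "i \<in> {i \<in> ?U. ?h i = y}"
        then have iS: "i \<in> S" and h: "?h i = y" by simp_all
        obtain y' where y': "\<rho> ` ends X i = {y'}" using contraction_collapsed[OF iS] by blast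
        with h have "y' = y" by simp
        then show "i \<in> {i \<in> S. \<rho> ` ends X i = {y}}" using iS y' by simp
      next
        fix i assume i: "i \<in> {i \<in> S. \<rho> ` ends X i = {y}}"
        then have e: "i \<in> S" "\<rho> ` ends X i = {y}" by simp_all
        have "\<rho>' ` \<rho> ` ends X i = {z}" unfolding e(2) using that by (simp add: fib_def)
        then have "(\<rho>' \<circ> \<rho>) ` ends X i = {z}" by (simp only: image_comp)
        then show "i \<in> {i \<in> ?U. ?h i = y}" using e by simp
      qed
      ultimately show ?thesis
        using sum.group[of ?U "fib Y \<rho>' z" ?h "\<lambda>_. 1 :: int"] contraction_edges by simp
    qed
    have 3: "card {j \<in> T. \<rho>' ` ends Y j = {z}} = card {i \<in> \<kappa> ` T. (\<rho>' \<circ> \<rho>) ` ends X i = {z}}"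
    proof -
      have "{i \<in> \<kappa> ` T. (\<rho>' \<circ> \<rho>) ` ends X i = {z}} = \<kappa> ` {j \<in> T. \<rho>' ` ends Y j = {z}}"
        using T by (auto simp: contraction_ends image_comp subset_iff)
      moreover have "inj_on \<kappa> {j \<in> T. \<rho>' ` ends Y j = {z}}"
        by (rule inj_on_subset[OF inj]) (use T in auto)
      ultimately show ?thesis by (simp add: card_image)
    qed
    have 4: "card {i \<in> S \<union> \<kappa> ` T. (\<rho>' \<circ> \<rho>) ` ends X i = {z}} =
        card {i \<in> S. (\<rho>' \<circ> \<rho>) ` ends X i = {z}} + card {i \<in> \<kappa> ` T. (\<rho>' \<circ> \<rho>) ` ends X i = {z}}"
      by (subst card_Un_disjoint[symmetric])
        (use TS finT contraction_edges in \<open>auto intro!: arg_cong[where f = card]\<close>)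
    have "int (wt Z z) - 1 = (\<Sum>y\<in>fib Y \<rho>' z. int (wt Y y) - 1)
        + int (card {j \<in> T. \<rho>' ` ends Y j = {z}})"
      using c2 z by (simp add: contraction_def)
    also have "(\<Sum>y\<in>fib Y \<rho>' z. int (wt Y y) - 1) =
        (\<Sum>y\<in>fib Y \<rho>' z. (\<Sum>v\<in>fib X \<rho> y. int (wt X v) - 1)
          + int (card {i \<in> S. \<rho> ` ends X i = {y}}))"
      by (rule sum.cong) (use sub contraction_wt in auto)
    finally show ?thesis by (simp only: sum.distrib 1 2 3 4 of_nat_add add.assoc)
  qed
  have "\<forall>j\<in>{1..n}. mk Z j = \<rho>' (mk Y j)" using c2 by (simp add: contraction_def)
  then have G: "\<forall>j\<in>{1..n}. mk Z j = (\<rho>' \<circ> \<rho>) (mk X j)"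
    using contraction_mk by (metis comp_apply)
  show ?thesis unfolding contraction_def by (intro conjI A B C D E G allI impI F)
qed

text \<open>Both quotient maps have the same kernel, given by connectedness along \<open>S\<close>,
  so \<open>\<rho> v\<close> maps to \<open>\<rho>' v\<close> bijectively. The weight condition
  determines the weights, and only the labelling of the surviving edges is left to
  \<open>\<tau>\<close>.\<close>

lemma contraction_unique:
  assumes c2: "contraction n X S Y' \<kappa>' \<rho>'" and t: "\<tau> permutes {..<ne Y}"
    and eq: "\<And>j. j < ne Y \<Longrightarrow> \<kappa>' (\<tau> j) = \<kappa> j"
  shows "iso_by n Y Y' \<tau>"
proof -
  have ker: "\<rho> u = \<rho> v \<longleftrightarrow> \<rho>' u = \<rho>' v" if "u < nv X" "v < nv X" for u v
    using c2 contraction_kernel that by (simp add: contraction_def)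
  have neY: "ne Y' = ne Y"
    using bij_betw_same_card[of \<kappa>' "{..<ne Y'}" "{..<ne X} - S"] c2
      bij_betw_same_card[OF contraction_bij] by (simp add: contraction_def)
  \<comment> \<open>A section of the quotient map, needed to define \<open>\<phi>\<close> on the
    vertices of \<open>Y\<close>.\<close>
  define s where "s y = (SOME v. v < nv X \<and> \<rho> v = y)" for y
  have s: "s y < nv X" "\<rho> (s y) = y" if "y < nv Y" for y
    using someI_ex[OF contraction_surj[OF that]] by (auto simp: s_def)
  define \<phi> where "\<phi> y = \<rho>' (s y)" for y
  have phi: "\<phi> (\<rho> v) = \<rho>' v" if "v < nv X" for v
    unfolding \<phi>_def using ker s contraction_lt that by blast
  have bij: "bij_betw \<phi> {..<nv Y} {..<nv Y'}"
  proof -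
    have "inj_on \<phi> {..<nv Y}"
      by (rule inj_onI) (metis \<phi>_def ker lessThan_iff s)
    moreover have "\<phi> ` {..<nv Y} = \<rho>' ` {..<nv X}"
    proof -
      have "{..<nv Y} = \<rho> ` {..<nv X}" using contr by (simp add: contraction_def)
      then show ?thesis by (auto simp: image_image phi)
    qed
    ultimately show ?thesis using c2 by (simp add: contraction_def bij_betw_def)
  qed
  have e: "\<phi> ` \<rho> ` ends X i = \<rho>' ` ends X i" if "i < ne X" for i
  proof -
    have "ends X i \<subseteq> {..<nv X}" using wf_ends[OF wfX that] by simp
    then show ?thesis unfolding image_image by (intro image_cong) (auto simp: phi)
  qed
  have ends: "ends Y' (\<tau> j) = \<phi> ` ends Y j" if j: "j < ne Y" for j
  proof -
    have "\<tau> j < ne Y'" using permutes_in_image[OF t] j neY by auto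
    then have "ends Y' (\<tau> j) = \<rho>' ` ends X (\<kappa> j)" using c2 eq[OF j] by (simp add: contraction_def)
    then show ?thesis using e contraction_ends[OF j] contraction_kept[OF j] by simp
  qed
  have wt: "wt Y' (\<phi> y) = wt Y y" if y: "y < nv Y" for y
  proof -
    have y': "\<phi> y < nv Y'" using bij y by (auto simp: bij_betw_def)
    have "fib X \<rho>' (\<phi> y) = fib X \<rho> y"
      using ker[OF _ s(1)[OF y]] s(2)[OF y] by (auto simp: fib_def \<phi>_def)
    moreover have "\<rho>' ` ends X i = {\<phi> y} \<longleftrightarrow> \<rho> ` ends X i = {y}" if iS: "i \<in> S" for i
    proof -
      obtain z where z: "z < nv Y" "\<rho> ` ends X i = {z}" using contraction_collapsed[OF iS] by blast
      have "i < ne X" using iS contraction_edges by auto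
      then have "\<rho>' ` ends X i = {\<phi> z}" using e[of i] z by simp
      then show ?thesis using z y bij by (auto simp: bij_betw_def inj_on_def)
    qed
    then have "{i \<in> S. \<rho>' ` ends X i = {\<phi> y}} = {i \<in> S. \<rho> ` ends X i = {y}}" by auto
    ultimately have "int (wt Y' (\<phi> y)) - 1 = int (wt Y y) - 1"
      unfolding contraction_wt[OF y] using c2 y' by (simp add: contraction_def)
    then show ?thesis by simp
  qed
  have mk: "mk Y' j = \<phi> (mk Y j)" if "j \<in> {1..n}" for j
    using that c2 contraction_mk phi wf_mk[OF wfX] by (simp add: contraction_def)
  have "nv Y = nv Y'" using bij_betw_same_card[OF bij] by simp
  then show ?thesis unfolding iso_by_def using neY t bij ends wt mk by auto
qed

end

text \<open>The inverse appears because \<open>\<sigma>\<close> sends labels of \<open>X\<close> to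
  labels of \<open>Y\<close>, while a contraction traces edges of \<open>Y\<close> back to
  \<open>X\<close>.\<close>

lemma contraction_of_iso:
  assumes "wf_lg n X" and iso: "iso_by n X Y \<sigma>"
  obtains \<phi> where "contraction n X {} Y (inv \<sigma>) \<phi>"
proof -
  from iso obtain \<phi> where e: "ne X = ne Y" "nv X = nv Y" and s: "\<sigma> permutes {..<ne X}"
    and bij: "bij_betw \<phi> {..<nv X} {..<nv Y}"
    and en: "\<forall>i < ne X. ends Y (\<sigma> i) = \<phi> ` ends X i"
    and w: "\<forall>v < nv X. wt Y (\<phi> v) = wt X v" and m: "\<forall>j \<in> {1..n}. mk Y j = \<phi> (mk X j)"
    by (auto simp: iso_by_def)
  have "bij_betw (inv \<sigma>) {..<ne Y} ({..<ne X} - {})"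
    using permutes_imp_bij[OF permutes_inv[OF s]] e by simp
  moreover have "\<phi> u = \<phi> v \<longleftrightarrow> (u, v) \<in> (adj_on X {})\<^sup>*" if "u < nv X" "v < nv X" for u v
    using bij that by (auto simp: adj_on_def bij_betw_def inj_on_def)
  moreover have "ends Y j = \<phi> ` ends X (inv \<sigma> j)" if "j < ne Y" for j
  proof -
    have "inv \<sigma> j < ne X" using permutes_in_image[OF permutes_inv[OF s], of j] that e by simp
    then show ?thesis using en permutes_inverses(1)[OF s, of j] by metis
  qed
  moreover have "int (wt Y y) - 1 = (\<Sum>v\<in>fib X \<phi> y. int (wt X v) - 1)" if y: "y < nv Y" for y
  proof -
    obtain v where v: "v < nv X" "\<phi> v = y" using bij y
      unfolding bij_betw_def by (metis (no_types, lifting) imageE lessThan_iff)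
    then have "fib X \<phi> y = {v}" using bij by (auto simp: fib_def bij_betw_def inj_on_def)
    then show ?thesis using w v by auto
  qed
  ultimately have "contraction n X {} Y (inv \<sigma>) \<phi>"
    unfolding contraction_def using bij m by (simp add: bij_betw_def)
  then show thesis by (rule that)
qed

text \<open>The last three hypotheses concern the default values outside the meaningful ranges,
  which a contraction does not see; connectedness and the bounds are inherited.\<close>

lemma contraction_wf:
  assumes wfX: "wf_lg n X" and contr: "contraction n X S Y \<kappa> \<rho>"
    and "\<And>i. ne Y \<le> i \<Longrightarrow> ends Y i = {}" "\<And>v. nv Y \<le> v \<Longrightarrow> wt Y v = 0"
    "\<And>j. j \<notin> {1..n} \<Longrightarrow> mk Y j = 0"
  shows "wf_lg n Y"
proof -
  note c = wfX contr
  have "ends Y j \<subseteq> {..<nv Y} \<and> ends Y j \<noteq> {} \<and> card (ends Y j) \<le> 2" if j: "j < ne Y" for j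
  proof -
    have k: "\<kappa> j < ne X" using contraction_kept[OF c j] by simp
    note e = wf_ends[OF wfX k]
    have "card (\<rho> ` ends X (\<kappa> j)) \<le> 2" using card_image_le[OF e(4), of \<rho>] e(3) by linarith
    moreover have "\<rho> ` ends X (\<kappa> j) \<subseteq> {..<nv Y}" using e(1) contraction_lt[OF c] by blast
    ultimately show ?thesis using contraction_ends[OF c j] e(2) by simp
  qed
  moreover have "mk Y j < nv Y" if "j \<in> {1..n}" for j
    using contraction_lt[OF c wf_mk[OF wfX that]] contraction_mk[OF c that] by simp
  moreover have "0 < nv Y" using contraction_lt[OF c, of 0] wfX by (auto simp: wf_lg_def)
  ultimately show ?thesis unfolding wf_lg_def
    using assms(3-5) contraction_connected[OF c] by auto
qed

section \<open>Contraction of a single edge\<close>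

lemma contraction_refl: "wf_lg n X \<Longrightarrow> contraction n X {} X id id"
proof -
  have "fib X id y = {y}" if "y < nv X" for y using that by (auto simp: fib_def)
  then show ?thesis by (simp add: contraction_def adj_on_def)
qed

lemma contraction_edgeI:
  assumes "i < ne X" "ne Y = ne X - 1" "\<rho> ` {..<nv X} = {..<nv Y}"
    and "\<And>u v. u < nv X \<Longrightarrow> v < nv X \<Longrightarrow> \<rho> u = \<rho> v \<longleftrightarrow> u = v \<or> (u \<in> ends X i \<and> v \<in> ends X i)"
    and "\<And>j. j < ne Y \<Longrightarrow> ends Y j = \<rho> ` ends X (skip i j)"
    and "\<And>y. y < nv Y \<Longrightarrow> int (wt Y y) - 1 = (\<Sum>v\<in>fib X \<rho> y. int (wt X v) - 1) +
        (if \<rho> ` ends X i = {y} then 1 else 0)"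
    and "\<And>j. j \<in> {1..n} \<Longrightarrow> mk Y j = \<rho> (mk X j)"
  shows "contraction n X {i} Y (skip i) \<rho>"
proof -
  have "bij_betw (skip i) {..<ne Y} ({..<ne X} - {i})"
    using bij_betw_skip[of i "ne X - 1"] assms(1,2) by simp
  moreover have "{i' \<in> {i}. \<rho> ` ends X i' = {y}} = (if \<rho> ` ends X i = {y} then {i} else {})" for y
    by auto
  ultimately show ?thesis using assms
    unfolding contraction_def adj_on_edge rtrancl_square by (auto simp del: One_nat_def)
qed

text \<open>The two branches of \<open>contract\<close> obey the same weight condition. For a loop
  at \<open>a\<close> the fibre is a single vertex and the collapsed edge adds 1. For an edge
  joining \<open>a\<close> and \<open>b\<close> the collapsed edge compensates one of the two terms
  -1, so the weights add.\<close>

lemma contract_edge: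
  assumes wfX: "wf_lg n X" and i: "i < ne X"
  obtains \<rho> where "contraction n X {i} (contract X i) (skip i) \<rho>" "wf_lg n (contract X i)"
  using wfX i
proof (cases rule: wf_ends_cases)
  case (1 a)
  let ?Y = "contract X i"
  have Y: "nv ?Y = nv X" "ne ?Y = ne X - 1" "mk ?Y = mk X" "wt ?Y = (wt X)(a := wt X a + 1)"
    "ends ?Y = (\<lambda>j. if j < ne X - 1 then ends X (skip i j) else {})"
    using 1 by (auto simp: contract_def Let_def skip_def fun_eq_iff)
  have "contraction n X {i} ?Y (skip i) id"
  proof (rule contraction_edgeI[OF i])
    fix y assume "y < nv ?Y"
    then have "fib X id y = {y}" by (auto simp: fib_def Y)
    then show "int (wt ?Y y) - 1 = (\<Sum>v\<in>fib X id y. int (wt X v) - 1) +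
        (if id ` ends X i = {y} then 1 else 0)" by (simp add: Y 1)
  qed (use 1 in \<open>auto simp: Y\<close>)
  moreover from wfX this have "wf_lg n ?Y"
    by (rule contraction_wf) (use wfX 1 in \<open>auto simp: Y wf_lg_def\<close>)
  ultimately show ?thesis by (rule that)
next
  case (2 a b)
  let ?Y = "contract X i"
  define \<pi> where "\<pi> v = (if v = b then a else if b < v then v - 1 else v)" for v
  have ab: "card (ends X i) = 2" "Min (ends X i) = a" "Max (ends X i) = b" using 2 by auto
  have Y: "nv ?Y = nv X - 1" "ne ?Y = ne X - 1" "mk ?Y = (\<lambda>j. \<pi> (mk X j))"
    "wt ?Y = (\<lambda>u. if u < nv X - 1 then (\<Sum>v \<in> {v. v < nv X \<and> \<pi> v = u}. wt X v) else 0)"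
    "ends ?Y = (\<lambda>j. if j < ne X - 1 then \<pi> ` ends X (skip i j) else {})"
    using 2 by (auto simp: contract_def Let_def skip_def ab \<pi>_def fun_eq_iff)
  have fib: "fib X \<pi> y = (if y = a then {a, b} else if y < b then {y} else {Suc y})"
    if "y < nv X - 1" for y
  proof (rule set_eqI)
    fix v
    show "v \<in> fib X \<pi> y \<longleftrightarrow> v \<in> (if y = a then {a, b} else if y < b then {y} else {Suc y})"
      unfolding fib_def \<pi>_def using that 2(2,3)
      by (cases "y = a"; cases "y < b"; cases "v = b"; cases "b < v") auto
  qed
  have "contraction n X {i} ?Y (skip i) \<pi>"
  proof (rule contraction_edgeI[OF i])
    have "y \<in> \<pi> ` {..<nv X}" if "y < nv X - 1" for y
    proof -
      have "fib X \<pi> y \<noteq> {}" unfolding fib[OF that] by simp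
      then show ?thesis by (auto simp: fib_def)
    qed
    moreover have "\<pi> v < nv X - 1" if "v < nv X" for v using that 2 by (auto simp: \<pi>_def)
    ultimately show "\<pi> ` {..<nv X} = {..<nv ?Y}" by (auto simp: Y)
  next
    fix u v assume "u < nv X" "v < nv X"
    then show "\<pi> u = \<pi> v \<longleftrightarrow> u = v \<or> (u \<in> ends X i \<and> v \<in> ends X i)"
      using 2 by (auto simp: \<pi>_def split: if_splits)
  next
    fix y assume "y < nv ?Y"
    then have y: "y < nv X - 1" by (simp add: Y)
    have "\<pi> ` ends X i = {a}" using 2 by (simp add: \<pi>_def)
    moreover have "int (wt ?Y y) = (\<Sum>v\<in>fib X \<pi> y. int (wt X v))"
      using y by (simp add: Y fib_def)
    ultimately show "int (wt ?Y y) - 1 = (\<Sum>v\<in>fib X \<pi> y. int (wt X v) - 1) +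
        (if \<pi> ` ends X i = {y} then 1 else 0)"
      using 2 by (simp add: sum_subtractf fib[OF y])
  qed (auto simp: Y)
  moreover from wfX this have "wf_lg n ?Y"
    by (rule contraction_wf) (use wfX 2 in \<open>auto simp: Y wf_lg_def \<pi>_def\<close>)
  ultimately show ?thesis by (rule that)
qed

section \<open>Attaching a tail\<close>

text \<open>The new edge gets the last label, so that the other labels are unchanged.\<close>
definition attach :: "lgraph \<Rightarrow> nat \<Rightarrow> lgraph" where
  "attach X v = X\<lparr>nv := Suc (nv X), ne := Suc (ne X),
     ends := (ends X)(ne X := {v, nv X}), wt := (wt X)(v := wt X v - 1, nv X := 1)\<rparr>"

text \<open>A tail lowers the excess at its foot by one, so an excess of at least 2 is what keeps
  the graph stable. In a stable graph these are the vertices of positive weight that are not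
  tips.\<close>

definition bases :: "nat \<Rightarrow> lgraph \<Rightarrow> nat set" where
  "bases n X = {v. v < nv X \<and> 0 < wt X v \<and> 2 \<le> excess n X v}"

text \<open>Weight \<open>w > 0\<close> and \<open>2 w - 2 + val = 1\<close> force \<open>w = 1\<close> and \<open>val = 1\<close>.\<close>
definition tips :: "nat \<Rightarrow> lgraph \<Rightarrow> nat set" where
  "tips n X = {v. v < nv X \<and> 0 < wt X v \<and> excess n X v = 1}"

lemma finite_bases [simp]: "finite (bases n X)"
  by (simp add: bases_def)

lemma finite_tips [simp]: "finite (tips n X)"
  by (simp add: tips_def)

lemma attach_sel [simp]:
  "nv (attach X v) = Suc (nv X)" "ne (attach X v) = Suc (ne X)"
  "ends (attach X v) = (ends X)(ne X := {v, nv X})"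
  "wt (attach X v) = (wt X)(v := wt X v - 1, nv X := 1)"
  "mk (attach X v) = mk X"
  by (simp_all add: attach_def)

lemma val_attach:
  assumes wfX: "wf_lg n X" and v: "v < nv X" and u: "u \<le> nv X"
  shows "val n (attach X v) u = (if u = nv X then 1 else val n X u + (if u = v then 1 else 0))"
proof -
  have "half_edges (ends X i) (nv X) = 0" if "i < ne X" for i
    using wf_ends[OF wfX that] by (auto simp: half_edges_def)
  moreover have "mk X j \<noteq> nv X" if "j \<in> {1..n}" for j using wf_mk[OF wfX that] by simp
  moreover have "half_edges {v, nv X} u = (if u = nv X then 1 else if u = v then 1 else 0)"
    using v u by (auto simp: half_edges_def)
  ultimately show ?thesis using v u by (auto simp: val_half_edges)
qed

text \<open>At \<open>v\<close> the weight term loses 2 and the valence gains 1; the new vertex has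
  2 - 2 + 1. Positive weight at \<open>v\<close> keeps the subtraction on naturals honest.\<close>

lemma excess_attach:
  assumes "wf_lg n X" "v < nv X" "0 < wt X v" "u \<le> nv X"
  shows "excess n (attach X v) u = (if u = nv X then 1 else excess n X u - (if u = v then 1 else 0))"
  using assms by (auto simp: excess_def val_attach)

lemma wf_attach:
  assumes wfX: "wf_lg n X" and v: "v < nv X"
  shows "wf_lg n (attach X v)"
proof -
  let ?Y = "attach X v"
  have "adj X \<subseteq> adj ?Y"
  proof safe
    fix u w assume "(u, w) \<in> adj X"
    then obtain i where "i < ne X" "u \<in> ends X i" "w \<in> ends X i" by (auto simp: adj_def)
    then show "(u, w) \<in> adj ?Y" by (auto simp: adj_def intro!: exI[of _ i])
  qed
  then have sub: "(adj X)\<^sup>* \<subseteq> (adj ?Y)\<^sup>*" by (rule rtrancl_mono)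
  have c: "(u, v) \<in> (adj ?Y)\<^sup>* \<and> (v, u) \<in> (adj ?Y)\<^sup>*" if "u \<le> nv X" for u
  proof (cases "u = nv X")
    case True
    then have "(u, v) \<in> adj ?Y" "(v, u) \<in> adj ?Y" by (auto simp: adj_def)
    then show ?thesis by blast
  next
    case False
    then have "(u, v) \<in> (adj X)\<^sup>*" "(v, u) \<in> (adj X)\<^sup>*" using that v wf_connected[OF wfX] by auto
    then show ?thesis using sub by blast
  qed
  have "(u, w) \<in> (adj ?Y)\<^sup>*" if "u \<le> nv X" "w \<le> nv X" for u w
    using c[OF that(1)] c[OF that(2)] by (meson rtrancl_trans)
  moreover have "ends X i \<subseteq> {..<Suc (nv X)}" if "i < ne X" for i
    using wf_ends[OF wfX that] by auto
  moreover have "ends ?Y i \<subseteq> {..<nv ?Y} \<and> ends ?Y i \<noteq> {} \<and> card (ends ?Y i) \<le> 2"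
    if i: "i < ne ?Y" for i
  proof (cases "i = ne X")
    case True
    then show ?thesis using v by (simp add: card_insert_if)
  next
    case False
    then show ?thesis using i wf_ends[OF wfX, of i] by fastforce
  qed
  moreover have "mk ?Y j < nv ?Y" if "j \<in> {1..n}" for j
    using wf_mk[OF wfX that] by simp
  ultimately show ?thesis using v wfX
    unfolding wf_lg_def by (simp add: less_Suc_eq_le Suc_le_eq)
qed

text \<open>Contracting the new tail undoes the attachment, as the unit of weight returns to
  \<open>v\<close>. This is the source of the diagonal term of d h.\<close>

lemma contraction_attached:
  assumes wfX: "wf_lg n X" and v: "v < nv X" "0 < wt X v"
  shows "contraction n (attach X v) {ne X} X (skip (ne X)) (\<lambda>u. if u = nv X then v else u)"
    (is "contraction n ?Y _ _ _ ?\<rho>")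
proof (rule contraction_edgeI)
  show "?\<rho> ` {..<nv ?Y} = {..<nv X}" using v by (auto split: if_splits)
next
  fix j assume j: "j < ne X"
  then have "ends X j \<subseteq> {..<nv X}" using wf_ends[OF wfX] by simp
  then have "?\<rho> ` ends X j = ends X j" by (force simp: image_def)
  then show "ends X j = ?\<rho> ` ends ?Y (skip (ne X) j)" using j by (simp add: skip_def)
next
  fix y assume y: "y < nv X"
  have "fib ?Y ?\<rho> y = (if y = v then {v, nv X} else {y})" using v y by (auto simp: fib_def)
  then show "int (wt X y) - 1 = (\<Sum>u\<in>fib ?Y ?\<rho> y. int (wt ?Y u) - 1) +
      (if ?\<rho> ` ends ?Y (ne X) = {y} then 1 else 0)" using v y by auto
next
  fix j assume "j \<in> {1..n}"
  then show "mk X j = ?\<rho> (mk ?Y j)" using wf_mk[OF wfX, of j] by auto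
qed (use v in \<open>auto split: if_splits\<close>)

text \<open>The genus is read off from the contraction of \<open>attach X v\<close> back to
  \<open>X\<close>.\<close>

lemma attach_gensD:
  assumes X: "X \<in> gensD g n p" and v: "v \<in> bases n X"
  shows "attach X v \<in> gensD g n (p + 1)"
proof -
  have wfX: "wf_lg n X" using X by (simp add: gensD_def)
  have v': "v < nv X" "0 < wt X v" "2 \<le> excess n X v" using v by (auto simp: bases_def)
  have "excess n X u > 0" if "u < nv X" for u
    using X that by (simp add: gensD_def excess_def)
  then have "excess n (attach X v) u > 0" if "u \<le> nv X" for u
    using that v' by (auto simp: excess_attach[OF wfX v'(1,2) that])
  then show ?thesis
    using X wf_attach[OF wfX v'(1)]
      contraction_genus[OF wf_attach[OF wfX v'(1)] contraction_attached[OF wfX v'(1,2)]]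
    by (auto simp: gensD_def excess_def less_Suc_eq_le)
qed

text \<open>Growing a tail commutes with contracting old edges. Since the tail is last on both
  sides, the edge map extends by sending last to last; with \<open>S = {}\<close> this also covers
  isomorphisms.\<close>

lemma contraction_attach:
  assumes wfX: "wf_lg n X" and c: "contraction n X S Y \<kappa> \<rho>"
    and v: "v < nv X" "0 < wt X v" "0 < wt Y (\<rho> v)"
  shows "contraction n (attach X v) S (attach Y (\<rho> v)) (\<kappa>(ne Y := ne X)) (\<rho>(nv X := nv Y))"
    (is "contraction n ?X S ?Y ?\<kappa> ?\<rho>")
proof -
  note c' = wfX c
  have S: "S \<subseteq> {..<ne X}" using contraction_edges[OF c'] by simp
  have lt: "\<rho> v < nv Y" using contraction_lt[OF c' v(1)] .
  have enX: "ends X i \<subseteq> {..<nv X}" if "i < ne X" for i using wf_ends[OF wfX that] by simp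
  have im: "?\<rho> ` ends X i = \<rho> ` ends X i" if "i < ne X" for i
    by (rule image_cong) (use enX[OF that] in auto)
  have "ends ?X i = ends X i" if "i \<in> S" for i using S that by auto
  then have adj: "adj_on ?X S = adj_on X S" by (simp add: adj_on_def)
  have A: "bij_betw ?\<kappa> {..<ne ?Y} ({..<ne ?X} - S)"
  proof -
    have "bij_betw ?\<kappa> {..<ne Y} ({..<ne X} - S)"
      using contraction_bij[OF c'] by (rule bij_betw_cong[THEN iffD1, rotated]) auto
    from bij_betw_combine[OF this, of "{ne Y}" "{ne X}"]
    have "bij_betw ?\<kappa> ({..<ne Y} \<union> {ne Y}) (({..<ne X} - S) \<union> {ne X})" by simp
    moreover have "({..<ne X} - S) \<union> {ne X} = {..<ne ?X} - S" using S by auto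
    moreover have "{..<ne Y} \<union> {ne Y} = {..<ne ?Y}" by auto
    ultimately show ?thesis by simp
  qed
  have B: "?\<rho> ` {..<nv ?X} = {..<nv ?Y}"
  proof -
    have "?\<rho> ` {..<nv X} = \<rho> ` {..<nv X}" by (rule image_cong) auto
    then have eq: "?\<rho> ` {..<nv X} = {..<nv Y}" unfolding contraction_image[OF c'] .
    have "?\<rho> ` {..<nv ?X} = insert (?\<rho> (nv X)) (?\<rho> ` {..<nv X})"
      by (simp only: attach_sel lessThan_Suc image_insert)
    then show ?thesis unfolding eq by (simp only: attach_sel lessThan_Suc fun_upd_same)
  qed
  \<comment> \<open>No edge of \<open>S\<close> touches the new vertex, so it remains alone in its
    class.\<close>
  have iso: "u = w \<or> (u < nv X \<and> w < nv X)" if "(u, w) \<in> (adj_on X S)\<^sup>*" for u w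
    using that
  proof induction
    case (step w w')
    from step.hyps(2) obtain i where i: "i \<in> S" "w \<in> ends X i" "w' \<in> ends X i"
      by (auto simp: adj_on_def)
    then have "ends X i \<subseteq> {..<nv X}" using enX S by auto
    then have "w < nv X" "w' < nv X" using i by auto
    then show ?case using step.IH by auto
  qed simp
  have C: "?\<rho> u = ?\<rho> w \<longleftrightarrow> (u, w) \<in> (adj_on ?X S)\<^sup>*" if uw: "u < nv ?X" "w < nv ?X" for u w
  proof (cases "u = nv X \<or> w = nv X")
    case True
    then have "?\<rho> u = ?\<rho> w \<longleftrightarrow> u = w"
      using uw contraction_lt[OF c', of u] contraction_lt[OF c', of w]
      by (auto simp: less_Suc_eq split: if_splits)
    also have "\<dots> \<longleftrightarrow> (u, w) \<in> (adj_on X S)\<^sup>*" using iso[of u w] True by auto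
    finally show ?thesis unfolding adj .
  next
    case False
    then show ?thesis unfolding adj using uw contraction_kernel[OF c', of u w] by simp
  qed
  have D: "ends ?Y j = ?\<rho> ` ends ?X (?\<kappa> j)" if j: "j < ne ?Y" for j
  proof (cases "j = ne Y")
    case True
    then show ?thesis using v by auto
  next
    case False
    then have j': "j < ne Y" using j by simp
    then show ?thesis
      using contraction_kept[OF c' j'] contraction_ends[OF c' j'] im by simp
  qed
  have E: "int (wt ?Y y) - 1 = (\<Sum>u\<in>fib ?X ?\<rho> y. int (wt ?X u) - 1)
      + int (card {i \<in> S. ?\<rho> ` ends ?X i = {y}})" if y: "y < nv ?Y" for y
  proof -
    have imS: "?\<rho> ` ends ?X i = \<rho> ` ends X i" if "i \<in> S" for i
    proof -
      have "i < ne X" using that S by auto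
      then show ?thesis using im by simp
    qed
    have eS: "{i \<in> S. ?\<rho> ` ends ?X i = {y}} = {i \<in> S. \<rho> ` ends X i = {y}}"
      by (intro Collect_cong conj_cong refl) (simp only: imS)
    show ?thesis
    proof (cases "y = nv Y")
      case True
      have "fib ?X ?\<rho> y = {nv X}"
        using True contraction_lt[OF c'] by (fastforce simp: fib_def less_Suc_eq)
      moreover have "card {i \<in> S. \<rho> ` ends X i = {y}} = 0"
      proof -
        have "{i \<in> S. \<rho> ` ends X i = {y}} = {}"
          using True contraction_collapsed[OF c'] by fastforce
        then show ?thesis by (simp only: card.empty)
      qed
      ultimately show ?thesis unfolding eS using True by simp
    next
      case False
      then have y': "y < nv Y" using y by simp
      have f: "fib ?X ?\<rho> y = fib X \<rho> y" using False by (auto simp: fib_def less_Suc_eq)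
      have "(\<Sum>u\<in>fib X \<rho> y. int (wt ?X u) - 1) =
          (\<Sum>u\<in>fib X \<rho> y. (int (wt X u) - 1) - (if u = v then 1 else 0))"
        by (rule sum.cong) (use v in \<open>auto simp: fib_def\<close>)
      also have "\<dots> = (\<Sum>u\<in>fib X \<rho> y. int (wt X u) - 1) - (if y = \<rho> v then 1 else 0)"
        unfolding sum_subtractf[of "\<lambda>u. int (wt X u) - 1"] using v by (auto simp: fib_def)
      finally show ?thesis unfolding eS f using contraction_wt[OF c' y'] False v by auto
    qed
  qed
  have F: "mk ?Y j = ?\<rho> (mk ?X j)" if "j \<in> {1..n}" for j
    using contraction_mk[OF c' that] wf_mk[OF wfX that] by simp
  have S': "S \<subseteq> {..<ne ?X}" using S by auto
  show ?thesis unfolding contraction_def by (intro conjI allI impI ballI A B C D E F S')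
qed

section \<open>Tails and edge contractions\<close>

text \<open>A tip has weight 1 and valence 1, and edge \<open>i\<close> already uses up its only
  half-edge.\<close>

lemma tip_edge:
  assumes wfX: "wf_lg n X" and t: "t \<in> tips n X" and i: "i < ne X" "t \<in> ends X i"
  shows "wt X t = 1" "\<And>j. j < ne X \<Longrightarrow> j \<noteq> i \<Longrightarrow> t \<notin> ends X j"
    "\<And>j. j \<in> {1..n} \<Longrightarrow> mk X j \<noteq> t" "ends X i \<noteq> {t}"
proof -
  have t': "0 < wt X t" "2 * int (wt X t) - 2 + int (val n X t) = 1"
    using t by (auto simp: tips_def excess_def)
  then show "wt X t = 1" by linarith
  with t' have val: "val n X t = 1" by simp
  let ?h = "\<lambda>j. half_edges (ends X j) t"
  have split: "(\<Sum>j<ne X. ?h j) = ?h i + (\<Sum>j\<in>{..<ne X} - {i}. ?h j)"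
    by (rule sum.remove) (use i in auto)
  have hi: "?h i \<ge> 1" using i by (simp add: half_edges_def)
  have v: "(\<Sum>j<ne X. ?h j) + (\<Sum>j\<in>{1..n}. if mk X j = t then 1 else 0) = 1"
    using val unfolding val_half_edges .
  from v split hi have "?h i = 1" "(\<Sum>j\<in>{..<ne X} - {i}. ?h j) = 0"
    "(\<Sum>j\<in>{1..n}. if mk X j = t then 1 else 0 :: nat) = 0" by linarith+
  then show "\<And>j. j < ne X \<Longrightarrow> j \<noteq> i \<Longrightarrow> t \<notin> ends X j"
    "\<And>j. j \<in> {1..n} \<Longrightarrow> mk X j \<noteq> t" "ends X i \<noteq> {t}"
    by (auto simp: half_edges_def split: if_splits)
qed

context
  fixes n X i Y \<kappa> \<rho>
  assumes wfX: "wf_lg n X" and contr: "contraction n X {i} Y \<kappa> \<rho>"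
    and pos: "\<And>v. v < nv X \<Longrightarrow> 0 < excess n X v"
begin

lemma edge_lt: "i < ne X"
  using contraction_edges[OF wfX contr] by simp

lemma edge_kernel:
  "u < nv X \<Longrightarrow> v < nv X \<Longrightarrow> \<rho> u = \<rho> v \<longleftrightarrow> u = v \<or> (u \<in> ends X i \<and> v \<in> ends X i)"
  using contraction_kernel[OF wfX contr] by (simp add: adj_on_edge rtrancl_square)

lemma edge_fib: "v < nv X \<Longrightarrow> fib X \<rho> (\<rho> v) = (if v \<in> ends X i then ends X i else {v})"
  using edge_kernel wf_ends(1)[OF wfX edge_lt] by (auto simp: fib_def)

text \<open>Of the 2, one unit is the collapsed edge and one undoes the -1 on the left of the weight
  condition. The formula gives w + 1 for a loop and the sum of the weights otherwise.\<close>

lemma edge_wt: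
  assumes v: "v < nv X"
  shows "int (wt Y (\<rho> v)) =
    (if v \<in> ends X i then (\<Sum>u\<in>ends X i. int (wt X u) - 1) + 2 else int (wt X v))"
proof -
  have "{i' \<in> {i}. \<rho> ` ends X i' = {\<rho> v}} = (if v \<in> ends X i then {i} else {})"
  proof -
    obtain y where y: "\<rho> ` ends X i = {y}" using contraction_collapsed[OF wfX contr, of i] by auto
    have "\<rho> v = y \<Longrightarrow> v \<in> ends X i"
    proof -
      assume "\<rho> v = y"
      then have "\<rho> v \<in> \<rho> ` ends X i" using y by simp
      then obtain u where u: "u \<in> ends X i" "\<rho> v = \<rho> u" by auto
      then have "u < nv X" using wf_ends(1)[OF wfX edge_lt] by auto
      then show ?thesis using edge_kernel[of v u] u v by auto
    qed
    moreover have "v \<in> ends X i \<Longrightarrow> \<rho> v = y" using y by blast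
    ultimately show ?thesis using y by auto
  qed
  then have "int (wt Y (\<rho> v)) - 1 =
      (\<Sum>u\<in>fib X \<rho> (\<rho> v). int (wt X u) - 1) + (if v \<in> ends X i then 1 else 0)"
    using contraction_wt[OF wfX contr contraction_lt[OF wfX contr v]] by simp
  then show ?thesis by (cases "v \<in> ends X i") (simp_all add: edge_fib[OF v])
qed

lemma edge_wt_mono: "v < nv X \<Longrightarrow> wt X v \<le> wt Y (\<rho> v)"
  using wfX edge_lt
proof (cases rule: wf_ends_cases)
  case (1 a)
  then show "v < nv X \<Longrightarrow> ?thesis" using edge_wt[of v] by (auto split: if_splits)
next
  case (2 a b)
  then show "v < nv X \<Longrightarrow> ?thesis" using edge_wt[of v] by (auto split: if_splits)
qed

lemma edge_excess:
  "v < nv X \<Longrightarrow> excess n Y (\<rho> v) =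
    (if v \<in> ends X i then (\<Sum>u\<in>ends X i. excess n X u) else excess n X v)"
  using contraction_excess[OF wfX contr contraction_lt[OF wfX contr]] by (simp add: edge_fib)

lemma edge_excess_mono:
  assumes v: "v < nv X"
  shows "excess n X v \<le> excess n Y (\<rho> v)"
proof (cases "v \<in> ends X i")
  case True
  have "excess n X v \<le> (\<Sum>u\<in>ends X i. excess n X u)"
    by (rule member_le_sum[OF True])
      (use pos wf_ends[OF wfX edge_lt] in \<open>force intro: less_imp_le\<close>)+
  then show ?thesis using edge_excess[OF v] True by simp
qed (simp add: edge_excess[OF v])

text \<open>Weight and excess do not decrease under contraction, the latter because all excesses are
  positive. Hence every attachment before a contraction has a counterpart after it.\<close>

lemma edge_bases: "v \<in> bases n X \<Longrightarrow> \<rho> v \<in> bases n Y"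
  using edge_excess_mono[of v] edge_wt_mono[of v] contraction_lt[OF wfX contr, of v]
  by (auto simp: bases_def)

text \<open>Vertices off the contracted edge keep weight and excess and are not identified. With
  \<open>card_tips_attach\<close> this puts the error terms of the homotopy deeper in the
  filtration.\<close>

lemma card_tips_edge:
  assumes "tips n X \<inter> ends X i = {}"
  shows "card (tips n X) \<le> card (tips n Y)"
proof (rule card_inj_on_le[of \<rho>])
  show "inj_on \<rho> (tips n X)"
    using assms edge_kernel by (intro inj_onI) (auto simp: tips_def)
  show "\<rho> ` tips n X \<subseteq> tips n Y"
  proof safe
    fix v assume v: "v \<in> tips n X"
    then have "v < nv X" "v \<notin> ends X i" using assms by (auto simp: tips_def)
    then show "\<rho> v \<in> tips n Y"
      using v edge_wt[of v] edge_excess[of v] contraction_lt[OF wfX contr, of v]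
      by (simp add: tips_def)
  qed
qed simp

context
  fixes b t
  assumes t: "t \<in> tips n X" and e: "ends X i = {b, t}" and bt: "b \<noteq> t"
begin

lemma tail_lt: "b < nv X" "t < nv X"
  using wf_ends(1)[OF wfX edge_lt] e by auto

lemma tail_wt: "wt Y (\<rho> b) = wt X b + 1"
  using edge_wt[OF tail_lt(1)] tip_edge(1)[OF wfX t edge_lt] e bt by simp

text \<open>Merging with a tip adds weight 1 and excess 1, so the foot of a tail becomes a base
  after contraction, whatever it was before. All other vertices are unchanged.\<close>

lemma tail_bases: "bases n Y = insert (\<rho> b) (\<rho> ` (bases n X))"
proof
  have "excess n Y (\<rho> b) = excess n X b + excess n X t"
    using edge_excess[OF tail_lt(1)] e bt by simp
  then have "\<rho> b \<in> bases n Y"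
    using pos[OF tail_lt(1)] pos[OF tail_lt(2)] tail_wt contraction_lt[OF wfX contr tail_lt(1)]
    by (simp add: bases_def)
  then show "insert (\<rho> b) (\<rho> ` (bases n X)) \<subseteq> bases n Y" using edge_bases by auto
  show "bases n Y \<subseteq> insert (\<rho> b) (\<rho> ` (bases n X))"
  proof
    fix y assume y: "y \<in> bases n Y"
    then obtain v where v: "v < nv X" "\<rho> v = y"
      using contraction_surj[OF wfX contr, of y] by (auto simp: bases_def)
    show "y \<in> insert (\<rho> b) (\<rho> ` (bases n X))"
    proof (cases "v \<in> ends X i")
      case True
      then have "\<rho> v = \<rho> b" using edge_kernel[OF v(1) tail_lt(1)] e by simp
      then show ?thesis using v by simp
    next
      case False
      then have "v \<in> bases n X"
        using y v edge_wt[OF v(1)] edge_excess[OF v(1)] by (simp add: bases_def)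
      then show ?thesis using v by auto
    qed
  qed
qed

text \<open>The only identification is that of \<open>b\<close> with \<open>t\<close>, and a tip is
  never a base.\<close>

lemma tail_inj: "inj_on \<rho> (bases n X)"
proof (rule inj_onI)
  fix u v assume uv: "u \<in> bases n X" "v \<in> bases n X" "\<rho> u = \<rho> v"
  have "t \<notin> bases n X" using t by (simp add: tips_def bases_def)
  then show "u = v" using uv edge_kernel[of u v] e by (auto simp: bases_def)
qed

lemma tail_base_notin:
  assumes "b \<notin> bases n X"
  shows "\<rho> b \<notin> \<rho> ` bases n X"
proof
  assume "\<rho> b \<in> \<rho> ` bases n X"
  then obtain v where v: "v \<in> bases n X" "\<rho> b = \<rho> v" by auto
  have "t \<notin> bases n X" using t by (simp add: tips_def bases_def)
  then show False using v assms edge_kernel[OF tail_lt(1), of v] e by (auto simp: bases_def)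
qed

end

end

text \<open>The new vertex is a tip, and no old tip is spoilt: only the excess at \<open>u\<close>
  changes, and \<open>u\<close> is not a tip because its excess is at least 2.\<close>

lemma card_tips_attach:
  assumes "wf_lg n Y" "u \<in> bases n Y"
  shows "card (tips n Y) < card (tips n (attach Y u))"
proof (rule psubset_card_mono)
  have u: "u < nv Y" "0 < wt Y u" "2 \<le> excess n Y u" using assms(2) by (auto simp: bases_def)
  have "nv Y \<in> tips n (attach Y u) - tips n Y"
    using excess_attach[OF assms(1) u(1,2), of "nv Y"] by (simp add: tips_def)
  moreover have "v \<in> tips n (attach Y u)" if "v \<in> tips n Y" for v
  proof -
    have "v \<noteq> u" "v < nv Y" using that u by (auto simp: tips_def)
    then show ?thesis using that excess_attach[OF assms(1) u(1,2), of v] by (simp add: tips_def)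
  qed
  ultimately show "tips n Y \<subset> tips n (attach Y u)" by blast
qed simp

section \<open>The differential\<close>

lemma gensD_wf: "X \<in> gensD g n p \<Longrightarrow> wf_lg n X"
  by (simp add: gensD_def)

lemma gensD_excess: "X \<in> gensD g n p \<Longrightarrow> v < nv X \<Longrightarrow> 0 < excess n X v"
  by (simp add: gensD_def excess_def)

lemma relgensDE:
  assumes "s \<in> relgensD g n p"
  obtains X Y \<sigma> where "s = (\<lambda>Z. delta X Z - of_int (sign \<sigma>) * delta Y Z)"
    "X \<in> gensD g n p" "Y \<in> gensD g n p" "iso_by n X Y \<sigma>"
  using assms unfolding relgensD_def by blast

lemma finsupp_relgensD: "s \<in> relgensD g n p \<Longrightarrow> finsupp s"
  by (auto simp: relgensD_def intro!: finsupp_diff_scale)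

lemma relsD_chD: "x \<in> relsD g n p \<Longrightarrow> x \<in> chD g n p"
  unfolding relsD_def chD_def
proof (erule spanQ_least)
  fix s assume "s \<in> relgensD g n p"
  then obtain X Y \<sigma> where s: "s = (\<lambda>Z. delta X Z - of_int (sign \<sigma>) * delta Y Z)"
    and XY: "X \<in> gensD g n p" "Y \<in> gensD g n p" and "iso_by n X Y \<sigma>" by (rule relgensDE)
  have "(\<lambda>Z. of_int (sign \<sigma>) * delta Y Z) \<in> spanQ (delta ` gensD g n p)"
    by (rule spanQ_scale, rule spanQ_base) (use XY in auto)
  moreover have "delta X \<in> spanQ (delta ` gensD g n p)"
    by (rule spanQ_base) (use XY in auto)
  ultimately show "s \<in> spanQ (delta ` gensD g n p)" unfolding s by (rule spanQ_diff[rotated])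
qed

lemma chD_finsupp: "x \<in> chD g n p \<Longrightarrow> finsupp x"
  unfolding chD_def by (erule spanQ_finsupp) auto

lemma iso_cong:
  assumes "X \<in> gensD g n p" "Y \<in> gensD g n p" "iso_by n X Y \<sigma>"
  shows "cong_mod (relgensD g n p) (delta X) (\<lambda>Z. of_int (sign \<sigma>) * delta Y Z)"
  unfolding cong_mod_def by (rule spanQ_base) (use assms in \<open>auto simp: relgensD_def\<close>)

lemma iso_cong_id:
  assumes "X \<in> gensD g n p" "Y \<in> gensD g n p" "iso_by n X Y id"
  shows "cong_mod (relgensD g n p) (delta X) (delta Y)"
  using iso_cong[OF assms] by simp

lemma dD_delta: "dD (delta X) = (\<lambda>Y. \<Sum>i<ne X. (-1) ^ i * delta (contract X i) Y)"
  unfolding dD_def lin_ext_delta by (auto simp: delta_def intro!: sum.cong)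

lemma fslin_dD: "fslin dD"
  unfolding dD_def by (rule fslin_lin_ext)

lemma finsupp_dD: "finsupp (dD f)"
proof -
  have "finsupp (dD (delta X))" for X unfolding dD_delta by (rule finsupp_sum) simp
  then show ?thesis unfolding dD_def lin_ext_delta by (rule finsupp_lin_ext)
qed

lemma ne_contract: "i < ne X \<Longrightarrow> ne (contract X i) = ne X - 1"
  by (simp add: contract_def Let_def)

lemma contract_gensD:
  assumes X: "X \<in> gensD g n p" and i: "i < ne X"
  shows "contract X i \<in> gensD g n (p - 1)"
proof -
  obtain \<rho> where "contraction n X {i} (contract X i) (skip i) \<rho>" "wf_lg n (contract X i)"
    using contract_edge[OF gensD_wf[OF X] i] .
  from contraction_gensD[OF gensD_wf[OF X] this(1) X this(2)] show ?thesis by simp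
qed

lemma dD_chD:
  assumes "x \<in> chD g n p"
  shows "dD x \<in> chD g n (p - 1)"
  unfolding chD_def
proof (rule fslin_spanQ[OF fslin_dD assms[unfolded chD_def]])
  fix s :: "lgraph \<Rightarrow> rat" assume "s \<in> delta ` gensD g n p"
  then obtain X where X: "s = delta X" "X \<in> gensD g n p" by auto
  show "dD s \<in> spanQ (delta ` gensD g n (p - 1))"
    unfolding X(1) dD_delta
    by (rule spanQ_sum, rule spanQ_base) (use contract_gensD[OF X(2)] in auto)
qed auto

text \<open>Both faces are contractions of \<open>X\<close> along edge \<open>i\<close>, one of them
  through the isomorphism. Their labels differ by \<open>\<sigma>\<close> with \<open>i\<close>
  removed, whose sign accounts for the different signs of the two faces.\<close>

lemma contract_iso:
  assumes X: "X \<in> gensD g n p" and Y: "Y \<in> gensD g n p" and iso: "iso_by n X Y \<sigma>"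
    and i: "i < ne X"
  shows "cong_mod (relgensD g n (p - 1)) (\<lambda>Z. (-1) ^ i * delta (contract X i) Z)
    (\<lambda>Z. of_int (sign \<sigma>) * ((-1) ^ \<sigma> i * delta (contract Y (\<sigma> i)) Z))"
proof -
  note wf = gensD_wf[OF X] gensD_wf[OF Y]
  have s: "\<sigma> permutes {..<ne X}" and ne: "ne X = ne Y" using iso by (auto simp: iso_by_def)
  have si: "\<sigma> i < ne Y" using permutes_in_image[OF s, of i] i ne by simp
  obtain m where m: "ne X = Suc m" using i by (cases "ne X") auto
  obtain \<tau> where t: "\<tau> permutes {..<m}" "\<And>j. j < m \<Longrightarrow> \<sigma> (skip i j) = skip (\<sigma> i) (\<tau> j)"
    "sign \<tau> * (-1) ^ i = sign \<sigma> * (-1) ^ \<sigma> i"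
    using permutes_remove_point[of \<sigma> m i] s i m by auto
  obtain \<rho> where X': "contraction n X {i} (contract X i) (skip i) \<rho>" "wf_lg n (contract X i)"
    using contract_edge[OF wf(1) i] .
  obtain \<rho>' where Y': "contraction n Y {\<sigma> i} (contract Y (\<sigma> i)) (skip (\<sigma> i)) \<rho>'"
    using contract_edge[OF wf(2) si] .
  obtain \<phi> where "contraction n X {} Y (inv \<sigma>) \<phi>" using contraction_of_iso[OF wf(1) iso] .
  from contraction_compose[OF wf(1) this Y']
  have c: "contraction n X {i} (contract Y (\<sigma> i)) (inv \<sigma> \<circ> skip (\<sigma> i)) (\<rho>' \<circ> \<phi>)"
    using permutes_inverses(2)[OF s] by simp
  have "iso_by n (contract X i) (contract Y (\<sigma> i)) \<tau>"
  proof (rule contraction_unique[OF wf(1) X'(1) c])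
    show "\<tau> permutes {..<ne (contract X i)}" using t(1) m i by (simp add: ne_contract)
  next
    fix j assume "j < ne (contract X i)"
    then have "j < m" using m i by (simp add: ne_contract)
    from t(2)[OF this] show "(inv \<sigma> \<circ> skip (\<sigma> i)) (\<tau> j) = skip i j"
      using permutes_inverses(2)[OF s] by (metis comp_apply)
  qed
  from iso_cong[OF contract_gensD[OF X i] contract_gensD[OF Y si] this]
  have "cong_mod (relgensD g n (p - 1)) (\<lambda>Z. (-1) ^ i * delta (contract X i) Z)
    (\<lambda>Z. (-1) ^ i * (of_int (sign \<tau>) * delta (contract Y (\<sigma> i)) Z))"
    by (rule cong_mod_scale)
  moreover have "(-1) ^ i * of_int (sign \<tau>) = (of_int (sign \<sigma>) * (-1) ^ \<sigma> i :: rat)"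
  proof -
    have "(of_int (sign \<tau> * (-1) ^ i) :: rat) = of_int (sign \<sigma> * (-1) ^ \<sigma> i)" by (simp only: t(3))
    then show ?thesis by (simp add: mult.commute)
  qed
  ultimately show ?thesis by (simp add: mult.assoc[symmetric])
qed

lemma dD_relsD:
  assumes "x \<in> relsD g n p"
  shows "dD x \<in> relsD g n (p - 1)"
  unfolding relsD_def
proof (rule fslin_spanQ[OF fslin_dD assms[unfolded relsD_def] finsupp_relgensD])
  fix s assume "s \<in> relgensD g n p"
  then obtain X Y \<sigma> where s: "s = (\<lambda>Z. delta X Z - of_int (sign \<sigma>) * delta Y Z)"
    and XY: "X \<in> gensD g n p" "Y \<in> gensD g n p" and iso: "iso_by n X Y \<sigma>"
    by (rule relgensDE)
  have p: "\<sigma> permutes {..<ne X}" and ne: "ne X = ne Y" using iso by (auto simp: iso_by_def)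
  have "cong_mod (relgensD g n (p - 1)) (dD (delta X))
    (\<lambda>Z. \<Sum>i<ne X. 1 * (of_int (sign \<sigma>) * ((-1) ^ \<sigma> i * delta (contract Y (\<sigma> i)) Z)))"
    unfolding dD_delta
    using cong_mod_sum[of "{..<ne X}" "relgensD g n (p - 1)" _ _ "\<lambda>_. 1", OF contract_iso[OF XY iso]]
    by simp
  moreover have "(\<Sum>i<ne X. 1 * (of_int (sign \<sigma>) * ((-1) ^ \<sigma> i * delta (contract Y (\<sigma> i)) Z))) =
      of_int (sign \<sigma>) * dD (delta Y) Z" for Z
    using sum.permute[OF p, of "\<lambda>i. (-1) ^ i * delta (contract Y i) Z"]
    by (simp add: dD_delta ne sum_distrib_left comp_def)
  ultimately have "cong_mod (relgensD g n (p - 1)) (dD (delta X))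
      (\<lambda>Z. of_int (sign \<sigma>) * dD (delta Y) Z)" by simp
  then show "dD s \<in> spanQ (relgensD g n (p - 1))"
    unfolding s cong_mod_def by (simp add: fslin_diff_scale[OF fslin_dD])
qed

text \<open>Equality may fail, since the renumbering of vertices depends on the order of
  contraction. Both graphs are contractions of \<open>X\<close> along the same two edges, and the
  surviving labels agree by \<open>skip_skip\<close>, so the isomorphism acts on labels by
  \<open>id\<close>.\<close>

lemma contract_contract:
  assumes X: "X \<in> gensD g n p" and ij: "i \<le> j" "Suc j < ne X"
  shows "cong_mod (relgensD g n (p - 2)) (delta (contract (contract X i) j))
    (delta (contract (contract X (Suc j)) i))"
proof -
  note wf = gensD_wf[OF X]
  have i: "i < ne X" using ij by simp
  obtain \<rho>1 where c1: "contraction n X {i} (contract X i) (skip i) \<rho>1" "wf_lg n (contract X i)"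
    using contract_edge[OF wf i] .
  obtain \<rho>2 where c2: "contraction n X {Suc j} (contract X (Suc j)) (skip (Suc j)) \<rho>2"
    "wf_lg n (contract X (Suc j))"
    using contract_edge[OF wf ij(2)] .
  have j1: "j < ne (contract X i)" and i2: "i < ne (contract X (Suc j))"
    using ij by (auto simp: ne_contract)
  obtain \<rho>3 where c3: "contraction n (contract X i) {j} (contract (contract X i) j) (skip j) \<rho>3"
    using contract_edge[OF c1(2) j1] .
  obtain \<rho>4 where c4: "contraction n (contract X (Suc j)) {i}
      (contract (contract X (Suc j)) i) (skip i) \<rho>4"
    using contract_edge[OF c2(2) i2] .
  have d1: "contraction n X {i, Suc j} (contract (contract X i) j) (skip i \<circ> skip j) (\<rho>3 \<circ> \<rho>1)"
    using contraction_compose[OF wf c1(1) c3] ij by (simp add: skip_def insert_commute)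
  have d2: "contraction n X {i, Suc j} (contract (contract X (Suc j)) i) (skip i \<circ> skip j) (\<rho>4 \<circ> \<rho>2)"
    using contraction_compose[OF wf c2(1) c4] ij
    by (simp add: insert_commute skip_skip[OF ij(1)] comp_def skip_def[of "Suc j" i])
  have "iso_by n (contract (contract X i) j) (contract (contract X (Suc j)) i) id"
    by (rule contraction_unique[OF wf d1 d2 permutes_id]) simp
  moreover have "contract (contract X i) j \<in> gensD g n (p - 2)"
    using contract_gensD[OF contract_gensD[OF X i] j1] by simp
  moreover have "contract (contract X (Suc j)) i \<in> gensD g n (p - 2)"
    using contract_gensD[OF contract_gensD[OF X ij(2)] i2] by simp
  ultimately show ?thesis by (intro iso_cong_id)
qed

lemma dD_dD:
  assumes "x \<in> chD g n p"
  shows "dD (dD x) \<in> relsD g n (p - 2)"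
proof -
  have lin: "fslin (\<lambda>x. dD (dD x))"
    using fslin_dD finsupp_dD by (simp add: fslin_def)
  show ?thesis unfolding relsD_def
  proof (rule fslin_spanQ[OF lin assms[unfolded chD_def]])
    fix s :: "lgraph \<Rightarrow> rat" assume "s \<in> delta ` gensD g n p"
    then obtain X where X: "s = delta X" "X \<in> gensD g n p" by auto
    show "dD (dD s) \<in> spanQ (relgensD g n (p - 2))"
    proof (cases "ne X")
      case 0
      then show ?thesis
        by (simp add: X(1) dD_delta fslin_zero[OF fslin_dD] spanQ_zero)
    next
      case (Suc m)
      define cc where "cc i j = delta (contract (contract X i) j)" for i j
      define A where "A = {(i, j). i \<le> j \<and> j < m}"
      define B where "B = {(i, j). j < i \<and> i < Suc m}"
      have fin: "finite A" "finite B"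
        by (rule finite_subset[of _ "{..<Suc m} \<times> {..<Suc m}"]; auto simp: A_def B_def)+
      have "dD (dD s) Z = (\<Sum>(i, j)\<in>A. (-1) ^ (i + j) * (cc i j Z - cc (Suc j) i Z))" for Z
      proof -
        have "dD (dD s) Z = (\<Sum>i<Suc m. (-1) ^ i * (\<Sum>j<m. (-1) ^ j * cc i j Z))"
          unfolding X(1) dD_delta[of X] fslin_sum[OF fslin_dD finsupp_delta]
          by (simp add: dD_delta Suc ne_contract cc_def cong: sum.cong_simp)
        also have "\<dots> = (\<Sum>(i, j)\<in>{..<Suc m} \<times> {..<m}. (-1) ^ (i + j) * cc i j Z)"
          by (simp add: sum.cartesian_product[symmetric] sum_distrib_left power_add mult.assoc)
        also have "{..<Suc m} \<times> {..<m} = A \<union> B" by (auto simp: A_def B_def)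
        also have "(\<Sum>(i, j)\<in>A \<union> B. (-1) ^ (i + j) * cc i j Z) =
            (\<Sum>(i, j)\<in>A. (-1) ^ (i + j) * cc i j Z) + (\<Sum>(i, j)\<in>B. (-1) ^ (i + j) * cc i j Z)"
          by (rule sum.union_disjoint[OF fin]) (auto simp: A_def B_def)
        \<comment> \<open>\<open>B\<close> lists the same pairs of edges contracted in the opposite
          order; passing from (i, j) to (j + 1, i) flips the parity of the sum of indices.\<close>
        also have "(\<Sum>(i, j)\<in>B. (-1) ^ (i + j) * cc i j Z) =
            (\<Sum>(i, j)\<in>A. - ((-1) ^ (i + j) * cc (Suc j) i Z))"
        proof -
          let ?f = "\<lambda>(i, j). (Suc j, i)"
          have "B \<subseteq> ?f ` A"
          proof
            fix q assume "q \<in> B"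
            then show "q \<in> ?f ` A"
              by (intro image_eqI[of _ _ "(snd q, fst q - 1)"]) (auto simp: A_def B_def)
          qed
          then have "B = ?f ` A" by (auto simp: A_def B_def)
          moreover have "inj_on ?f A" by (auto simp: inj_on_def)
          ultimately show ?thesis
            by (simp add: sum.reindex case_prod_unfold add.commute)
        qed
        finally show ?thesis
          by (simp add: case_prod_unfold right_diff_distrib sum_subtractf sum_negf)
      qed
      then have "dD (dD s) = (\<lambda>Z. \<Sum>q\<in>A. (-1) ^ (fst q + snd q) *
          (cc (fst q) (snd q) Z - cc (Suc (snd q)) (fst q) Z))"
        by (simp add: case_prod_unfold fun_eq_iff)
      also have "\<dots> \<in> spanQ (relgensD g n (p - 2))"
        by (rule spanQ_sum)
          (use contract_contract[OF X(2)] Suc in \<open>auto simp: A_def cc_def cong_mod_def\<close>)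
      finally show ?thesis .
    qed
  qed auto
qed

section \<open>The homotopy\<close>

text \<open>The sign is that of the face deleting the new label \<open>ne X\<close>, so contracting
  the new tail returns \<open>X\<close> with coefficient +1. As a contraction lowers
  \<open>ne\<close> by one, the remaining terms of d h and h d meet with opposite signs.\<close>

definition hop :: "nat \<Rightarrow> (lgraph \<Rightarrow> rat) \<Rightarrow> lgraph \<Rightarrow> rat" where
  "hop n = lin_ext (\<lambda>X Y. \<Sum>v\<in>bases n X. (-1) ^ ne X * delta (attach X v) Y)"

definition weighted_gens :: "nat \<Rightarrow> nat \<Rightarrow> int \<Rightarrow> lgraph set" where
  "weighted_gens g n p = {X \<in> gensD g n p. \<exists>v<nv X. 0 < wt X v}"

lemma hop_delta: "hop n (delta X) = (\<lambda>Y. \<Sum>v\<in>bases n X. (-1) ^ ne X * delta (attach X v) Y)"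
  by (simp add: hop_def)

lemma fslin_hop: "fslin (hop n)"
  unfolding hop_def by (rule fslin_lin_ext)

lemma finsupp_hop: "finsupp (hop n f)"
  unfolding hop_def by (rule finsupp_lin_ext, rule finsupp_sum) simp

lemma attach_weighted_gens:
  assumes "X \<in> gensD g n p" "v \<in> bases n X"
  shows "attach X v \<in> weighted_gens g n (p + 1)"
  using attach_gensD[OF assms] by (auto simp: weighted_gens_def intro!: exI[of _ "nv X"])

text \<open>The new vertex has weight 1, so even a chain outside the weight subcomplex is sent into
  it. This keeps the primitives constructed later inside the subcomplex.\<close>

lemma hop_chD:
  assumes "x \<in> chD g n p"
  shows "hop n x \<in> spanQ (delta ` weighted_gens g n (p + 1))"
proof (rule fslin_spanQ[OF fslin_hop assms[unfolded chD_def]])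
  fix s :: "lgraph \<Rightarrow> rat" assume "s \<in> delta ` gensD g n p"
  then obtain X where X: "s = delta X" "X \<in> gensD g n p" by auto
  show "hop n s \<in> spanQ (delta ` weighted_gens g n (p + 1))"
    unfolding X(1) hop_delta
    by (rule spanQ_sum, rule spanQ_base) (use attach_weighted_gens[OF X(2)] in auto)
qed auto

text \<open>Isomorphisms preserve weight and excess, hence match the bases. The new edges carry the
  same last label, which \<open>\<sigma>\<close> fixes, so the sign is unchanged.\<close>

lemma hop_relsD:
  assumes "x \<in> relsD g n p"
  shows "hop n x \<in> relsD g n (p + 1)"
  unfolding relsD_def
proof (rule fslin_spanQ[OF fslin_hop assms[unfolded relsD_def] finsupp_relgensD])
  fix s assume "s \<in> relgensD g n p"
  then obtain X Y \<sigma> where s: "s = (\<lambda>Z. delta X Z - of_int (sign \<sigma>) * delta Y Z)"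
    and XY: "X \<in> gensD g n p" "Y \<in> gensD g n p" and iso: "iso_by n X Y \<sigma>"
    by (rule relgensDE)
  note wf = gensD_wf[OF XY(1)]
  have p: "\<sigma> permutes {..<ne X}" and ne: "ne X = ne Y" and nv: "nv X = nv Y"
    using iso by (auto simp: iso_by_def)
  obtain \<phi> where c: "contraction n X {} Y (inv \<sigma>) \<phi>" using contraction_of_iso[OF wf iso] .
  note c' = wf c
  have ker: "\<phi> u = \<phi> v \<longleftrightarrow> u = v" if "u < nv X" "v < nv X" for u v
    using contraction_kernel[OF c' that] by (simp add: adj_on_def)
  have fib: "fib X \<phi> (\<phi> v) = {v}" if "v < nv X" for v using that ker by (auto simp: fib_def)
  have wt: "wt Y (\<phi> v) = wt X v" and ex: "excess n Y (\<phi> v) = excess n X v" if "v < nv X" for v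
    using contraction_wt[OF c' contraction_lt[OF c' that]]
      contraction_excess[OF c' contraction_lt[OF c' that]] by (simp_all add: fib[OF that])
  have bij: "bij_betw \<phi> (bases n X) (bases n Y)"
  proof -
    have "inj_on \<phi> (bases n X)" using ker by (auto simp: inj_on_def bases_def)
    moreover have "\<phi> ` bases n X = bases n Y"
    proof
      show "\<phi> ` bases n X \<subseteq> bases n Y"
        using wt ex contraction_lt[OF c'] by (auto simp: bases_def)
      show "bases n Y \<subseteq> \<phi> ` bases n X"
      proof
        fix y assume y: "y \<in> bases n Y"
        then obtain v where v: "v < nv X" "\<phi> v = y"
          using contraction_surj[OF c', of y] by (auto simp: bases_def)
        then have "v \<in> bases n X" using y wt[OF v(1)] ex[OF v(1)] by (simp add: bases_def)
        then show "y \<in> \<phi> ` bases n X" using v by auto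
      qed
    qed
    ultimately show ?thesis by (simp add: bij_betw_def)
  qed
  have "cong_mod (relgensD g n (p + 1)) (delta (attach X v))
      (\<lambda>Z. of_int (sign \<sigma>) * delta (attach Y (\<phi> v)) Z)" if v: "v \<in> bases n X" for v
  proof (rule iso_cong)
    show "attach X v \<in> gensD g n (p + 1)" using attach_gensD[OF XY(1) v] .
    have v': "v < nv X" "0 < wt X v" using v by (auto simp: bases_def)
    show "attach Y (\<phi> v) \<in> gensD g n (p + 1)"
      using attach_gensD[OF XY(2)] bij v by (auto simp: bij_betw_def)
    have "contraction n (attach X v) {} (attach Y (\<phi> v)) ((inv \<sigma>)(ne Y := ne X)) (\<phi>(nv X := nv Y))"
      by (rule contraction_attach[OF c']) (use v' wt in auto)
    then show "iso_by n (attach X v) (attach Y (\<phi> v)) \<sigma>"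
    proof (rule contraction_unique[OF wf_attach[OF wf v'(1)]
          contraction_refl[OF wf_attach[OF wf v'(1)]]])
      show "\<sigma> permutes {..<ne (attach X v)}" by (rule permutes_subset[OF p]) auto
      fix j assume j: "j < ne (attach X v)"
      show "((inv \<sigma>)(ne Y := ne X)) (\<sigma> j) = id j"
      proof (cases "j = ne X")
        case True
        then have "\<sigma> j = j" using p by (simp add: permutes_not_in)
        then show ?thesis using True ne by simp
      next
        case False
        then have "\<sigma> j < ne X" using j permutes_in_image[OF p, of j] by auto
        then show ?thesis using ne permutes_inverses(2)[OF p] by simp
      qed
    qed
  qed
  from cong_mod_sum[OF this, of "bases n X" "\<lambda>v. v" "\<lambda>_. (-1 :: rat) ^ ne X"]
  have "cong_mod (relgensD g n (p + 1)) (hop n (delta X))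
    (\<lambda>Z. \<Sum>v\<in>bases n X. (-1) ^ ne X * (of_int (sign \<sigma>) * delta (attach Y (\<phi> v)) Z))"
    unfolding hop_delta by simp
  moreover have "(\<Sum>v\<in>bases n X. (-1) ^ ne X * (of_int (sign \<sigma>) * delta (attach Y (\<phi> v)) Z)) =
      of_int (sign \<sigma>) * hop n (delta Y) Z" for Z
    unfolding hop_delta ne
    by (subst sum.reindex_bij_betw[OF bij, symmetric])
      (simp add: sum_distrib_left mult.left_commute)
  ultimately have "cong_mod (relgensD g n (p + 1)) (hop n (delta X))
      (\<lambda>Z. of_int (sign \<sigma>) * hop n (delta Y) Z)" by simp
  then show "hop n s \<in> spanQ (relgensD g n (p + 1))"
    unfolding s cong_mod_def by (simp add: fslin_diff_scale[OF fslin_hop])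
qed

text \<open>Edges are counted rather than tips: an edge joining two tips contributes once. As a tip
  is not a base, the second condition speaks about the other end.\<close>

definition tail_count :: "nat \<Rightarrow> lgraph \<Rightarrow> nat" where
  "tail_count n X = card {i. i < ne X \<and> tips n X \<inter> ends X i \<noteq> {} \<and> bases n X \<inter> ends X i = {}}"

text \<open>A base contributes by growing a tail and contracting it; a tail whose foot is not a base
  contributes by being contracted and regrown. If the foot is a base, the second contribution is
  cancelled by a term of d h.\<close>

definition eigenvalue :: "nat \<Rightarrow> lgraph \<Rightarrow> nat" where
  "eigenvalue n X = card (bases n X) + tail_count n X"

text \<open>The regrown tail has the last label instead of \<open>i\<close>. Restoring the old order
  is the cycle \<open>move_last\<close>, whose sign appears on the right.\<close>

lemma attach_contracted_tail:
  assumes X: "X \<in> gensD g n p" and i: "i < ne X"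
    and c: "contraction n X {i} (contract X i) (skip i) \<rho>"
    and t: "t \<in> tips n X" and e: "ends X i = {b, t}" and bt: "b \<noteq> t"
  shows "cong_mod (relgensD g n p) (delta (attach (contract X i) (\<rho> b)))
    (\<lambda>Z. (-1) ^ (ne X - 1 - i) * delta X Z)"
proof -
  let ?Y = "contract X i"
  let ?Y' = "attach ?Y (\<rho> b)"
  define m where "m = ne X - 1"
  have m: "ne X = Suc m" "i \<le> m" using i by (auto simp: m_def)
  note wf = gensD_wf[OF X]
  note pos = gensD_excess[OF X]
  note ctx = wf c pos
  have lt: "b < nv X" "t < nv X" using tail_lt[OF ctx t e bt] by auto
  note tp = tip_edge[OF wf t i]
  have t_end: "t \<in> ends X i" using e by simp
  have base: "\<rho> b \<in> bases n ?Y" using tail_bases[OF ctx t e bt] by simp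
  have Y: "?Y \<in> gensD g n (p - 1)" by (rule contract_gensD[OF X i])
  have Y': "?Y' \<in> gensD g n p" using attach_gensD[OF Y base] by simp
  have neY: "ne ?Y = m" using m i by (simp add: ne_contract)
  \<comment> \<open>The contraction identified \<open>t\<close> with \<open>b\<close>; the tip is
    now sent to the regrown vertex instead.\<close>
  let ?\<phi> = "\<rho>(t := nv ?Y)"
  have rt: "\<rho> t = \<rho> b" using edge_kernel[OF ctx lt(2,1)] e by simp
  have ker: "\<rho> u = \<rho> v \<longleftrightarrow> u = v" if "u < nv X" "v < nv X" "u \<noteq> t" "v \<noteq> t" for u v
    using edge_kernel[OF ctx that(1,2)] that e by auto
  have clt: "\<rho> v < nv ?Y" if "v < nv X" for v using contraction_lt[OF wf c that] .
  have im: "?\<phi> ` {..<nv X} = {..<nv ?Y'}"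
  proof
    show "?\<phi> ` {..<nv X} \<subseteq> {..<nv ?Y'}" using clt by (auto simp: less_Suc_eq)
    show "{..<nv ?Y'} \<subseteq> ?\<phi> ` {..<nv X}"
    proof
      fix y assume "y \<in> {..<nv ?Y'}"
      then consider "y = nv ?Y" | "y < nv ?Y" by fastforce
      then show "y \<in> ?\<phi> ` {..<nv X}"
      proof cases
        case 1
        then show ?thesis using lt by (intro image_eqI[of _ _ t]) auto
      next
        case 2
        then obtain v where v: "v < nv X" "\<rho> v = y" using contraction_surj[OF wf c] by blast
        define u where "u = (if v = t then b else v)"
        have "u < nv X" "?\<phi> u = y" using v rt bt lt by (auto simp: u_def)
        then show ?thesis by blast
      qed
    qed
  qed
  have inj: "?\<phi> u = ?\<phi> v \<longleftrightarrow> u = v" if "u < nv X" "v < nv X" for u v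
    using ker[OF that] clt[OF that(1)] clt[OF that(2)] by (cases "u = t"; cases "v = t") auto
  have fib: "fib X ?\<phi> (?\<phi> v) = {v}" if "v < nv X" for v
    unfolding fib_def using inj that by blast
  have en: "ends ?Y' j = ?\<phi> ` ends X (move_last m i j)" if j: "j < ne ?Y'" for j
  proof (cases "j = m")
    case True
    then show ?thesis using bt by (simp add: move_last_def neY e insert_commute)
  next
    case False
    then have j': "j < m" using j neY by simp
    have sk: "skip i j < ne X" "skip i j \<noteq> i" using j' m by (auto simp: skip_def)
    have "t \<notin> ends X (skip i j)" using tp(2)[OF t_end sk] .
    then have "?\<phi> ` ends X (skip i j) = \<rho> ` ends X (skip i j)" by (intro image_cong) auto
    then show ?thesis using False j' contraction_ends[OF wf c, of j] neY by (simp add: move_last_def)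
  qed
  \<comment> \<open>At \<open>b\<close> the unit of weight gained by absorbing the tip is given back
    by the attachment.\<close>
  have w: "wt ?Y' (?\<phi> v) = wt X v" if v: "v < nv X" for v
  proof -
    consider "v = t" | "v = b" | "v \<noteq> t" "v \<noteq> b" by blast
    then show ?thesis
    proof cases
      case 1
      then show ?thesis using tp(1)[OF t_end] by simp
    next
      case 2
      then show ?thesis using tail_wt[OF ctx t e bt] bt clt[OF lt(1)] by simp
    next
      case 3
      then have "\<rho> v \<noteq> \<rho> b" using ker[OF v lt(1)] bt by simp
      moreover have "wt ?Y (\<rho> v) = wt X v" using edge_wt[OF ctx v] 3 e by simp
      ultimately show ?thesis using 3 clt[OF v] by simp
    qed
  qed
  have mk: "mk ?Y' j = ?\<phi> (mk X j)" if "j \<in> {1..n}" for j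
    using contraction_mk[OF wf c that] tp(3)[OF t_end that] by simp
  have c': "contraction n X {} ?Y' (move_last m i) ?\<phi>"
    unfolding contraction_def
  proof (intro conjI allI impI ballI im en mk)
    show "bij_betw (move_last m i) {..<ne ?Y'} ({..<ne X} - {})"
      using permutes_imp_bij[OF move_last_permutes[OF m(2)]] m(1) neY by (simp add: lessThan_Suc_atMost)
  next
    fix u v assume "u < nv X" "v < nv X"
    then show "?\<phi> u = ?\<phi> v \<longleftrightarrow> (u, v) \<in> (adj_on X {})\<^sup>*" using inj by (simp add: adj_on_def)
  next
    fix y assume "y < nv ?Y'"
    then have "y \<in> ?\<phi> ` {..<nv X}" unfolding im by simp
    then obtain v where v: "v < nv X" "y = ?\<phi> v" by blast
    have "int (wt ?Y' y) - 1 = (\<Sum>v\<in>fib X ?\<phi> y. int (wt X v) - 1)"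
      unfolding v(2) fib[OF v(1)] w[OF v(1)] by simp
    then show "int (wt ?Y' y) - 1 = (\<Sum>v\<in>fib X ?\<phi> y. int (wt X v) - 1)
      + int (card {i \<in> {}. ?\<phi> ` ends X i = {y}})" by simp
  qed auto
  have ml: "move_last m i permutes {..<ne ?Y'}"
    using move_last_permutes[OF m(2)] neY by (simp add: lessThan_Suc_atMost)
  have "iso_by n ?Y' X (move_last m i)"
    by (rule contraction_unique[OF wf c' contraction_refl[OF wf] ml]) simp
  from iso_cong[OF Y' X this] show ?thesis
    using sign_move_last[OF m(2)] by (simp add: m_def)
qed

text \<open>Isolates what edge \<open>i\<close> contributes to d h + h d: tails grown before the
  contraction, minus tails grown after it. What survives depends on whether \<open>i\<close> is a
  tail and on whether its foot is a base.\<close>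

lemma homotopy_edge:
  assumes X: "X \<in> gensD g n p" and i: "i < ne X"
    and c: "contraction n X {i} (contract X i) (skip i) \<rho>"
  shows "cong_mod (relgensD g n p \<union> delta ` {Y \<in> weighted_gens g n p. card (tips n X) < card (tips n Y)})
    (\<lambda>Z. (\<Sum>v\<in>bases n X. delta (attach (contract X i) (\<rho> v)) Z)
      - (\<Sum>u\<in>bases n (contract X i). delta (attach (contract X i) u) Z))
    (\<lambda>Z. (if tips n X \<inter> ends X i \<noteq> {} \<and> bases n X \<inter> ends X i = {} then 1 else 0)
      * ((-1) ^ ne X * (-1) ^ i) * delta X Z)"
    (is "cong_mod ?W ?E _")
proof -
  let ?Y = "contract X i"
  let ?a = "\<lambda>u. delta (attach ?Y u)"
  note wf = gensD_wf[OF X]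
  note pos = gensD_excess[OF X]
  note ctx = wf c pos
  have Y: "?Y \<in> gensD g n (p - 1)" by (rule contract_gensD[OF X i])
  show ?thesis
  proof (cases "tips n X \<inter> ends X i = {}")
    case True
    \<comment> \<open>Off the tips, contraction loses no tip and attachment gains at least one, so
      each term of both sums vanishes modulo \<open>?W\<close> separately.\<close>
    have mem: "?a u \<in> spanQ ?W" if u: "u \<in> bases n ?Y" for u
    proof (rule spanQ_base)
      have "card (tips n X) \<le> card (tips n ?Y)" by (rule card_tips_edge[OF ctx True])
      also have "\<dots> < card (tips n (attach ?Y u))" by (rule card_tips_attach[OF gensD_wf[OF Y] u])
      finally show "?a u \<in> ?W" using attach_weighted_gens[OF Y u] by auto
    qed
    have "(\<lambda>Z. \<Sum>v\<in>bases n X. 1 * ?a (\<rho> v) Z) \<in> spanQ ?W"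
      by (rule spanQ_sum) (use mem edge_bases[OF ctx] in auto)
    moreover have "(\<lambda>Z. \<Sum>u\<in>bases n ?Y. 1 * ?a u Z) \<in> spanQ ?W"
      by (rule spanQ_sum) (rule mem)
    ultimately have "(\<lambda>Z. (\<Sum>v\<in>bases n X. 1 * ?a (\<rho> v) Z) - (\<Sum>u\<in>bases n ?Y. 1 * ?a u Z)) \<in> spanQ ?W"
      by (rule spanQ_diff)
    then show ?thesis using True by (simp add: cong_mod_def)
  next
    case False
    then obtain t where t: "t \<in> tips n X" "t \<in> ends X i" by auto
    have "\<exists>b. ends X i = {b, t} \<and> b \<noteq> t"
      using wf i
    proof (cases rule: wf_ends_cases)
      case (1 a)
      then show ?thesis using t tip_edge(4)[OF wf t(1) i t(2)] by simp
    next
      case (2 a b)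
      then show ?thesis using t by auto
    qed
    then obtain b where e: "ends X i = {b, t}" and bt: "b \<noteq> t" by auto
    have t_base: "t \<notin> bases n X" using t by (simp add: tips_def bases_def)
    have im: "(\<Sum>v\<in>bases n X. ?a (\<rho> v) Z) = (\<Sum>u\<in>\<rho> ` bases n X. ?a u Z)" for Z
      using sum.reindex[OF tail_inj[OF ctx t(1) e bt], of "\<lambda>u. ?a u Z"] by simp
    show ?thesis
    proof (cases "b \<in> bases n X")
      case True
      \<comment> \<open>The foot was a base already, so both sums run over the same attachments and
        cancel.\<close>
      then have "bases n ?Y = \<rho> ` bases n X" using tail_bases[OF ctx t(1) e bt] by auto
      moreover have "bases n X \<inter> ends X i \<noteq> {}" using True e by auto
      ultimately show ?thesis by (simp add: im)
    next
      case b: False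
      have "bases n ?Y = insert (\<rho> b) (\<rho> ` bases n X)" by (rule tail_bases[OF ctx t(1) e bt])
      moreover have "\<rho> b \<notin> \<rho> ` bases n X" by (rule tail_base_notin[OF ctx t(1) e bt b])
      \<comment> \<open>The foot has become a base only through the contraction, so exactly one term
        of h d is unmatched.\<close>
      ultimately have E: "?E Z = (-1) * ?a (\<rho> b) Z" for Z by (simp add: im)
      have "cong_mod (relgensD g n p) (\<lambda>Z. (-1) * ?a (\<rho> b) Z)
          (\<lambda>Z. (-1) * ((-1) ^ (ne X - 1 - i) * delta X Z))"
        by (rule cong_mod_scale[OF attach_contracted_tail[OF X i c t(1) e bt]])
      moreover have "(-1) * ((-1) ^ (ne X - 1 - i) * x) = (-1) ^ ne X * (-1) ^ i * x" for x :: rat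
      proof -
        have "(-1) ^ (ne X - 1 - i) = ((-1) ^ (ne X - 1) * (-1) ^ i :: rat)"
          using i by (intro minus_one_power_diff) simp
        moreover have "(-1) ^ ne X = - ((-1) ^ (ne X - 1) :: rat)" using i by (cases "ne X") auto
        ultimately show ?thesis by simp
      qed
      moreover have "bases n X \<inter> ends X i = {}" using b e t_base by auto
      ultimately have "cong_mod (relgensD g n p) ?E
          (\<lambda>Z. (if tips n X \<inter> ends X i \<noteq> {} \<and> bases n X \<inter> ends X i = {} then 1 else 0)
            * ((-1) ^ ne X * (-1) ^ i) * delta X Z)"
        using False unfolding E by simp
      then show ?thesis by (rule cong_mod_mono) auto
    qed
  qed
qed

text \<open>A face contracting an old edge commutes with the attachment, and the last face removes
  the new tail. The labels agree in both cases, so no permutation sign arises.\<close>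

lemma homotopy_attach:
  assumes X: "X \<in> gensD g n p" and v: "v \<in> bases n X"
    and c: "\<And>i. i < ne X \<Longrightarrow> contraction n X {i} (contract X i) (skip i) (\<rho> i)"
  shows "cong_mod (relgensD g n p) (dD (delta (attach X v)))
    (\<lambda>Z. (\<Sum>i<ne X. (-1) ^ i * delta (attach (contract X i) (\<rho> i v)) Z) + (-1) ^ ne X * delta X Z)"
proof -
  note wf = gensD_wf[OF X]
  have v': "v < nv X" "0 < wt X v" using v by (auto simp: bases_def)
  have X': "attach X v \<in> gensD g n (p + 1)" by (rule attach_gensD[OF X v])
  note wf' = gensD_wf[OF X']
  have low: "cong_mod (relgensD g n p) (delta (contract (attach X v) i))
      (delta (attach (contract X i) (\<rho> i v)))" if i: "i < ne X" for i
  proof (rule iso_cong_id)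
    let ?Y = "contract X i"
    have i': "i < ne (attach X v)" using i by simp
    show g1: "contract (attach X v) i \<in> gensD g n p" using contract_gensD[OF X' i'] by simp
    have base: "\<rho> i v \<in> bases n ?Y" using edge_bases[OF wf c[OF i] gensD_excess[OF X] v] by blast
    show "attach ?Y (\<rho> i v) \<in> gensD g n p"
      using attach_gensD[OF contract_gensD[OF X i] base] by simp
    obtain \<rho>' where c1: "contraction n (attach X v) {i} (contract (attach X v) i) (skip i) \<rho>'"
      using contract_edge[OF wf' i'] .
    have "0 < wt ?Y (\<rho> i v)" using base by (simp add: bases_def)
    from contraction_attach[OF wf c[OF i] v' this]
    have c2: "contraction n (attach X v) {i} (attach ?Y (\<rho> i v)) ((skip i)(ne ?Y := ne X))
        ((\<rho> i)(nv X := nv ?Y))" .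
    show "iso_by n (contract (attach X v) i) (attach ?Y (\<rho> i v)) id"
    proof (rule contraction_unique[OF wf' c1 c2 permutes_id])
      fix j show "((skip i)(ne ?Y := ne X)) (id j) = skip i j"
        using i by (simp add: ne_contract) (auto simp: skip_def)
    qed
  qed
  have top: "cong_mod (relgensD g n p) (delta (contract (attach X v) (ne X))) (delta X)"
  proof (rule iso_cong_id[OF _ X])
    have i': "ne X < ne (attach X v)" by simp
    show "contract (attach X v) (ne X) \<in> gensD g n p" using contract_gensD[OF X' i'] by simp
    obtain \<rho>' where c1: "contraction n (attach X v) {ne X} (contract (attach X v) (ne X)) (skip (ne X)) \<rho>'"
      using contract_edge[OF wf' i'] .
    show "iso_by n (contract (attach X v) (ne X)) X id"
      by (rule contraction_unique[OF wf' c1 contraction_attached[OF wf v'] permutes_id]) simp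
  qed
  have "dD (delta (attach X v)) = (\<lambda>Z. (\<Sum>i<ne X. (-1) ^ i * delta (contract (attach X v) i) Z)
      + (-1) ^ ne X * delta (contract (attach X v) (ne X)) Z)"
    by (simp add: dD_delta)
  moreover have "cong_mod (relgensD g n p) \<dots>
    (\<lambda>Z. (\<Sum>i<ne X. (-1) ^ i * delta (attach (contract X i) (\<rho> i v)) Z) + (-1) ^ ne X * delta X Z)"
    by (intro cong_mod_add cong_mod_sum cong_mod_scale low top) simp
  ultimately show ?thesis by simp
qed

text \<open>The sum is sorted by contracted edge: each new tail gives back \<open>X\<close>, and
  each old edge is handled by \<open>homotopy_edge\<close>.\<close>

lemma homotopy:
  assumes X: "X \<in> gensD g n p"
  shows "cong_mod (relgensD g n p \<union> delta ` {Y \<in> weighted_gens g n p. card (tips n X) < card (tips n Y)})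
    (\<lambda>Z. dD (hop n (delta X)) Z + hop n (dD (delta X)) Z)
    (\<lambda>Z. of_nat (eigenvalue n X) * delta X Z)"
    (is "cong_mod ?W _ _")
proof -
  let ?m = "ne X"
  have "\<forall>i. \<exists>\<rho>. i < ?m \<longrightarrow> contraction n X {i} (contract X i) (skip i) \<rho>"
    using contract_edge[OF gensD_wf[OF X]] by metis
  then obtain \<rho> where c: "\<And>i. i < ?m \<Longrightarrow> contraction n X {i} (contract X i) (skip i) (\<rho> i)"
    by metis
  let ?a = "\<lambda>i u. delta (attach (contract X i) u)"
  let ?s = "(-1) ^ ?m :: rat"
  have sq: "?s * (?s * x) = x" for x
    by (simp add: mult.assoc[symmetric] flip: power_mult_distrib)
  have "dD (hop n (delta X)) = (\<lambda>Z. \<Sum>v\<in>bases n X. ?s * dD (delta (attach X v)) Z)"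
    unfolding hop_delta by (rule fslin_sum[OF fslin_dD]) simp
  moreover have "cong_mod (relgensD g n p) (\<lambda>Z. \<Sum>v\<in>bases n X. ?s * dD (delta (attach X v)) Z)
    (\<lambda>Z. \<Sum>v\<in>bases n X. ?s * ((\<Sum>i<?m. (-1) ^ i * ?a i (\<rho> i v) Z) + ?s * delta X Z))"
    by (intro cong_mod_sum homotopy_attach[OF X] c)
  ultimately have 1: "cong_mod (relgensD g n p) (dD (hop n (delta X)))
    (\<lambda>Z. \<Sum>v\<in>bases n X. ?s * ((\<Sum>i<?m. (-1) ^ i * ?a i (\<rho> i v) Z) + ?s * delta X Z))" by simp
  have 2: "hop n (dD (delta X)) =
      (\<lambda>Z. \<Sum>i<?m. (-1) ^ i * (\<Sum>u\<in>bases n (contract X i). - ?s * ?a i u Z))"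
  proof -
    \<comment> \<open>One edge fewer, hence the opposite sign in \<open>hop\<close>; this turns the
      sum of the two composites into the difference \<open>?E\<close>.\<close>
    have neg: "(-1) ^ ne (contract X i) = - ?s" if "i < ?m" for i
      using that by (cases ?m) (auto simp: ne_contract)
    have "hop n (dD (delta X)) = (\<lambda>Z. \<Sum>i<?m. (-1) ^ i * hop n (delta (contract X i)) Z)"
      unfolding dD_delta by (rule fslin_sum[OF fslin_hop]) simp
    then show ?thesis by (simp add: hop_delta neg cong: sum.cong_simp)
  qed
  let ?E = "\<lambda>i Z. (\<Sum>v\<in>bases n X. ?a i (\<rho> i v) Z) - (\<Sum>u\<in>bases n (contract X i). ?a i u Z)"
  have "(\<Sum>v\<in>bases n X. ?s * ((\<Sum>i<?m. (-1) ^ i * ?a i (\<rho> i v) Z) + ?s * delta X Z))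
      + (\<Sum>i<?m. (-1) ^ i * (\<Sum>u\<in>bases n (contract X i). - ?s * ?a i u Z))
    = of_nat (card (bases n X)) * delta X Z + (\<Sum>i<?m. (?s * (-1) ^ i) * ?E i Z)" for Z
  proof -
    have "(\<Sum>v\<in>bases n X. ?s * ((\<Sum>i<?m. (-1) ^ i * ?a i (\<rho> i v) Z) + ?s * delta X Z)) =
      (\<Sum>i<?m. \<Sum>v\<in>bases n X. ?s * ((-1) ^ i * ?a i (\<rho> i v) Z)) + of_nat (card (bases n X)) * delta X Z"
      by (simp add: distrib_left sum.distrib sq sum_distrib_left sum.swap[of _ "{..<?m}"])
    then show ?thesis
      by (simp add: right_diff_distrib sum_subtractf sum_distrib_left sum_negf mult.assoc
          mult.left_commute[of ?s])
  qed
  then have "cong_mod (relgensD g n p) (\<lambda>Z. dD (hop n (delta X)) Z + hop n (dD (delta X)) Z)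
      (\<lambda>Z. of_nat (card (bases n X)) * delta X Z + (\<Sum>i<?m. (?s * (-1) ^ i) * ?E i Z))"
    using cong_mod_add[OF 1 cong_mod_refl[of _ "hop n (dD (delta X))"]] unfolding 2 by simp
  then have "cong_mod ?W (\<lambda>Z. dD (hop n (delta X)) Z + hop n (dD (delta X)) Z)
      (\<lambda>Z. of_nat (card (bases n X)) * delta X Z + (\<Sum>i<?m. (?s * (-1) ^ i) * ?E i Z))"
    by (rule cong_mod_mono) simp
  also have "cong_mod ?W \<dots> (\<lambda>Z. of_nat (card (bases n X)) * delta X Z + (\<Sum>i<?m. (?s * (-1) ^ i) *
    ((if tips n X \<inter> ends X i \<noteq> {} \<and> bases n X \<inter> ends X i = {} then 1 else 0) * (?s * (-1) ^ i) * delta X Z)))"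
    by (intro cong_mod_add cong_mod_refl cong_mod_sum homotopy_edge[OF X _ c]) auto
  also have "(\<lambda>Z. of_nat (card (bases n X)) * delta X Z + (\<Sum>i<?m. (?s * (-1) ^ i) *
    ((if tips n X \<inter> ends X i \<noteq> {} \<and> bases n X \<inter> ends X i = {} then 1 else 0) * (?s * (-1) ^ i) * delta X Z)))
    = (\<lambda>Z. of_nat (eigenvalue n X) * delta X Z)"
  proof
    fix Z
    let ?P = "\<lambda>i. tips n X \<inter> ends X i \<noteq> {} \<and> bases n X \<inter> ends X i = {}"
    \<comment> \<open>The sign supplied by \<open>homotopy_edge\<close> equals the one already in
      front, so every counted tail contributes +1 and none cancel.\<close>
    have "(?s * (-1) ^ i) * ((if ?P i then 1 else 0) * (?s * (-1) ^ i) * delta X Z) =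
        (if ?P i then delta X Z else 0)" for i
    proof -
      have "(?s * (-1) ^ i) * (?s * (-1) ^ i) = 1"
        by (simp flip: power_mult_distrib power_add)
      then show ?thesis by (simp add: mult.assoc[symmetric])
    qed
    then have "(\<Sum>i<?m. (?s * (-1) ^ i) * ((if ?P i then 1 else 0) * (?s * (-1) ^ i) * delta X Z)) =
        (\<Sum>i<?m. if ?P i then delta X Z else 0)" by (rule sum.cong[OF refl])
    also have "\<dots> = of_nat (tail_count n X) * delta X Z"
      by (simp add: sum.If_cases tail_count_def Int_def)
    finally show "of_nat (card (bases n X)) * delta X Z + (\<Sum>i<?m. (?s * (-1) ^ i) *
        ((if ?P i then 1 else 0) * (?s * (-1) ^ i) * delta X Z)) = of_nat (eigenvalue n X) * delta X Z"
      by (simp add: eigenvalue_def distrib_right)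
  qed
  finally show ?thesis .
qed

section \<open>Numerical bounds and positivity of the eigenvalue\<close>

lemma total_excess:
  assumes X: "X \<in> gensD g n p"
  shows "(\<Sum>v<nv X. excess n X v) = 2 * int g - 2 + int n"
proof -
  note wf = gensD_wf[OF X]
  have "(\<Sum>v<nv X. \<Sum>i<ne X. half_edges (ends X i) v) = (\<Sum>i<ne X. \<Sum>v<nv X. half_edges (ends X i) v)"
    by (rule sum.swap)
  also have "\<dots> = (\<Sum>i<ne X. 2)"
  proof (rule sum.cong[OF refl])
    fix i assume "i \<in> {..<ne X}"
    then have e: "ends X i \<subseteq> {..<nv X}" "ends X i \<noteq> {}" "card (ends X i) \<le> 2"
      using wf_ends[OF wf] by auto
    \<comment> \<open>Mapping all vertices to one point makes the edge a loop there, which has 2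
      half-edges.\<close>
    have "{v \<in> {..<nv X}. (0::nat) = 0} = {..<nv X}" by auto
    then have "(\<Sum>v<nv X. half_edges (ends X i) v) = half_edges ((\<lambda>_. 0) ` ends X i) 0"
      using sum_half_edges[OF _ e, of "\<lambda>_. 0" 0] by simp
    then show "(\<Sum>v<nv X. half_edges (ends X i) v) = 2" using e(2)
      by (simp add: half_edges_def image_constant_conv)
  qed
  finally have 1: "(\<Sum>v<nv X. \<Sum>i<ne X. half_edges (ends X i) v) = 2 * ne X" by simp
  have "(\<Sum>v<nv X. \<Sum>j\<in>{1..n}. if mk X j = v then 1 else 0 :: nat) =
      (\<Sum>j\<in>{1..n}. \<Sum>v<nv X. if mk X j = v then 1 else 0)" by (rule sum.swap)
  also have "\<dots> = (\<Sum>j\<in>{1..n}. 1)"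
    by (rule sum.cong) (use wf_mk[OF wf] in auto)
  finally have "(\<Sum>v<nv X. val n X v) = 2 * ne X + n"
    using 1 by (simp add: val_half_edges sum.distrib)
  then have "(\<Sum>v<nv X. int (val n X v)) = 2 * int (ne X) + int n"
    by (simp flip: of_nat_sum)
  then show ?thesis using X
    by (simp add: excess_def sum.distrib sum_subtractf gensD_def b1_def total_wt_def
        flip: sum_distrib_left)
qed

text \<open>Each vertex uses at least 1 of the total excess. The bound does not depend on the number
  of edges.\<close>

lemma nv_bound:
  assumes X: "X \<in> gensD g n p"
  shows "int (nv X) \<le> 2 * int g - 2 + int n"
proof -
  have "(\<Sum>v<nv X. 1) \<le> (\<Sum>v<nv X. excess n X v)"
    by (rule sum_mono) (use gensD_excess[OF X] in force)
  then show ?thesis using total_excess[OF X] by simp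
qed

lemma eigenvalue_le:
  assumes X: "X \<in> gensD g n p"
  shows "eigenvalue n X \<le> nv X + ne X"
proof -
  have "card (bases n X) \<le> card {..<nv X}" by (rule card_mono) (auto simp: bases_def)
  moreover have "tail_count n X \<le> card {..<ne X}"
    unfolding tail_count_def by (rule card_mono) auto
  ultimately show ?thesis by (simp add: eigenvalue_def)
qed

lemma card_tips_le: "card (tips n X) \<le> nv X"
  using card_mono[of "{..<nv X}" "tips n X"] by (auto simp: tips_def)

text \<open>Without bases a vertex of positive weight is a tip, and any edge at it would be a
  counted tail. It is therefore isolated, hence the whole graph, and the total excess 2g - 2 + n
  would be 1.\<close>

lemma eigenvalue_pos:
  assumes X: "X \<in> weighted_gens g n p" and gn: "2 \<le> 2 * int g - 2 + int n"
  shows "0 < eigenvalue n X"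
proof (rule ccontr)
  assume "\<not> 0 < eigenvalue n X"
  then have 0: "card (bases n X) = 0" "tail_count n X = 0" by (simp_all add: eigenvalue_def)
  have G: "X \<in> gensD g n p" and "\<exists>v<nv X. 0 < wt X v" using X by (auto simp: weighted_gens_def)
  then obtain v where v: "v < nv X" "0 < wt X v" by auto
  note wf = gensD_wf[OF G]
  have b: "bases n X = {}" using 0(1) by simp
  then have vt: "v \<in> tips n X" using v gensD_excess[OF G v(1)] by (auto simp: bases_def tips_def)
  have "{i. i < ne X \<and> tips n X \<inter> ends X i \<noteq> {}} = {}"
    using 0(2) by (simp add: tail_count_def b)
  then have no: "v \<notin> ends X i" if "i < ne X" for i using vt that by blast
  have "u = v" if u: "u < nv X" for u
    using wf_connected[OF wf v(1) u]
  proof (cases rule: converse_rtranclE)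
    case (step y)
    then have "\<exists>i<ne X. v \<in> ends X i" by (auto simp: adj_def)
    then show ?thesis using no by blast
  qed simp
  then have "{..<nv X} = {v}" using v(1) by blast
  then have "excess n X v = 2 * int g - 2 + int n" using total_excess[OF G] by simp
  then show False using vt gn by (simp add: tips_def)
qed

section \<open>The weight subcomplex is acyclic\<close>

text \<open>If \<open>N = d h + h d\<close> and \<open>z\<close> is a cycle, then \<open>N z\<close> is a boundary, while \<open>N z - (l + 1) z\<close> is a
  cycle in the next smaller filtration step, hence a boundary by induction.\<close>
lemma weighted_acyclic_step:
  fixes g n p
  defines "U \<equiv> \<lambda>s l. relgensD g n p \<union> delta ` {X \<in> weighted_gens g n p.
    s < card (tips n X) \<or> (card (tips n X) = s \<and> eigenvalue n X \<le> l)}"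
  assumes z: "z \<in> spanQ (U s (Suc l))" and cyc: "dD z \<in> relsD g n (p - 1)"
    and IH: "\<And>z. z \<in> spanQ (U s l) \<Longrightarrow> dD z \<in> relsD g n (p - 1) \<Longrightarrow>
      \<exists>y\<in>spanQ (delta ` weighted_gens g n (p + 1)). cong_mod (relgensD g n p) z (dD y)"
  shows "\<exists>y\<in>spanQ (delta ` weighted_gens g n (p + 1)). cong_mod (relgensD g n p) z (dD y)"
proof -
  have zch: "z \<in> chD g n p" unfolding chD_def
  proof (rule spanQ_least[OF z])
    fix x assume "x \<in> U s (Suc l)"
    then consider "x \<in> relgensD g n p" | "x \<in> delta ` gensD g n p"
      by (auto simp: U_def weighted_gens_def)
    then show "x \<in> spanQ (delta ` gensD g n p)"
    proof cases
      case 1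
      then have "x \<in> relsD g n p" by (simp add: relsD_def spanQ_base)
      then show ?thesis unfolding chD_def[symmetric] by (rule relsD_chD)
    qed (rule spanQ_base)
  qed
  define N where "N x = (\<lambda>Z. dD (hop n x) Z + hop n (dD x) Z)" for x
  \<comment> \<open>Subtracting \<open>Suc l\<close> kills the leading term of the generators with
    \<open>s\<close> tips and eigenvalue \<open>Suc l\<close>, and those are the only ones not yet
    in \<open>U s l\<close>.\<close>
  define M where "M x = (\<lambda>Z. N x Z - of_nat (Suc l) * x Z)" for x :: "lgraph \<Rightarrow> rat"
  have linM: "fslin M"
    unfolding fslin_def
  proof (intro conjI allI impI)
    show "M (\<lambda>_. 0) = (\<lambda>_. 0)"
      by (simp add: M_def N_def fslin_zero[OF fslin_hop] fslin_zero[OF fslin_dD])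
    fix c :: rat and f h :: "lgraph \<Rightarrow> rat" assume "finsupp f" "finsupp h"
    then have "dD (hop n (\<lambda>a. c * f a + h a)) = (\<lambda>b. c * dD (hop n f) b + dD (hop n h) b)"
      "hop n (dD (\<lambda>a. c * f a + h a)) = (\<lambda>b. c * hop n (dD f) b + hop n (dD h) b)"
      by (simp_all only: fslinD[OF fslin_hop] fslinD[OF fslin_dD] finsupp_hop finsupp_dD)
    then show "M (\<lambda>a. c * f a + h a) = (\<lambda>b. c * M f b + M h b)"
      unfolding M_def N_def by (simp only:) (simp add: fun_eq_iff algebra_simps)
  qed
  have fin: "finsupp x" if "x \<in> U s (Suc l)" for x
  proof -
    from that consider "x \<in> relgensD g n p" | X where "x = delta X"
      unfolding U_def by blast
    then show ?thesis by cases (auto intro: finsupp_relgensD)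
  qed
  have M: "M z \<in> spanQ (U s l)"
  proof (rule fslin_spanQ[OF linM z fin])
    fix x assume "x \<in> U s (Suc l)"
    then consider (rel) "x \<in> relgensD g n p"
      | (gen) X where "x = delta X" "X \<in> weighted_gens g n p"
        "s < card (tips n X) \<or> (card (tips n X) = s \<and> eigenvalue n X \<le> Suc l)"
      by (auto simp: U_def)
    then show "M x \<in> spanQ (U s l)"
    proof cases
      case rel
      then have x: "x \<in> relsD g n p" by (simp add: relsD_def spanQ_base)
      have "dD (hop n x) \<in> relsD g n p" using dD_relsD[OF hop_relsD[OF x]] by simp
      moreover have "hop n (dD x) \<in> relsD g n p" using hop_relsD[OF dD_relsD[OF x]] by simp
      ultimately have "M x \<in> relsD g n p"
        using x unfolding M_def N_def relsD_def by (intro spanQ_diff spanQ_add spanQ_scale)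
      then show ?thesis unfolding relsD_def by (rule spanQ_mono) (auto simp: U_def)
    next
      case gen
      then have X: "X \<in> gensD g n p" by (simp add: weighted_gens_def)
      let ?W = "relgensD g n p \<union> delta ` {Y \<in> weighted_gens g n p. card (tips n X) < card (tips n Y)}"
      have sub: "?W \<subseteq> U s l" using gen(3) by (auto simp: U_def)
      have "cong_mod (U s l) (N x) (\<lambda>Z. of_nat (eigenvalue n X) * x Z)"
        using cong_mod_mono[OF homotopy[OF X] sub] by (simp add: N_def gen(1))
      then have 1: "(\<lambda>Z. N x Z - of_nat (eigenvalue n X) * x Z) \<in> spanQ (U s l)"
        by (simp add: cong_mod_def)
      have "(\<lambda>Z. (of_nat (eigenvalue n X) - of_nat (Suc l)) * x Z) \<in> spanQ (U s l)"
      proof (cases "eigenvalue n X = Suc l \<and> \<not> s < card (tips n X)")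
        case True
        then show ?thesis by (simp add: spanQ_zero)
      next
        case False
        then have "x \<in> U s l" using gen by (auto simp: U_def)
        then show ?thesis by (intro spanQ_scale spanQ_base)
      qed
      from spanQ_add[OF 1 this] show ?thesis by (simp add: M_def algebra_simps)
    qed
  qed
  have hz: "hop n z \<in> spanQ (delta ` weighted_gens g n (p + 1))" by (rule hop_chD[OF zch])
  then have hz': "hop n z \<in> chD g n (p + 1)"
    unfolding chD_def by (rule spanQ_mono) (auto simp: weighted_gens_def)
  have hdz: "hop n (dD z) \<in> relsD g n p" using hop_relsD[OF cyc] by simp
  \<comment> \<open>Of the three terms, the first is a relation by d d = 0, the other two because
    \<open>dD z\<close> is one and both maps preserve relations.\<close>
  have "dD (M z) \<in> relsD g n (p - 1)"
  proof -
    have "dD (M z) = (\<lambda>Z. 1 * (dD (dD (hop n z)) Z) + dD (hop n (dD z)) Z - of_nat (Suc l) * dD z Z)"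
    proof -
      have f: "finsupp (\<lambda>Z. 1 * dD (hop n z) Z + hop n (dD z) Z)"
        by (rule finsupp_lincomb[OF finsupp_dD finsupp_hop])
      have "M z = (\<lambda>Z. (1 * dD (hop n z) Z + hop n (dD z) Z) - of_nat (Suc l) * z Z)"
        by (simp add: M_def N_def)
      then show ?thesis
        by (simp only: fslin_diff_scale[OF fslin_dD f chD_finsupp[OF zch]]
            fslinD[OF fslin_dD finsupp_dD finsupp_hop])
    qed
    also have "\<dots> \<in> relsD g n (p - 1)"
    proof -
      have "dD (dD (hop n z)) \<in> relsD g n (p - 1)" using dD_dD[OF hz'] by simp
      moreover have "dD (hop n (dD z)) \<in> relsD g n (p - 1)" by (rule dD_relsD[OF hdz])
      ultimately show ?thesis using cyc unfolding relsD_def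
        by (intro spanQ_diff spanQ_lincomb spanQ_scale)
    qed
    finally show ?thesis .
  qed
  from IH[OF M this] obtain y where y: "y \<in> spanQ (delta ` weighted_gens g n (p + 1))"
    "cong_mod (relgensD g n p) (M z) (dD y)" by auto
  define q :: rat where "q = 1 / of_nat (Suc l)"
  \<comment> \<open>Modulo relations \<open>hop n (dD z)\<close> vanishes and \<open>M z\<close> is
    \<open>dD y\<close>, so \<open>Suc l\<close> times \<open>z\<close> is d of
    \<open>hop n z - y\<close>.\<close>
  define w where "w = (\<lambda>Z. q * (hop n z Z - 1 * y Z))"
  have yf: "finsupp y" using y(1) by (rule spanQ_finsupp) auto
  have "w \<in> spanQ (delta ` weighted_gens g n (p + 1))"
    unfolding w_def using spanQ_scale[OF spanQ_diff[OF hz y(1)]] by simp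
  moreover have "cong_mod (relgensD g n p) z (dD w)"
  proof -
    have dw: "dD w = (\<lambda>Z. q * (dD (hop n z) Z - 1 * dD y Z))"
      unfolding w_def fslin_scale[OF fslin_dD finsupp_diff_scale[OF finsupp_hop yf]]
      by (simp only: fslin_diff_scale[OF fslin_dD finsupp_hop yf])
    have "(\<lambda>Z. q * (hop n (dD z) Z - (M z Z - dD y Z))) \<in> spanQ (relgensD g n p)"
      by (rule spanQ_scale[OF spanQ_diff[OF hdz[unfolded relsD_def] y(2)[unfolded cong_mod_def]]])
    moreover have "q * (hop n (dD z) Z - (M z Z - dD y Z)) = z Z - dD w Z" for Z
    proof -
      have "q * of_nat (Suc l) = 1" by (simp add: q_def del: of_nat_Suc)
      then have "q * (of_nat (Suc l) * z Z) = z Z" by (simp only: mult.assoc[symmetric] mult_1)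
      then show ?thesis by (simp add: dw M_def N_def algebra_simps del: of_nat_Suc)
    qed
    ultimately show ?thesis by (simp add: cong_mod_def)
  qed
  ultimately show ?thesis by blast
qed

lemma weighted_acyclic:
  assumes gn: "2 \<le> 2 * int g - 2 + int n"
    and z: "z \<in> spanQ (relgensD g n p \<union> delta ` weighted_gens g n p)"
    and cyc: "dD z \<in> relsD g n (p - 1)"
  shows "\<exists>y\<in>spanQ (delta ` weighted_gens g n (p + 1)). cong_mod (relgensD g n p) z (dD y)"
proof -
  \<comment> \<open>\<open>M\<close> bounds the number of vertices and hence of tips;
    \<open>L\<close> adds the number of edges, \<open>p + 1\<close>, and so bounds every
    eigenvalue.\<close>
  define M where "M = nat (2 * int g - 2 + int n)"
  define L where "L = M + nat (p + 1)"
  define U where "U s l = relgensD g n p \<union> delta ` {X \<in> weighted_gens g n p.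
    s < card (tips n X) \<or> (card (tips n X) = s \<and> eigenvalue n X \<le> l)}" for s l
  have tM: "card (tips n X) \<le> M" and eL: "eigenvalue n X \<le> L" if "X \<in> weighted_gens g n p" for X
  proof -
    have X: "X \<in> gensD g n p" using that by (simp add: weighted_gens_def)
    then have "int (ne X) = p + 1" by (simp add: gensD_def)
    then have "ne X = nat (p + 1)" by linarith
    then show "card (tips n X) \<le> M" "eigenvalue n X \<le> L"
      using nv_bound[OF X] card_tips_le[of n X] eigenvalue_le[OF X] by (auto simp: M_def L_def)
  qed
  define P where "P s l \<longleftrightarrow> (\<forall>z\<in>spanQ (U s l). dD z \<in> relsD g n (p - 1) \<longrightarrow>
      (\<exists>y\<in>spanQ (delta ` weighted_gens g n (p + 1)). cong_mod (relgensD g n p) z (dD y)))" for s l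
  have step: "P s l \<Longrightarrow> P s (Suc l)" for s l
    unfolding P_def U_def using weighted_acyclic_step[of _ g n p s l] by blast
  \<comment> \<open>Eigenvalues are positive, so eigenvalue bound 0 leaves no graph with exactly
    \<open>s\<close> tips, and the stage already lies in the top stage for
    \<open>Suc s\<close>.\<close>
  have base: "P s 0" if "P (Suc s) L" for s
  proof -
    have "Suc s < card (tips n X) \<or> card (tips n X) = Suc s \<and> eigenvalue n X \<le> L"
      if "X \<in> weighted_gens g n p" "s < card (tips n X) \<or> card (tips n X) = s \<and> eigenvalue n X \<le> 0"
      for X
      using that(2) eL[OF that(1)] eigenvalue_pos[OF that(1) gn] by linarith
    then have "U s 0 \<subseteq> U (Suc s) L" unfolding U_def by blast
    then show ?thesis using that spanQ_mono unfolding P_def by blast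
  qed
  have all: "P s l" if "P s 0" for s l
    using that by (induction l) (auto intro: step)
  have "P s L" for s
  \<comment> \<open>Beyond \<open>M\<close> tips there are no graphs, and at bound 0 only relations
    remain, for which 0 is a primitive.\<close>
  proof (induction "Suc M - s" arbitrary: s)
    case 0
    have "\<not> (s < card (tips n X) \<or> card (tips n X) = s \<and> eigenvalue n X \<le> 0)"
      if "X \<in> weighted_gens g n p" for X
      using 0 tM[OF that] by linarith
    then have U0: "U s 0 = relgensD g n p" unfolding U_def by blast
    have "P s 0"
      unfolding P_def U0
    proof (intro ballI impI)
      fix z assume "z \<in> spanQ (relgensD g n p)"
      then have "cong_mod (relgensD g n p) z (dD (\<lambda>_. 0))"
        by (simp add: cong_mod_def fslin_zero[OF fslin_dD])
      then show "\<exists>y\<in>spanQ (delta ` weighted_gens g n (p + 1)). cong_mod (relgensD g n p) z (dD y)"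
        using spanQ_zero by blast
    qed
    then show ?case by (rule all)
  next
    case (Suc k)
    then have "P (Suc s) L" by (intro Suc.hyps(1)) simp
    then show ?case by (rule all[OF base])
  qed
  then have P0: "P 0 L" .
  have "0 < card (tips n X) \<or> card (tips n X) = 0 \<and> eigenvalue n X \<le> L"
    if "X \<in> weighted_gens g n p" for X
    using eL[OF that] by auto
  then have "relgensD g n p \<union> delta ` weighted_gens g n p \<subseteq> U 0 L"
    unfolding U_def by blast
  with z have "z \<in> spanQ (U 0 L)" by (rule spanQ_mono)
  from P0[unfolded P_def, rule_format, OF this cyc] show ?thesis .
qed

section \<open>The natural map\<close>

lemma dG_delta: "dG (delta X) =
    (\<lambda>Y. \<Sum>i | i < ne X \<and> card (ends X i) \<noteq> 1. (-1) ^ i * delta (contract X i) Y)"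
  unfolding dG_def lin_ext_delta by (auto simp: delta_def intro!: sum.cong)

lemma fslin_dG: "fslin dG"
  unfolding dG_def by (rule fslin_lin_ext)

lemma fslin_natmap: "fslin natmap"
  by (auto simp: fslin_def natmap_def)

lemma finsupp_natmap: "finsupp f \<Longrightarrow> finsupp (natmap f)"
  unfolding finsupp_def by (erule finite_subset[rotated]) (auto simp: natmap_def)

lemma natmap_delta: "natmap (delta X) = (if \<forall>v. wt X v = 0 then delta X else (\<lambda>_. 0))"
  by (auto simp: natmap_def delta_def fun_eq_iff)

lemma not_weighted_gens:
  assumes "X \<in> gensD g n p"
  shows "X \<notin> weighted_gens g n p \<longleftrightarrow> (\<forall>v. wt X v = 0)"
proof -
  have "wt X v = 0" if "nv X \<le> v" for v using gensD_wf[OF assms] that by (simp add: wf_lg_def)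
  then show ?thesis using assms by (auto simp: weighted_gens_def not_less)
qed

text \<open>At weight 0 stability means valence at least 3, and \<open>ne = p + 1\<close> gives
  \<open>ne - 2g = p - (2g - 1)\<close>: this is the degree shift.\<close>

lemma gensG_eq: "gensG g n (p - (2 * int g - 1)) = {X \<in> gensD g n p. \<forall>v. wt X v = 0}"
  by (auto simp: gensG_def gensD_def total_wt_def)

lemma chG_eq: "chG g n (p - (2 * int g - 1)) = spanQ (delta ` {X \<in> gensD g n p. \<forall>v. wt X v = 0})"
  by (simp add: chG_def gensG_eq)

text \<open>The inclusion is a section of \<open>natmap\<close> in each degree. It does not commute
  with the differentials, since \<open>dD\<close> contracts loops and so creates weight.\<close>

lemma chG_chD: "x \<in> chG g n (p - (2 * int g - 1)) \<Longrightarrow> x \<in> chD g n p"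
  unfolding chG_eq chD_def by (rule spanQ_mono) auto

lemma relsG_relsD: "x \<in> relsG g n (p - (2 * int g - 1)) \<Longrightarrow> x \<in> relsD g n p"
  unfolding relsG_def relsD_def
  by (rule spanQ_mono) (auto simp: relgensG_def relgensD_def gensG_eq)

lemma natmap_chG: "x \<in> chG g n k \<Longrightarrow> natmap x = x"
  unfolding chG_def spanQ_delta by (auto simp: natmap_def gensG_def fun_eq_iff)

lemma natmap_chD:
  assumes "x \<in> chD g n p"
  shows "natmap x \<in> chG g n (p - (2 * int g - 1))"
  unfolding chG_eq
proof (rule fslin_spanQ[OF fslin_natmap assms[unfolded chD_def]])
  fix s :: "lgraph \<Rightarrow> rat" assume "s \<in> delta ` gensD g n p"
  then obtain X where X: "s = delta X" "X \<in> gensD g n p" by auto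
  show "natmap s \<in> spanQ (delta ` {X \<in> gensD g n p. \<forall>v. wt X v = 0})"
  proof (cases "\<forall>v. wt X v = 0")
    case True
    then have "delta X \<in> delta ` {X \<in> gensD g n p. \<forall>v. wt X v = 0}" using X(2) by blast
    then show ?thesis unfolding X(1) natmap_delta if_P[OF True] by (rule spanQ_base)
  next
    case False
    then show ?thesis unfolding X(1) natmap_delta if_not_P[OF False] by (intro spanQ_zero)
  qed
qed auto

text \<open>Isomorphisms preserve weights, so \<open>natmap\<close> keeps both graphs of a relation
  or kills both.\<close>

lemma natmap_relsD:
  assumes "x \<in> relsD g n p"
  shows "natmap x \<in> relsG g n (p - (2 * int g - 1))"
  unfolding relsG_def
proof (rule fslin_spanQ[OF fslin_natmap assms[unfolded relsD_def] finsupp_relgensD])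
  fix s assume "s \<in> relgensD g n p"
  then obtain X Y \<sigma> where s: "s = (\<lambda>Z. delta X Z - of_int (sign \<sigma>) * delta Y Z)"
    and XY: "X \<in> gensD g n p" "Y \<in> gensD g n p" and iso: "iso_by n X Y \<sigma>"
    by (rule relgensDE)
  from iso obtain \<phi> where "bij_betw \<phi> {..<nv X} {..<nv Y}" "\<forall>v<nv X. wt Y (\<phi> v) = wt X v"
    by (auto simp: iso_by_def)
  then have im: "\<phi> ` {..<nv X} = {..<nv Y}" and w: "\<forall>v<nv X. wt Y (\<phi> v) = wt X v"
    by (simp_all add: bij_betw_def)
  have "(\<forall>y\<in>{..<nv Y}. wt Y y = 0) \<longleftrightarrow> (\<forall>v\<in>{..<nv X}. wt X v = 0)"
    unfolding im[symmetric] using w by simp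
  then have "X \<notin> weighted_gens g n p \<longleftrightarrow> Y \<notin> weighted_gens g n p"
    using XY by (auto simp: weighted_gens_def)
  then have eq: "(\<forall>v. wt X v = 0) \<longleftrightarrow> (\<forall>v. wt Y v = 0)"
    unfolding not_weighted_gens[OF XY(1)] not_weighted_gens[OF XY(2)] .
  have lin: "natmap s = (\<lambda>Z. natmap (delta X) Z - of_int (sign \<sigma>) * natmap (delta Y) Z)"
    unfolding s by (rule fslin_diff_scale[OF fslin_natmap]) auto
  show "natmap s \<in> spanQ (relgensG g n (p - (2 * int g - 1)))"
  proof (cases "\<forall>v. wt X v = 0")
    case True
    then have "natmap s = s" using eq unfolding lin by (simp add: s natmap_delta)
    also have "s \<in> relgensG g n (p - (2 * int g - 1))"
      using True eq XY iso unfolding s relgensG_def gensG_eq by blast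
    finally show ?thesis by (rule spanQ_base)
  next
    case False
    then have "\<not> (\<forall>v. wt Y v = 0)" using eq by blast
    with False have "natmap s = (\<lambda>_. 0)"
      unfolding lin natmap_delta by (simp only: if_False mult_zero_right diff_zero)
    then show ?thesis by (simp add: spanQ_zero)
  qed
qed

text \<open>Weights never decrease and a loop adds 1, so the only faces of weight zero are
  contractions of non-loops in graphs of weight zero. This is why \<open>dG\<close> omits
  loops.\<close>

lemma contract_weight_zero:
  assumes X: "X \<in> gensD g n p" and i: "i < ne X"
  shows "(\<forall>v. wt (contract X i) v = 0) \<longleftrightarrow> (\<forall>v. wt X v = 0) \<and> card (ends X i) \<noteq> 1"
proof -
  let ?Y = "contract X i"
  note wf = gensD_wf[OF X]
  obtain \<rho> where c: "contraction n X {i} ?Y (skip i) \<rho>" and wfY: "wf_lg n ?Y"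
    using contract_edge[OF wf i] .
  note ctx = wf c gensD_excess[OF X]
  have out: "wt X v = 0" if "nv X \<le> v" for v using wf that by (simp add: wf_lg_def)
  have outY: "wt ?Y v = 0" if "nv ?Y \<le> v" for v using wfY that by (simp add: wf_lg_def)
  show ?thesis
  proof
    assume Y0: "\<forall>v. wt ?Y v = 0"
    have "wt X v = 0" for v
      using edge_wt_mono[OF ctx, of v] Y0 out[of v] by (cases "v < nv X") auto
    moreover have "card (ends X i) \<noteq> 1"
    proof
      assume "card (ends X i) = 1"
      then obtain a where a: "ends X i = {a}" by (auto simp: card_1_singleton_iff)
      then have "a < nv X" using wf_ends(1)[OF wf i] by simp
      from edge_wt[OF ctx this] a Y0 show False by simp
    qed
    ultimately show "(\<forall>v. wt X v = 0) \<and> card (ends X i) \<noteq> 1" by blast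
  next
    assume X0: "(\<forall>v. wt X v = 0) \<and> card (ends X i) \<noteq> 1"
    obtain a b where ab: "ends X i = {a, b}" "a \<noteq> b"
      using wf i by (cases rule: wf_ends_cases) (use X0 in auto)
    have "wt ?Y y = 0" if y: "y < nv ?Y" for y
    proof -
      obtain v where "v < nv X" "\<rho> v = y" using contraction_surj[OF wf c y] by blast
      then show ?thesis using edge_wt[OF ctx, of v] X0 ab by (auto split: if_splits)
    qed
    then show "\<forall>v. wt ?Y v = 0" using outY by (metis not_less)
  qed
qed

lemma natmap_dD:
  assumes "x \<in> chD g n p"
  shows "natmap (dD x) = dG (natmap x)"
proof -
  let ?L = "\<lambda>x Y. natmap (dD x) Y - dG (natmap x) Y"
  \<comment> \<open>The span of the empty set is zero; phrasing the equality as membership lets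
    \<open>fslin_spanQ\<close> reduce it to generators. The maps agree exactly, not just modulo
    relations.\<close>
  have "?L x \<in> spanQ {}"
  proof (rule fslin_spanQ[OF _ assms[unfolded chD_def]])
    show "fslin ?L"
      unfolding fslin_def
    proof (intro conjI allI impI)
      show "?L (\<lambda>_. 0) = (\<lambda>_. 0)"
        by (simp add: fslin_zero[OF fslin_natmap] fslin_zero[OF fslin_dD] fslin_zero[OF fslin_dG])
      fix c :: rat and f h :: "lgraph \<Rightarrow> rat" assume "finsupp f" "finsupp h"
      then have "natmap (dD (\<lambda>a. c * f a + h a)) = (\<lambda>b. c * natmap (dD f) b + natmap (dD h) b)"
        "dG (natmap (\<lambda>a. c * f a + h a)) = (\<lambda>b. c * dG (natmap f) b + dG (natmap h) b)"
        by (simp_all only: fslinD[OF fslin_natmap] fslinD[OF fslin_dD] fslinD[OF fslin_dG]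
            finsupp_dD finsupp_natmap)
      then show "?L (\<lambda>a. c * f a + h a) = (\<lambda>b. c * ?L f b + ?L h b)"
        by (simp only:) (simp add: fun_eq_iff algebra_simps)
    qed
  next
    fix s :: "lgraph \<Rightarrow> rat" assume "s \<in> delta ` gensD g n p"
    then obtain X where s: "s = delta X" and X: "X \<in> gensD g n p" by auto
    have eq: "natmap (dD s) = (\<lambda>Z. \<Sum>i<ne X. (-1) ^ i * natmap (delta (contract X i)) Z)"
      unfolding s dD_delta by (rule fslin_sum[OF fslin_natmap]) simp
    have "natmap (dD s) Z = dG (natmap s) Z" for Z
    proof (cases "\<forall>v. wt X v = 0")
      case True
      then have "natmap (dD s) Z = (\<Sum>i<ne X. if card (ends X i) \<noteq> 1 then (-1) ^ i * delta (contract X i) Z else 0)"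
        unfolding eq natmap_delta using contract_weight_zero[OF X]
        by (intro sum.cong) auto
      also have "\<dots> = dG (natmap s) Z"
        using True by (simp add: s natmap_delta dG_delta sum.If_cases Int_def)
      finally show ?thesis .
    next
      case False
      then have "\<not> (\<forall>v. wt (contract X i) v = 0)" if "i < ne X" for i
        using contract_weight_zero[OF X that] by blast
      then have "natmap (delta (contract X i)) = (\<lambda>_. 0)" if "i < ne X" for i
        unfolding natmap_delta using that by (intro if_not_P)
      then have "natmap (dD s) Z = 0" unfolding eq by simp
      moreover have "natmap s = (\<lambda>_. 0)"
        unfolding s natmap_delta using False by (rule if_not_P)
      ultimately show ?thesis by (simp add: fslin_zero[OF fslin_dG])
    qed
    then show "?L s \<in> spanQ {}" by (simp add: spanQ_zero)
  qed auto
  moreover have "spanQ {} = {\<lambda>_ :: lgraph. 0 :: rat}" by (auto intro: spanQ_zero elim: spanQ.cases)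
  ultimately have "?L x = (\<lambda>_. 0)" by (simp only: singleton_iff)
  from fun_cong[OF this] show ?thesis by (intro ext) simp
qed

text \<open>Split \<open>x\<close> into \<open>x - natmap x\<close>, supported on graphs with
  positive weight, and \<open>natmap x\<close>, which is a relation by assumption.\<close>

lemma natmap_kernel:
  "{x \<in> chD g n p. natmap x \<in> relsG g n (p - (2 * int g - 1))} =
    spanQ (delta ` weighted_gens g n p \<union> relgensD g n p)" (is "?K = spanQ ?S")
proof (intro equalityI subsetI)
  fix x assume x: "x \<in> ?K"
  let ?w = "\<lambda>Z. x Z - natmap x Z"
  have x': "finsupp x" "\<And>a. x a \<noteq> 0 \<Longrightarrow> a \<in> gensD g n p"
    using x by (auto simp: chD_def spanQ_delta)
  have "finsupp ?w"
    using finsupp_diff_scale[OF x'(1) finsupp_natmap[OF x'(1)], of 1] by simp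
  moreover have "a \<in> weighted_gens g n p" if "?w a \<noteq> 0" for a
  proof -
    have "x a \<noteq> 0" "\<not> (\<forall>v. wt a v = 0)" using that by (auto simp: natmap_def split: if_splits)
    then show ?thesis using x'(2)[of a] not_weighted_gens by blast
  qed
  ultimately have "?w \<in> spanQ (delta ` weighted_gens g n p)" by (simp add: spanQ_delta)
  then have w: "?w \<in> spanQ ?S" by (rule spanQ_mono) simp
  have "natmap x \<in> relsD g n p" using x relsG_relsD by blast
  then have "natmap x \<in> spanQ ?S" unfolding relsD_def by (rule spanQ_mono) simp
  from spanQ_add[OF w this] show "x \<in> spanQ ?S" by simp
next
  fix x assume x: "x \<in> spanQ ?S"
  have "x \<in> chD g n p" unfolding chD_def
  proof (rule spanQ_least[OF x])
    fix s assume "s \<in> ?S"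
    then consider "s \<in> delta ` gensD g n p" | "s \<in> relsD g n p"
      by (auto simp: weighted_gens_def relsD_def intro: spanQ_base)
    then show "s \<in> spanQ (delta ` gensD g n p)"
      by cases (auto simp flip: chD_def intro: relsD_chD, auto simp: chD_def intro: spanQ_base)
  qed
  moreover have "natmap x \<in> relsG g n (p - (2 * int g - 1))" unfolding relsG_def
  proof (rule fslin_spanQ[OF fslin_natmap x])
    fix s assume "s \<in> ?S"
    then consider (w) X where "s = delta X" "X \<in> weighted_gens g n p" | (r) "s \<in> relgensD g n p" by auto
    note cs = this
    show "finsupp s" using cs by cases (auto intro: finsupp_relgensD)
    show "natmap s \<in> spanQ (relgensG g n (p - (2 * int g - 1)))" using cs
    proof cases
      case w
      then have "\<not> (\<forall>v. wt X v = 0)" by (auto simp: weighted_gens_def)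
      then have "natmap s = (\<lambda>_. 0)" unfolding w(1) natmap_delta by (rule if_not_P)
      then show ?thesis by (simp add: spanQ_zero)
    next
      case r
      then have "s \<in> relsD g n p" by (simp add: relsD_def spanQ_base)
      from natmap_relsD[OF this] show ?thesis by (simp add: relsG_def)
    qed
  qed
  ultimately show "x \<in> ?K" by simp
qed

text \<open>The argument of the long exact sequence with acyclic kernel, carried out on lifted
  chains.\<close>

lemma natmap_homology:
  assumes gn: "2 \<le> 2 * int g - 2 + int n" and q: "q = p - (2 * int g - 1)"
  shows "homology_iso (chD g n) (relsD g n) dD (chG g n) (relsG g n) dG natmap p q"
  unfolding homology_iso_def
proof (intro conjI ballI impI)
  have q1: "q - 1 = (p - 1) - (2 * int g - 1)" and q2: "q + 1 = (p + 1) - (2 * int g - 1)"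
    using q by simp_all
  have bd: "\<exists>y\<in>chD g n (p + 1). (\<lambda>a. z a - dD y a) \<in> relsD g n p"
    if "z \<in> spanQ (delta ` weighted_gens g n p \<union> relgensD g n p)" "dD z \<in> relsD g n (p - 1)" for z
  proof -
    from weighted_acyclic[OF gn, of z p] that
    obtain y where "y \<in> spanQ (delta ` weighted_gens g n (p + 1))" "cong_mod (relgensD g n p) z (dD y)"
      by (auto simp: Un_commute)
    moreover from this(1) have "y \<in> chD g n (p + 1)"
      unfolding chD_def by (rule spanQ_mono) (auto simp: weighted_gens_def)
    ultimately show ?thesis by (auto simp: cong_mod_def relsD_def)
  qed
  {
    fix z assume "z \<in> cycles (chD g n) (relsD g n) dD p"
    then have z: "z \<in> chD g n p" "dD z \<in> relsD g n (p - 1)" by (simp_all add: cycles_def)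
    then show "natmap z \<in> cycles (chG g n) (relsG g n) dG q"
      using natmap_chD[OF z(1)] natmap_relsD[OF z(2)] natmap_dD[OF z(1)]
      by (simp add: cycles_def q q1[unfolded q])
  }
  {
    fix z assume "z \<in> bdries (chD g n) (relsD g n) dD p"
    then obtain y where z: "z \<in> chD g n p" and y: "y \<in> chD g n (p + 1)"
      "(\<lambda>a. z a - dD y a) \<in> relsD g n p" by (auto simp: bdries_def)
    have "natmap (\<lambda>a. z a - dD y a) = (\<lambda>a. natmap z a - dG (natmap y) a)"
      unfolding fslin_diff[OF fslin_natmap chD_finsupp[OF z] finsupp_dD] natmap_dD[OF y(1)] ..
    then have "(\<lambda>a. natmap z a - dG (natmap y) a) \<in> relsG g n q"
      using natmap_relsD[OF y(2)] q by simp
    moreover have "natmap z \<in> chG g n q" using natmap_chD[OF z] q by simp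
    moreover have "natmap y \<in> chG g n (q + 1)" using natmap_chD[OF y(1)] q2 by simp
    ultimately show "natmap z \<in> bdries (chG g n) (relsG g n) dG q" by (auto simp: bdries_def)
  }
  {
    fix z assume "z \<in> cycles (chD g n) (relsD g n) dD p"
      and "natmap z \<in> bdries (chG g n) (relsG g n) dG q"
    then obtain y where z: "z \<in> chD g n p" "dD z \<in> relsD g n (p - 1)" and y: "y \<in> chG g n (q + 1)"
      "(\<lambda>a. natmap z a - dG y a) \<in> relsG g n q" by (auto simp: cycles_def bdries_def)
    have yD: "y \<in> chD g n (p + 1)" using y(1) chG_chD unfolding q2 by blast
    \<comment> \<open>Injectivity: \<open>y\<close> is its own lift, so \<open>?w\<close> is a cycle
      in the kernel and bounds some \<open>y'\<close>; then \<open>z\<close> bounds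
      \<open>y + y'\<close> modulo relations.\<close>
    let ?w = "\<lambda>a. z a - dD y a"
    note fin = chD_finsupp[OF z(1)] finsupp_dD[of y]
    have "?w \<in> chD g n p" using z(1) dD_chD[OF yD] unfolding chD_def by (simp add: spanQ_diff)
    moreover have "natmap ?w = (\<lambda>a. natmap z a - dG y a)"
      unfolding fslin_diff[OF fslin_natmap fin] natmap_dD[OF yD] natmap_chG[OF y(1)] ..
    ultimately have "?w \<in> spanQ (delta ` weighted_gens g n p \<union> relgensD g n p)"
      using y(2) q unfolding natmap_kernel[symmetric] by simp
    moreover have "dD ?w \<in> relsD g n (p - 1)"
      unfolding fslin_diff[OF fslin_dD fin] using z(2) dD_dD[OF yD]
      by (simp add: relsD_def spanQ_diff)
    ultimately obtain y' where y': "y' \<in> chD g n (p + 1)" "(\<lambda>a. ?w a - dD y' a) \<in> relsD g n p"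
      using bd by blast
    have "(\<lambda>a. 1 * y a + y' a) \<in> chD g n (p + 1)"
      using yD y'(1) unfolding chD_def by (rule spanQ_lincomb)
    moreover have "dD (\<lambda>a. 1 * y a + y' a) = (\<lambda>a. 1 * dD y a + dD y' a)"
      by (rule fslinD[OF fslin_dD chD_finsupp[OF yD] chD_finsupp[OF y'(1)]])
    then have "(\<lambda>a. z a - dD (\<lambda>a. 1 * y a + y' a) a) \<in> relsD g n p"
      using y'(2) by (simp add: diff_diff_eq)
    ultimately show "z \<in> bdries (chD g n) (relsD g n) dD p"
      using z(1) unfolding bdries_def by blast
  }
  {
    fix z' assume "z' \<in> cycles (chG g n) (relsG g n) dG q"
    then have z': "z' \<in> chG g n q" "dG z' \<in> relsG g n (q - 1)" by (simp_all add: cycles_def)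
    have zD: "z' \<in> chD g n p" using z'(1) chG_chD unfolding q by blast
    have "natmap (dD z') \<in> relsG g n ((p - 1) - (2 * int g - 1))"
      using z'(2) unfolding natmap_dD[OF zD] natmap_chG[OF z'(1)] q1 .
    \<comment> \<open>Surjectivity: \<open>z'\<close> need not be a cycle upstairs, but its boundary
      is a cycle in the kernel, hence the boundary of some \<open>y\<close> there, and
      \<open>z' - y\<close> is the required cycle.\<close>
    then have "dD z' \<in> spanQ (delta ` weighted_gens g n (p - 1) \<union> relgensD g n (p - 1))"
      using dD_chD[OF zD] unfolding natmap_kernel[symmetric] by simp
    moreover have "dD (dD z') \<in> relsD g n (p - 1 - 1)" using dD_dD[OF zD] by simp
    ultimately obtain y where y: "y \<in> spanQ (delta ` weighted_gens g n p)"
      "cong_mod (relgensD g n (p - 1)) (dD z') (dD y)"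
      using weighted_acyclic[OF gn, of "dD z'" "p - 1"] by (auto simp: Un_commute)
    have "y \<in> spanQ (delta ` weighted_gens g n p \<union> relgensD g n p)"
      using y(1) by (rule spanQ_mono) simp
    then have yK: "y \<in> chD g n p" "natmap y \<in> relsG g n q"
      unfolding natmap_kernel[symmetric] q by simp_all
    let ?z = "\<lambda>a. z' a - y a"
    note fin = chD_finsupp[OF zD] chD_finsupp[OF yK(1)]
    have "?z \<in> cycles (chD g n) (relsD g n) dD p"
      using zD yK(1) y(2)
      by (simp add: cycles_def fslin_diff[OF fslin_dD fin] cong_mod_def relsD_def)
        (simp add: chD_def spanQ_diff)
    moreover have "(\<lambda>a. natmap ?z a - z' a) \<in> bdries (chG g n) (relsG g n) dG q"
    proof -
      \<comment> \<open>The lift misses \<open>z'\<close> only by \<open>natmap y\<close>, a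
        relation, so 0 serves as primitive.\<close>
      have eq: "(\<lambda>a. natmap ?z a - z' a) = (\<lambda>a. (-1) * natmap y a)"
        unfolding fslin_diff[OF fslin_natmap fin] natmap_chG[OF z'(1)] by simp
      have "(\<lambda>a. (-1) * natmap y a) \<in> relsG g n q"
        using yK(2) unfolding relsG_def by (rule spanQ_scale)
      moreover have "(\<lambda>a. (-1) * natmap y a) \<in> chG g n q"
        using natmap_chD[OF yK(1)] unfolding chG_def q by (rule spanQ_scale)
      moreover have "(\<lambda>_. 0) \<in> chG g n (q + 1)" unfolding chG_def by (rule spanQ_zero)
      ultimately show ?thesis
        unfolding eq bdries_def by (auto intro!: bexI[of _ "\<lambda>_. 0"] simp: fslin_zero[OF fslin_dG])
    qed
    ultimately show "\<exists>z\<in>cycles (chD g n) (relsD g n) dD p.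
        (\<lambda>a. natmap z a - z' a) \<in> bdries (chG g n) (relsG g n) dG q" by blast
  }
qed

theorem theorem1p4:
  fixes g n :: nat
  assumes "1 \<le> g" and "2 \<le> 2 * int g - 2 + int n"
  shows
    \<comment> \<open>natmap is well defined on the quotients and maps degree p to degree p-(2g-1)\<close>
    "(\<forall>p. \<forall>x \<in> chD g n p. natmap x \<in> chG g n (p - (2 * int g - 1))) \<and>
     (\<forall>p. \<forall>x \<in> relsD g n p. natmap x \<in> relsG g n (p - (2 * int g - 1))) \<and>
     \<comment> \<open>chain map\<close>
     (\<forall>p. \<forall>x \<in> chD g n p.
        (\<lambda>Y. natmap (dD x) Y - dG (natmap x) Y) \<in> relsG g n (p - 1 - (2 * int g - 1))) \<and>
     \<comment> \<open>surjective\<close>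
     (\<forall>k. \<forall>y \<in> chG g n k. \<exists>x \<in> chD g n (k + (2 * int g - 1)).
        (\<lambda>Y. natmap x Y - y Y) \<in> relsG g n k) \<and>
     \<comment> \<open>kernel = subcomplex spanned by cells with a vertex of positive weight\<close>
     (\<forall>p. {x \<in> chD g n p. natmap x \<in> relsG g n (p - (2 * int g - 1))} =
          spanQ (delta ` {X \<in> gensD g n p. \<exists>v < nv X. 0 < wt X v} \<union> relgensD g n p)) \<and>
     \<comment> \<open>isomorphism on homology\<close>
     (\<forall>k. homology_iso (chD g n) (relsD g n) dD (chG g n) (relsG g n) dG natmap
                        (k + (2 * int g - 1)) k)"
proof (intro conjI allI ballI)
  fix p x assume "x \<in> chD g n p"
  then show "natmap x \<in> chG g n (p - (2 * int g - 1))" by (rule natmap_chD)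
next
  fix p x assume "x \<in> relsD g n p"
  then show "natmap x \<in> relsG g n (p - (2 * int g - 1))" by (rule natmap_relsD)
next
  fix p x assume "x \<in> chD g n p"
  then show "(\<lambda>Y. natmap (dD x) Y - dG (natmap x) Y) \<in> relsG g n (p - 1 - (2 * int g - 1))"
    by (simp add: natmap_dD relsG_def spanQ_zero)
next
  fix k y assume y: "y \<in> chG g n k"
  then have "y \<in> chD g n (k + (2 * int g - 1))" by (intro chG_chD) simp
  moreover have "(\<lambda>Y. natmap y Y - y Y) \<in> relsG g n k"
    by (simp add: natmap_chG[OF y] relsG_def spanQ_zero)
  ultimately show "\<exists>x \<in> chD g n (k + (2 * int g - 1)). (\<lambda>Y. natmap x Y - y Y) \<in> relsG g n k"
    by blast
next
  fix p
  show "{x \<in> chD g n p. natmap x \<in> relsG g n (p - (2 * int g - 1))} =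
      spanQ (delta ` {X \<in> gensD g n p. \<exists>v < nv X. 0 < wt X v} \<union> relgensD g n p)"
    using natmap_kernel by (simp add: weighted_gens_def)
next
  fix k
  show "homology_iso (chD g n) (relsD g n) dD (chG g n) (relsG g n) dG natmap
      (k + (2 * int g - 1)) k"
    by (rule natmap_homology[OF assms(2)]) simp
qed

end
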